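(* Let $T>0$ and $d\ge 1$. Let $\|\cdot\|$ be a norm on $\mathbb{R}^d$ whose unit ball has $C^1$ boundary. Let $\mathscr{E}:[0,T]\times\mathbb{R}^d\to[0,+\infty)$ be of class $C^1$ and suppose that there is a constant $\lambda$ with $|\partial_t\mathscr{E}(s,x)|\le\lambda\,\mathscr{E}(s,x)$ for all $(s,x)\in[0,T]\times\mathbb{R}^d$. Let $\Psi:\mathbb{R}^d\to[0,\infty)$ be convex, positively $1$-homogeneous, and satisfy $\Psi(v)>0$ for all $v\in\mathbb{R}^d\setminus\{0\}$. Let $x_0\in\mathbb{R}^d$ be a local minimizer of the functional $x\mapsto\mathscr{E}(0,x)+\Psi(x-x_0)$. Then the following hold. (i) (Discretized solution) For any $\varepsilon>0$ and $\tau>0$ there exists a discretized solution $x^{\varepsilon,\tau}:[0,T]\to\mathbb{R}^d$ (as defined in the context). (ii) (Epsilon-neighborhood solution) For any fixed $\varepsilon>0$ there exists a sequence $\tau_n\to0$ such that $x^{\varepsilon,\tau_n}$ converges pointwise on $[0,T]$ to some limit $x^{\varepsilon}:[0,T]\to\mathbb{R}^d$. Moreover: - (Epsilon local stability) If $t\in[0,T)$ and $x^\varepsilon$ is right-continuous at $t$, namely $\lim_{t'\to t^+}x^\varepsilon(t')=x^\varepsilon(t)$, then $$\mathscr{E}(t,x^\varepsilon(t))\le\mathscr{E}(t,x)+\Psi(x-x^\varepsilon(t))\quad\text{for all } x\in\mathbb{R}^d \text{ with } \|x-x^\varepsilon(t)\|\le\varepsilon.$$ - (Energy-dissipation inequalities)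 $\mathrm{Diss}_\Psi(x^\varepsilon;[0,T])\le C$ with a constant $C$ independent of $\varepsilon$, $\partial_t\mathscr{E}(\cdot,x^\varepsilon(\cdot))\in L^1(0,T)$, and for all $0\le s\le t\le T$ $$-\mathrm{Diss}_{new}(x^\varepsilon;[s,t])\le\mathscr{E}(t,x^\varepsilon(t))-\mathscr{E}(s,x^\varepsilon(s))-\int_s^t\partial_t\mathscr{E}(r,x^\varepsilon(r))\,dr\le-\mathrm{Diss}_\Psi(x^\varepsilon;[s,t]).$$ (iii) (BV solution constructed by epsilon-neighborhoods) There exists a sequence $\varepsilon_n\to0$ such that $x^{\varepsilon_n}$ converges pointwise on $[0,T]$ to some BV function $u:[0,T]\to\mathbb{R}^d$. Furthermore, $u$ satisfies: - (Weak local stability) If $u$ is continuous at $t\in[0,T]$, then $-\nabla_x\mathscr{E}(t,u(t))\in\partial\Psi(0)$. - (New energy-dissipation balance) For all $0\le s\le t\le T$, $$\mathscr{E}(t,u(t))-\mathscr{E}(s,u(s))=\int_s^t\partial_t\mathscr{E}(r,u(r))\,dr-\mathrm{Diss}_{new}(u;[s,t]).$$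
   Context: Discretized solutions. Given $\varepsilon>0$, $\tau>0$, let $N$ be the nonnegative integer with $T\in[\tau N,\tau(N+1))$ and put $t_i=i\tau$, $i=0,\dots,N$. A sequence $(x_i^{\varepsilon,\tau})_{i=0}^N$ is defined by $x_0^{\varepsilon,\tau}=x_0$ and, for every $i\in\{1,\dots,N\}$, $$x_i^{\varepsilon,\tau}\in\operatorname{argmin}\{\mathscr{E}(t_i,x)+\Psi(x-x_{i-1}^{\varepsilon,\tau}) : x\in\mathbb{R}^d,\ \|x-x_{i-1}^{\varepsilon,\tau}\|\le\varepsilon\}.$$ The discretized solution is the piecewise constant function $x^{\varepsilon,\tau}(t)=x_{i-1}^{\varepsilon,\tau}$ for $t\in[t_{i-1},t_i)$, $i\in\{1,\dots,N\}$, and $x^{\varepsilon,\tau}(t)=x_N^{\varepsilon,\tau}$ for $t\in[t_N,T]$. Minimizers need not be unique; for each $(\varepsilon,\tau)$ one discretized solution $x^{\varepsilon,\tau}$ is fixed. In (iii), $x^{\varepsilon}$ denotes the limits obtained in (ii). Notation. A BV function $u:[0,T]\to\mathbb{R}^d$ is a function of bounded pointwise variation (defined at every point); it has one-sided limits $u(t^-)$, $u(t^+)$. The pairing between $(\mathbb{R}^d)^*$ and $\mathbb{R}^d$ is $\langle\cdot,\cdot\rangle$; the dual norm is $\|\eta\|_*=\sup_{v\neq0}|\langle\eta,v\rangle|/\|v\|$; $\nabla_x\mathscr{E}$ is the differential of $\mathscr{E}$ in $x$; and $$\partial\Psi(0)=\{\eta\in(\mathbb{R}^d)^* : \langle\eta,v\rangle\le\Psi(v)\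 \ \forall v\in\mathbb{R}^d\}.$$ Dissipations. For $t_1\le t_2$, $$\mathrm{Diss}_\Psi(u;[t_1,t_2])=\sup\Big\{\sum_{i=1}^N\Psi(u(s_i)-u(s_{i-1})) : N\in\mathbb{N},\ t_1=s_0<s_1<\dots<s_N=t_2\Big\}$$ (equal to $0$ if $t_1=t_2$). For $t\in[0,T]$ and $a,b\in\mathbb{R}^d$, $$\Delta_{new}(t;a,b)=\inf\Big\{\int_0^1\Big(\Psi(\dot\gamma(s))+\|\dot\gamma(s)\|\inf_{z\in\partial\Psi(0)}\|\nabla_x\mathscr{E}(t,\gamma(s))+z\|_*\Big)ds : \gamma\in AC([0,1];\mathbb{R}^d),\ \gamma(0)=a,\ \gamma(1)=b\Big\}.$$ Let $J$ be the set of $t\in[0,T]$ at which $u$ is not continuous. For $t_1<t_2$, $$\begin{aligned}\mathrm{Diss}_{new}(u;[t_1,t_2])={}&\mathrm{Diss}_\Psi(u;[t_1,t_2])+\sum_{t\in J\cap(t_1,t_2)}\big(\Delta_{new}(t;u(t^-),u(t))+\Delta_{new}(t;u(t),u(t^+))\big)\\&+\Delta_{new}(t_1;u(t_1),u(t_1^+))+\Delta_{new}(t_2;u(t_2^-),u(t_2))\\&-\sum_{t\in J\cap(t_1,t_2)}\big(\Psi(u(t)-u(t^-))+\Psi(u(t^+)-u(t))\big)\\&-\Psi(u(t_1^+)-u(t_1))-\Psi(u(t_2)-u(t_2^-)),\end{aligned}$$ and $\mathrm{Diss}_{new}(u;[t_1,t_1])=0$. *)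

theory Defs
  imports "HOL-Analysis.Analysis"
begin

definition is_norm :: "('a::real_vector \<Rightarrow> real) \<Rightarrow> bool" where
  "is_norm nrm \<longleftrightarrow>
     (\<forall>x. 0 \<le> nrm x) \<and> (\<forall>x. nrm x = 0 \<longleftrightarrow> x = 0) \<and>
     (\<forall>c x. nrm (c *\<^sub>R x) = \<bar>c\<bar> * nrm x) \<and>
     (\<forall>x y. nrm (x + y) \<le> nrm x + nrm y)"

(* On a set with boundary, such as {0..T} \<times> UNIV, the derivative is taken within the set. *)
definition C1_on :: "'a::real_normed_vector set \<Rightarrow> ('a \<Rightarrow> 'b::real_normed_vector) \<Rightarrow> bool" where
  "C1_on S f \<longleftrightarrow>
     (\<exists>f' :: 'a \<Rightarrow> 'a \<Rightarrow>\<^sub>L 'b.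
        (\<forall>x\<in>S. (f has_derivative blinfun_apply (f' x)) (at x within S)) \<and> continuous_on S f')"

(* K is, near each of its boundary points, a sublevel set of a C1 function without critical points. *)
definition has_C1_boundary :: "'a::euclidean_space set \<Rightarrow> bool" where
  "has_C1_boundary K \<longleftrightarrow>
     (\<forall>p\<in>frontier K. \<exists>U (g :: 'a \<Rightarrow> real). open U \<and> p \<in> U \<and> C1_on U g \<and>
        (\<forall>x\<in>U. \<not> (g has_derivative (\<lambda>h. 0)) (at x)) \<and>
        K \<inter> U = {x \<in> U. g x \<le> 0})"

(* The dual of R^d is the type of bounded linear functionals; its built-in norm is the one dual to
   the Euclidean norm, so the norm dual to nrm is defined separately. *)
definition dual_norm :: "('a::real_normed_vector \<Rightarrow> real) \<Rightarrow> ('a \<Rightarrow>\<^sub>L real) \<Rightarrow> real" where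
  "dual_norm nrm \<eta> = (SUP v\<in>-{0}. \<bar>blinfun_apply \<eta> v\<bar> / nrm v)"

definition subdiff0 :: "('a::real_normed_vector \<Rightarrow> real) \<Rightarrow> ('a \<Rightarrow>\<^sub>L real) set" where
  "subdiff0 \<Psi> = {\<eta>. \<forall>v. blinfun_apply \<eta> v \<le> \<Psi> v}"

(* One-sided at the end points 0 and T. *)
definition dt :: "real \<Rightarrow> (real \<Rightarrow> 'a \<Rightarrow> real) \<Rightarrow> real \<Rightarrow> 'a \<Rightarrow> real" where
  "dt T E t x = vector_derivative (\<lambda>s. E s x) (at t within {0..T})"

definition dx :: "(real \<Rightarrow> 'a::real_normed_vector \<Rightarrow> real) \<Rightarrow> real \<Rightarrow> 'a \<Rightarrow> ('a \<Rightarrow>\<^sub>L real)" where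
  "dx E t x = Blinfun (frechet_derivative (E t) (at x))"

definition discretized_solution ::
  "('a::real_normed_vector \<Rightarrow> real) \<Rightarrow> real \<Rightarrow> (real \<Rightarrow> 'a \<Rightarrow> real) \<Rightarrow> ('a \<Rightarrow> real) \<Rightarrow> 'a \<Rightarrow>
   real \<Rightarrow> real \<Rightarrow> (real \<Rightarrow> 'a) \<Rightarrow> bool" where
  "discretized_solution nrm T E \<Psi> x0 \<epsilon> \<tau> x \<longleftrightarrow>
     (\<exists>(N::nat) (y :: nat \<Rightarrow> 'a).
        \<tau> * real N \<le> T \<and> T < \<tau> * (real N + 1) \<and>
        y 0 = x0 \<and>
        (\<forall>i\<in>{1..N}. is_arg_min (\<lambda>z. E (real i * \<tau>) z + \<Psi> (z - y (i - 1)))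
                               (\<lambda>z. nrm (z - y (i - 1)) \<le> \<epsilon>) (y i)) \<and>
        (\<forall>i\<in>{1..N}. \<forall>t\<in>{real (i - 1) * \<tau>..<real i * \<tau>}. x t = y (i - 1)) \<and>
        (\<forall>t\<in>{real N * \<tau>..T}. x t = y N))"

(* The argument Y maps a time step to the discretized solution chosen for it. *)
definition eps_neighborhood_solution ::
  "real \<Rightarrow> (real \<Rightarrow> real \<Rightarrow> 'a::topological_space) \<Rightarrow> (real \<Rightarrow> 'a) \<Rightarrow> bool" where
  "eps_neighborhood_solution T Y x \<longleftrightarrow>
     (\<exists>\<tau> :: nat \<Rightarrow> real. (\<forall>n. 0 < \<tau> n) \<and> \<tau> \<longlonglongrightarrow> 0 \<and>
        (\<forall>t\<in>{0..T}. (\<lambda>n. Y (\<tau> n) t) \<longlonglongrightarrow> x t))"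

(* For t1 = t2 the only admissible partition has N = 0, so that the value is 0. *)
definition Diss :: "('a::ab_group_add \<Rightarrow> real) \<Rightarrow> (real \<Rightarrow> 'a) \<Rightarrow> real \<Rightarrow> real \<Rightarrow> ereal" where
  "Diss \<Psi> u t1 t2 =
     Sup {ereal (\<Sum>i\<in>{1..N}. \<Psi> (u (s i) - u (s (i - 1)))) | (N::nat) (s :: nat \<Rightarrow> real).
            s 0 = t1 \<and> s N = t2 \<and> (\<forall>i\<in>{1..N}. s (i - 1) < s i)}"

definition BV_on :: "real \<Rightarrow> real \<Rightarrow> (real \<Rightarrow> 'a::real_normed_vector) \<Rightarrow> bool" where
  "BV_on a b u \<longleftrightarrow> Diss norm u a b < \<infinity>"

definition AC_on :: "real \<Rightarrow> real \<Rightarrow> (real \<Rightarrow> 'a::real_normed_vector) \<Rightarrow> bool" where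
  "AC_on a b \<gamma> \<longleftrightarrow>
     (\<forall>e>0. \<exists>\<delta>>0. \<forall>(n::nat) (l :: nat \<Rightarrow> real) (r :: nat \<Rightarrow> real).
        (\<forall>i<n. a \<le> l i \<and> l i \<le> r i \<and> r i \<le> b) \<and>
        disjoint_family_on (\<lambda>i. {l i<..<r i}) {..<n} \<and>
        (\<Sum>i<n. r i - l i) < \<delta> \<longrightarrow> (\<Sum>i<n. norm (\<gamma> (r i) - \<gamma> (l i))) < e)"

(* An absolutely continuous curve is differentiable outside a null set, which does not affect
   the integral. *)
definition Delta_new ::
  "('a::euclidean_space \<Rightarrow> real) \<Rightarrow> (real \<Rightarrow> 'a \<Rightarrow> real) \<Rightarrow> ('a \<Rightarrow> real) \<Rightarrow> real \<Rightarrow> 'a \<Rightarrow> 'a \<Rightarrow> ereal" where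
  "Delta_new nrm E \<Psi> t a b =
     enn2ereal (INF \<gamma>\<in>{\<gamma>. AC_on 0 1 \<gamma> \<and> \<gamma> 0 = a \<and> \<gamma> 1 = b}.
       \<integral>\<^sup>+s\<in>{0..1}. ennreal
          (\<Psi> (vector_derivative \<gamma> (at s)) +
           nrm (vector_derivative \<gamma> (at s)) *
             (INF z\<in>subdiff0 \<Psi>. dual_norm nrm (dx E t (\<gamma> s) + z))) \<partial>lebesgue)"

abbreviation left_lim :: "(real \<Rightarrow> 'a::t2_space) \<Rightarrow> real \<Rightarrow> 'a" where
  "left_lim u t \<equiv> Lim (at_left t) u"

abbreviation right_lim :: "(real \<Rightarrow> 'a::t2_space) \<Rightarrow> real \<Rightarrow> 'a" where
  "right_lim u t \<equiv> Lim (at_right t) u"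

definition jump_set :: "real \<Rightarrow> (real \<Rightarrow> 'a::topological_space) \<Rightarrow> real set" where
  "jump_set T u = {t \<in> {0..T}. \<not> continuous (at t within {0..T}) u}"

(* Meant for u of bounded variation, where all terms are finite. *)
definition Diss_new ::
  "('a::euclidean_space \<Rightarrow> real) \<Rightarrow> real \<Rightarrow> (real \<Rightarrow> 'a \<Rightarrow> real) \<Rightarrow> ('a \<Rightarrow> real) \<Rightarrow>
   (real \<Rightarrow> 'a) \<Rightarrow> real \<Rightarrow> real \<Rightarrow> ereal" where
  "Diss_new nrm T E \<Psi> u t1 t2 =
     (if t1 = t2 then 0 else
        Diss \<Psi> u t1 t2
        + (\<Sum>\<^sub>\<infinity>t\<in>jump_set T u \<inter> {t1<..<t2}.
             Delta_new nrm E \<Psi> t (left_lim u t) (u t) + Delta_new nrm E \<Psi> t (u t) (right_lim u t))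
        + Delta_new nrm E \<Psi> t1 (u t1) (right_lim u t1)
        + Delta_new nrm E \<Psi> t2 (left_lim u t2) (u t2)
        - (\<Sum>\<^sub>\<infinity>t\<in>jump_set T u \<inter> {t1<..<t2}.
             ereal (\<Psi> (u t - left_lim u t) + \<Psi> (right_lim u t - u t)))
        - ereal (\<Psi> (right_lim u t1 - u t1))
        - ereal (\<Psi> (u t2 - left_lim u t2)))"

end

theory Submission
  imports Defs "HOL-Complex_Analysis.Great_Picard"
begin

text \<open>
  The incremental problems give \<open>\<Psi> (x t - x s) \<le> G x s t\<close> for the released energy
  \<open>G x s t = E s (x s) - E t (x t) + \<integral> dt E\<close>. This inequality controls the variation, is closed under
  pointwise limits, and so yields compactness (Helly) and the upper energy estimate. Conversely, a
  curve that is stable outside a countable set satisfies \<open>G \<le> Diss_new\<close>: near a given time the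
  first-order expansion of the energy at the one-sided limits, which are stable, bounds \<open>G\<close> by \<open>\<Psi>\<close>
  plus the transition cost of the jump, and these local bounds are glued by bisection.

  For the opposite inequality in the limit, let \<open>v\<close> be a step of the scheme. Since \<open>v\<close> minimizes
  \<open>\<langle>\<xi>, \<cdot>\<rangle> + \<Psi>\<close> over the ball of radius \<open>\<epsilon>\<close>, where \<open>\<xi>\<close> is the differential at the new point, a separation
  argument gives \<open>- \<langle>\<xi>, v\<rangle> \<ge> \<Psi> v + nrm v * inf (dual_norm (\<xi> + z))\<close>. Hence the energy released on a short time
  interval bounds, up to a small error, the cost of the polygon through the discrete points, and with
  it the transition cost between the one-sided limits of the limit curve.
\<close>

section \<open>Total variation with respect to a dissipation\<close>

text \<open>Since \<open>Delta_new\<close> is an infimum over all absolutely continuous curves, its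
  two estimates differ in weight. An upper bound needs one polygon; a lower bound needs a chain rule
  along every competitor, hence the theory of variation, densities and almost everywhere
  differentiability for \<open>AC_on\<close>. A limit curve keeps no trace of the discrete path
  followed inside a jump. What is carried through both limits is therefore an estimate between
  arbitrary points \<open>p\<close> and \<open>q\<close> over a short time window, with terms
  \<open>K * \<Psi>\<close> that pay for the mismatch between these points and the curve. The
  mismatch disappears only at the end, when the window shrinks to the jump time and
  \<open>p\<close>, \<open>q\<close> are the value and a one-sided limit of the limit curve.
  Stability is inherited by the limit only off the countable union of the jump sets of its
  approximations. This suffices, because every interval meets the complement and the stability
  condition is closed, so that one-sided limits are stable at all times. All constants uniform in
  \<epsilon> and \<tau> go back to a Gronwall estimate for the energy.\<close>

lemma partition_mono:
  fixes s :: "nat \<Rightarrow> real"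
  assumes "\<forall>i\<in>{1..N}. s (i - 1) < s i" "i \<le> j" "j \<le> N"
  shows "s i \<le> s j"
  using assms(2,3)
proof (induction rule: dec_induct)
  case (step k)
  then show ?case using assms(1) by (auto dest!: bspec[of _ _ "Suc k"])
qed auto

text \<open>Partition sums telescope against the potential \<phi>. Potentials used later are the
  variation function of a prefix and the released energy \<open>G x 0\<close>, possibly divided by a
  constant.\<close>

lemma Diss_le:
  fixes \<phi> :: "real \<Rightarrow> real"
  assumes "\<And>s t. \<lbrakk>a \<le> s; s < t; t \<le> b\<rbrakk> \<Longrightarrow> \<Psi> (u t - u s) \<le> \<phi> t - \<phi> s"
  shows "Diss \<Psi> u a b \<le> ereal (\<phi> b - \<phi> a)"
  unfolding Diss_def
proof (rule Sup_least, clarify)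
  fix N :: nat and s :: "nat \<Rightarrow> real"
  assume s: "\<forall>i\<in>{1..N}. s (i - 1) < s i" "a = s 0" "b = s N"
  have less_step: "s i < s (Suc i)" if "Suc i \<le> N" for i
    using s(1) that by (auto dest!: bspec[of _ _ "Suc i"])
  note mono = partition_mono[OF s(1)]
  have "(\<Sum>i\<in>{1..n}. \<Psi> (u (s i) - u (s (i - 1)))) \<le> \<phi> (s n) - \<phi> (s 0)" if "n \<le> N" for n
    using that
  proof (induction n)
    case (Suc n)
    have "\<Psi> (u (s (Suc n)) - u (s n)) \<le> \<phi> (s (Suc n)) - \<phi> (s n)"
      using Suc.prems s less_step[of n] mono[of 0 n] mono[of "Suc n" N] by (intro assms) auto
    with Suc show ?case by simp
  qed simp
  then show "ereal (\<Sum>i\<in>{1..N}. \<Psi> (u (s i) - u (s (i - 1)))) \<le> ereal (\<phi> (s N) - \<phi> (s 0))"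
    by simp
qed

text \<open>A partition of the prefix stays a partition after the point \<open>t\<close> is
  appended. This makes prefixes of a finite dissipation finite and turns the prefix dissipation into
  a potential for the increments.\<close>

lemma Diss_append:
  assumes "a \<le> s" "s < t" "Diss \<Psi> u a t \<le> ereal c"
  shows "Diss \<Psi> u a s \<le> ereal (c - \<Psi> (u t - u s))"
  unfolding Diss_def
proof (rule Sup_least, clarify)
  fix N :: nat and p :: "nat \<Rightarrow> real"
  assume p: "\<forall>i\<in>{1..N}. p (i - 1) < p i" "a = p 0" "s = p N"
  define q where "q = (\<lambda>i. if i \<le> N then p i else t)"
  have "ereal (\<Sum>i\<in>{1..Suc N}. \<Psi> (u (q i) - u (q (i - 1)))) \<le> Diss \<Psi> u a t"
    unfolding Diss_def
  proof (rule Sup_upper, intro CollectI exI conjI ballI refl)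
    show "q (i - 1) < q i" if "i \<in> {1..Suc N}" for i
    proof (cases "i = Suc N")
      case True then show ?thesis using p assms by (simp add: q_def)
    next
      case False
      with that have "i \<in> {1..N}" by auto
      then show ?thesis using p(1) by (auto simp: q_def)
    qed
  qed (use p in \<open>auto simp: q_def\<close>)
  also have "(\<Sum>i\<in>{1..Suc N}. \<Psi> (u (q i) - u (q (i - 1))))
      = (\<Sum>i\<in>{1..N}. \<Psi> (u (p i) - u (p (i - 1)))) + \<Psi> (u t - u (p N))"
    by (auto simp: q_def intro!: sum.cong)
  finally show "ereal (\<Sum>i\<in>{1..N}. \<Psi> (u (p i) - u (p (i - 1)))) \<le> ereal (c - \<Psi> (u t - u (p N)))"
    using order_trans[OF _ assms(3)] p(3) by fastforce
qed

lemma Diss_refl [simp]: "Diss \<Psi> u a a = 0"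
proof (rule antisym)
  show "Diss \<Psi> u a a \<le> 0"
    using Diss_le[of a a \<Psi> u "\<lambda>_. 0"] by (simp add: zero_ereal_def)
  have "ereal (\<Sum>i\<in>{1..0::nat}. \<Psi> (u ((\<lambda>_. a) i) - u ((\<lambda>_. a) (i - 1)))) \<le> Diss \<Psi> u a a"
    unfolding Diss_def by (rule Sup_upper, intro CollectI exI[of _ "0::nat"] exI[of _ "\<lambda>_. a"]) auto
  then show "0 \<le> Diss \<Psi> u a a" by (simp add: zero_ereal_def)
qed

lemma Diss_ge:
  assumes "s < t"
  shows "ereal (\<Psi> (u t - u s)) \<le> Diss \<Psi> u s t"
proof -
  have "ereal (\<Sum>i\<in>{1..1::nat}. \<Psi> (u ((\<lambda>i. if i = 0 then s else t) i)
      - u ((\<lambda>i. if i = 0 then s else t) (i - 1)))) \<le> Diss \<Psi> u s t"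
    unfolding Diss_def
    by (rule Sup_upper, intro CollectI exI[of _ "1::nat"] exI[of _ "\<lambda>i::nat. if i = 0 then s else t"])
      (use assms in auto)
  then show ?thesis by simp
qed

lemma Diss_nonneg:
  assumes "s \<le> t" "\<And>v. 0 \<le> \<Psi> v"
  shows "0 \<le> Diss \<Psi> u s t"
  using Diss_ge[of s t \<Psi> u] assms by (cases "s = t") (auto intro: order_trans[rotated])

locale finite_diss =
  fixes \<Psi> :: "'a::real_vector \<Rightarrow> real" and u :: "real \<Rightarrow> 'a" and a b :: real
  assumes ab: "a \<le> b" and nonneg: "\<And>v. 0 \<le> \<Psi> v" and \<Psi>0: "\<Psi> 0 = 0"
    and triangle: "\<And>v w. \<Psi> (v + w) \<le> \<Psi> v + \<Psi> w"
    and finite_Diss: "Diss \<Psi> u a b < \<infinity>"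
begin

text \<open>\<open>real_of_ereal\<close> sends infinity to 0, so the values carry information only
  for subintervals of \<open>{a..b}\<close>, where the dissipation is finite.\<close>

definition D where "D s t = real_of_ereal (Diss \<Psi> u s t)"

lemma Diss_prefix: assumes "a \<le> t" "t \<le> b" shows "Diss \<Psi> u a t = ereal (D a t)"
proof -
  obtain c where c: "Diss \<Psi> u a b \<le> ereal c"
    using finite_Diss by (cases "Diss \<Psi> u a b") auto
  have "Diss \<Psi> u a t \<le> ereal c"
  proof (cases "t = b")
    case False
    then have "Diss \<Psi> u a t \<le> ereal (c - \<Psi> (u b - u t))"
      using assms c by (intro Diss_append) auto
    also have "\<dots> \<le> ereal c" using nonneg by simp
    finally show ?thesis .
  qed (use c in auto)
  then show ?thesis
    using Diss_nonneg[OF assms(1), of \<Psi> u, OF nonneg] unfolding D_def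
    by (cases "Diss \<Psi> u a t") auto
qed

lemma D_append: assumes "a \<le> s" "s \<le> t" "t \<le> b" shows "\<Psi> (u t - u s) \<le> D a t - D a s"
proof (cases "s = t")
  case False
  then have "Diss \<Psi> u a s \<le> ereal (D a t - \<Psi> (u t - u s))"
    using assms Diss_prefix[of t] by (intro Diss_append) auto
  then show ?thesis using assms Diss_prefix[of s] by auto
qed (simp add: \<Psi>0)

lemma Diss_eq: assumes "a \<le> s" "s \<le> t" "t \<le> b" shows "Diss \<Psi> u s t = ereal (D s t)"
proof -
  have "Diss \<Psi> u s t \<le> ereal (D a t - D a s)"
    using assms by (intro Diss_le D_append) auto
  then show ?thesis
    using Diss_nonneg[OF assms(2), of \<Psi> u, OF nonneg] unfolding D_def
    by (cases "Diss \<Psi> u s t") auto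
qed

lemma D_nonneg: "s \<le> t \<Longrightarrow> 0 \<le> D s t"
  unfolding D_def by (simp add: Diss_nonneg nonneg real_of_ereal_pos)

lemma D_refl [simp]: "D s s = 0"
  by (simp add: D_def)

lemma D_ge: assumes "a \<le> s" "s \<le> t" "t \<le> b" shows "\<Psi> (u t - u s) \<le> D s t"
  using Diss_ge[of s t \<Psi> u] Diss_eq[OF assms] assms \<Psi>0 by (cases "s = t") auto

lemma D_le:
  assumes "a \<le> s" "s \<le> t" "t \<le> b"
    and "\<And>p q. \<lbrakk>s \<le> p; p < q; q \<le> t\<rbrakk> \<Longrightarrow> \<Psi> (u q - u p) \<le> \<phi> q - \<phi> p"
  shows "D s t \<le> \<phi> t - \<phi> s"
proof -
  have "Diss \<Psi> u s t \<le> ereal (\<phi> t - \<phi> s)"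
    by (rule Diss_le) (rule assms(4))
  then show ?thesis unfolding Diss_eq[OF assms(1-3)] by simp
qed

end

text \<open>Finiteness on the union of the two intervals is part of what is gained, so only the two
  halves are assumed finite; the bisection argument for absolutely continuous curves relies on
  this.\<close>

lemma Diss_triangle:
  assumes "finite_diss \<Psi> u s r" "finite_diss \<Psi> u r t"
  shows "Diss \<Psi> u s t \<le> Diss \<Psi> u s r + Diss \<Psi> u r t"
proof -
  interpret s: finite_diss \<Psi> u s r by fact
  interpret r: finite_diss \<Psi> u r t by fact
  \<comment> \<open>The two variation functions are glued continuously in value at \<open>r\<close>;
    an increment across \<open>r\<close> is split there by the triangle inequality for
    \<Psi>.\<close>
  define \<phi> where "\<phi> = (\<lambda>q. if q \<le> r then s.D s q else s.D s r + s.D r q)"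
  have "Diss \<Psi> u s t \<le> ereal (\<phi> t - \<phi> s)"
  proof (rule Diss_le)
    fix p q assume pq: "s \<le> p" "p < q" "q \<le> t"
    consider "q \<le> r" | "p \<le> r" "r < q" | "r < p" by linarith
    then show "\<Psi> (u q - u p) \<le> \<phi> q - \<phi> p"
    proof cases
      case 1 then show ?thesis using pq s.D_append[of p q] by (simp add: \<phi>_def)
    next
      case 2
      have "\<Psi> (u q - u p) \<le> \<Psi> (u q - u r) + \<Psi> (u r - u p)"
        using s.triangle[of "u q - u r" "u r - u p"] by simp
      then show ?thesis using 2 pq s.D_append[of p r] r.D_ge[of r q] by (simp add: \<phi>_def)
    next
      case 3 then show ?thesis using pq s.ab r.D_append[of p q] by (simp add: \<phi>_def)
    qed
  qed
  also have "\<phi> t - \<phi> s = s.D s r + s.D r t"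
    using s.ab r.ab by (cases "t = r") (auto simp: \<phi>_def)
  finally show ?thesis
    using s.Diss_eq[of s r] r.Diss_eq[of r t] s.ab r.ab by simp
qed

context finite_diss
begin

lemma finite_diss_sub: "a \<le> s \<Longrightarrow> s \<le> t \<Longrightarrow> t \<le> b \<Longrightarrow> finite_diss \<Psi> u s t"
  by unfold_locales (simp_all add: nonneg \<Psi>0 triangle Diss_eq)

text \<open>One inequality uses \<open>D s\<close> as a potential on the second interval, the other
  is \<open>Diss_triangle\<close>.\<close>

lemma D_add:
  assumes "a \<le> s" "s \<le> r" "r \<le> t" "t \<le> b"
  shows "D s r + D r t = D s t"
proof (rule antisym)
  interpret s: finite_diss \<Psi> u s b using assms by (intro finite_diss_sub) auto
  have "D r t \<le> D s t - D s r"
    using assms by (intro D_le[where \<phi> = "D s"] s.D_append) auto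
  then show "D s r + D r t \<le> D s t" by simp
  show "D s t \<le> D s r + D r t"
    using Diss_triangle[OF finite_diss_sub finite_diss_sub, of s r t] assms by (simp add: Diss_eq)
qed

end

lemma partition_disjoint:
  fixes s :: "nat \<Rightarrow> real"
  assumes "\<forall>i\<in>{1..N}. s (i - 1) < s i"
  shows "disjoint_family_on (\<lambda>i. {s (i - 1)<..<s i}) {1..N}"
proof -
  have "{s (i - 1)<..<s i} \<inter> {s (j - 1)<..<s j} = {}" if "i < j" "j \<le> N" for i j
  proof -
    have "s i \<le> s (j - 1)"
      using that by (intro partition_mono[OF assms]) auto
    then show ?thesis by (auto simp: min_le_iff_disj le_max_iff_disj)
  qed
  then show ?thesis
    unfolding disjoint_family_on_def by (metis Int_commute atLeastAtMost_iff linorder_neqE_nat)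
qed

lemma partition_sum: "(\<Sum>i\<in>{1..N}. s i - s (i - 1)) = s N - (s 0 :: real)" for N :: nat
  by (induction N) auto

text \<open>Refining a family of intervals produces cells indexed by pairs, and grid arguments
  select a subset of indices; neither is an initial segment of the naturals as in
  \<open>AC_on\<close>.\<close>

lemma AC_on_finite_index:
  assumes "AC_on a b \<gamma>" "0 < e"
  obtains \<delta> where "0 < \<delta>"
    "\<And>(I :: 'i set) l r. \<lbrakk>finite I; \<And>i. i \<in> I \<Longrightarrow> a \<le> l i \<and> l i \<le> r i \<and> r i \<le> b;
       disjoint_family_on (\<lambda>i. {l i<..<r i}) I; (\<Sum>i\<in>I. r i - l i) < \<delta>\<rbrakk>
       \<Longrightarrow> (\<Sum>i\<in>I. norm (\<gamma> (r i) - \<gamma> (l i))) < e"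
proof -
  obtain \<delta> where "0 < \<delta>" and \<delta>0: "\<forall>(n::nat) l r.
      (\<forall>i<n. a \<le> l i \<and> l i \<le> r i \<and> r i \<le> b) \<and> disjoint_family_on (\<lambda>i. {l i<..<r i}) {..<n} \<and>
       (\<Sum>i<n. r i - l i) < \<delta> \<longrightarrow> (\<Sum>i<n. norm (\<gamma> (r i) - \<gamma> (l i))) < e"
    using assms(1)[unfolded AC_on_def, rule_format, OF assms(2)] by (elim exE conjE) (rule that)
  note \<delta> = \<delta>0[rule_format, OF conjI, OF _ conjI]
  show thesis
  proof (rule that[OF \<open>0 < \<delta>\<close>])
    fix I :: "'i set" and l r :: "'i \<Rightarrow> real"
    assume I: "finite I" "\<And>i. i \<in> I \<Longrightarrow> a \<le> l i \<and> l i \<le> r i \<and> r i \<le> b"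
      "disjoint_family_on (\<lambda>i. {l i<..<r i}) I" "(\<Sum>i\<in>I. r i - l i) < \<delta>"
    obtain g where g: "bij_betw g {..<card I} I"
      using ex_bij_betw_nat_finite[OF I(1)] by (auto simp: atLeast0LessThan)
    have sum_g: "(\<Sum>i\<in>I. f i) = (\<Sum>k<card I. f (g k))" for f :: "'i \<Rightarrow> real"
      using sum.reindex_bij_betw[OF g, of f] by simp
    have gI: "g k \<in> I" if "k < card I" for k
      using bij_betwE[OF g] that by simp
    have "(\<Sum>k<card I. norm (\<gamma> (r (g k)) - \<gamma> (l (g k)))) < e"
    proof (rule \<delta>)
      show "\<forall>i<card I. a \<le> l (g i) \<and> l (g i) \<le> r (g i) \<and> r (g i) \<le> b"
        using I(2)[OF gI] by simp
      show "disjoint_family_on (\<lambda>i. {l (g i)<..<r (g i)}) {..<card I}"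
        using I(3) gI bij_betw_imp_inj_on[OF g]
        unfolding disjoint_family_on_def inj_on_def by (meson lessThan_iff)
      show "(\<Sum>i<card I. r (g i) - l (g i)) < \<delta>"
        using I(4) sum_g[of "\<lambda>i. r i - l i"] by simp
    qed
    then show "(\<Sum>i\<in>I. norm (\<gamma> (r i) - \<gamma> (l i))) < e"
      using sum_g[of "\<lambda>i. norm (\<gamma> (r i) - \<gamma> (l i))"] by simp
  qed
qed

section \<open>Absolutely continuous curves\<close>

lemma finite_diss_norm: "a \<le> b \<Longrightarrow> Diss norm F a b < \<infinity> \<Longrightarrow> finite_diss norm F a b"
  by unfold_locales (auto simp: norm_triangle_ineq)

text \<open>The cells of a partition are disjoint, so an interval shorter than the \<delta>
  belonging to 1 has variation at most 1. Finiteness passes to unions of adjacent intervals, and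
  bisection covers \<open>{a..b}\<close>.\<close>

lemma AC_on_finite_variation:
  fixes F :: "real \<Rightarrow> 'a::real_normed_vector"
  assumes "AC_on a b F" "a \<le> b"
  shows "Diss norm F a b < \<infinity>"
proof -
  obtain \<delta> where "0 < \<delta>" and \<delta>:
    "\<And>(I :: nat set) l r. \<lbrakk>finite I; \<And>i. i \<in> I \<Longrightarrow> a \<le> l i \<and> l i \<le> r i \<and> r i \<le> b;
       disjoint_family_on (\<lambda>i. {l i<..<r i}) I; (\<Sum>i\<in>I. r i - l i) < \<delta>\<rbrakk>
       \<Longrightarrow> (\<Sum>i\<in>I. norm (F (r i) - F (l i))) < 1"
    using AC_on_finite_index[OF assms(1), of 1, where ?'i = nat] by auto
  have loc: "Diss norm F s t \<le> ereal 1" if st: "a \<le> s" "s \<le> t" "t \<le> b" "t - s < \<delta>" for s t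
    unfolding Diss_def
  proof (rule Sup_least, clarify)
    fix N :: nat and p :: "nat \<Rightarrow> real"
    assume p: "\<forall>i\<in>{1..N}. p (i - 1) < p i" "s = p 0" "t = p N"
    have "(\<Sum>i\<in>{1..N}. norm (F (p i) - F (p (i - 1)))) < 1"
    proof (rule \<delta>)
      show "a \<le> p (i - 1) \<and> p (i - 1) \<le> p i \<and> p i \<le> b" if "i \<in> {1..N}" for i
      proof -
        have "p 0 \<le> p (i - 1)" "p (i - 1) \<le> p i" "p i \<le> p N"
          using that by (auto intro!: partition_mono[OF p(1)])
        then show ?thesis using p st by simp
      qed
    qed (use p st partition_sum[of p N] partition_disjoint[OF p(1)] in auto)
    then show "ereal (\<Sum>i\<in>{1..N}. norm (F (p i) - F (p (i - 1)))) \<le> ereal 1"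
      by simp
  qed
  define P where "P = (\<lambda>s t. a \<le> s \<and> s \<le> t \<and> t \<le> b \<longrightarrow> Diss norm F s t < \<infinity>)"
  have "P a b"
    using \<open>a \<le> b\<close>
  proof (induction rule: Bolzano)
    case (trans s r t)
    show ?case
      unfolding P_def
    proof
      assume *: "a \<le> s \<and> s \<le> t \<and> t \<le> b"
      with trans have fin: "Diss norm F s r < \<infinity>" "Diss norm F r t < \<infinity>"
        unfolding P_def by auto
      then have "finite_diss norm F s r" "finite_diss norm F r t"
        using trans(3,4) by (simp_all add: finite_diss_norm)
      then have "Diss norm F s t \<le> Diss norm F s r + Diss norm F r t"
        by (rule Diss_triangle)
      also have "\<dots> < \<infinity>"
        using fin by simp
      finally show "Diss norm F s t < \<infinity>" .
    qed
  next
    case (local x)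
    have "Diss norm F s t < \<infinity>" if "a \<le> s \<and> s \<le> t \<and> t \<le> b" "t - s < \<delta>" for s t
      using order.strict_trans1[OF loc[of s t], of \<infinity>] that by simp
    then show ?case using \<open>0 < \<delta>\<close> unfolding P_def by blast
  qed
  then show ?thesis using assms(2) unfolding P_def by blast
qed

lemma (in finite_diss) partition_approx:
  assumes "a \<le> s" "s \<le> t" "t \<le> b" "0 < e"
  obtains N :: nat and p where "p 0 = s" "p N = t" "\<forall>i\<in>{1..N}. p (i - 1) < p i"
    "D s t - e < (\<Sum>i\<in>{1..N}. \<Psi> (u (p i) - u (p (i - 1))))"
proof -
  have "ereal (D s t - e) < Diss \<Psi> u s t"
    using Diss_eq[OF assms(1-3)] assms(4) by simp
  then show thesis
    unfolding Diss_def less_Sup_iff using that by auto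
qed

text \<open>Each interval of a short family is replaced by a partition that nearly attains its
  variation. All cells together form a disjoint family of the same total length, to which absolute
  continuity of \<open>F\<close> applies.\<close>

lemma AC_on_variation:
  fixes F :: "real \<Rightarrow> 'a::real_normed_vector"
  assumes F: "AC_on a b F" and "a \<le> b"
  shows "AC_on a b (\<lambda>t. real_of_ereal (Diss norm F a t))"
proof -
  interpret finite_diss norm F a b
    using AC_on_finite_variation[OF assms] \<open>a \<le> b\<close> by (rule finite_diss_norm[rotated])
  have "AC_on a b (D a)"
    unfolding AC_on_def
  proof (intro allI impI)
    fix e :: real assume "0 < e"
    obtain \<delta> where "0 < \<delta>" and \<delta>:
      "\<And>(I :: (nat \<times> nat) set) l r. \<lbrakk>finite I; \<And>i. i \<in> I \<Longrightarrow> a \<le> l i \<and> l i \<le> r i \<and> r i \<le> b;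
         disjoint_family_on (\<lambda>i. {l i<..<r i}) I; (\<Sum>i\<in>I. r i - l i) < \<delta>\<rbrakk>
         \<Longrightarrow> (\<Sum>i\<in>I. norm (F (r i) - F (l i))) < e / 2"
      using AC_on_finite_index[OF F, of "e / 2", where ?'i = "nat \<times> nat"] \<open>0 < e\<close> by auto
    show "\<exists>\<delta>>0. \<forall>(n::nat) l r. (\<forall>i<n. a \<le> l i \<and> l i \<le> r i \<and> r i \<le> b) \<and>
      disjoint_family_on (\<lambda>i. {l i<..<r i}) {..<n} \<and> (\<Sum>i<n. r i - l i) < \<delta> \<longrightarrow>
      (\<Sum>i<n. norm (D a (r i) - D a (l i))) < e"
    proof (intro exI[of _ \<delta>] conjI allI impI \<open>0 < \<delta>\<close>)
      fix n :: nat and l r :: "nat \<Rightarrow> real"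
      assume *: "(\<forall>i<n. a \<le> l i \<and> l i \<le> r i \<and> r i \<le> b) \<and>
        disjoint_family_on (\<lambda>i. {l i<..<r i}) {..<n} \<and> (\<Sum>i<n. r i - l i) < \<delta>"
      \<comment> \<open>The \<open>n\<close> approximation errors add up to at most
        \<open>e / 2\<close>; adding 1 covers \<open>n = 0\<close>.\<close>
      define d where "d = e / (2 * (real n + 1))"
      have "0 < d" "real n * d \<le> e / 2"
        using \<open>0 < e\<close> by (auto simp: d_def field_simps)
      have "\<forall>i\<in>{..<n}. \<exists>(N::nat) p. p 0 = l i \<and> p N = r i \<and> (\<forall>i\<in>{1..N}. p (i - 1) < p i) \<and>
          D (l i) (r i) - d < (\<Sum>i\<in>{1..N}. norm (F (p i) - F (p (i - 1))))"
      proof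
        fix i assume "i \<in> {..<n}"
        with * have "a \<le> l i" "l i \<le> r i" "r i \<le> b" by auto
        from partition_approx[OF this \<open>0 < d\<close>] show "\<exists>(N::nat) p. p 0 = l i \<and> p N = r i \<and>
            (\<forall>i\<in>{1..N}. p (i - 1) < p i) \<and>
            D (l i) (r i) - d < (\<Sum>i\<in>{1..N}. norm (F (p i) - F (p (i - 1))))" by blast
      qed
      from bchoice[OF this] obtain N :: "nat \<Rightarrow> nat" where "\<forall>i\<in>{..<n}. \<exists>p. p 0 = l i \<and> p (N i) = r i \<and>
          (\<forall>k\<in>{1..N i}. p (k - 1) < p k) \<and>
          D (l i) (r i) - d < (\<Sum>k\<in>{1..N i}. norm (F (p k) - F (p (k - 1))))"
        by blast
      from bchoice[OF this] obtain p where p: "\<And>i. i < n \<Longrightarrow> p i 0 = l i" "\<And>i. i < n \<Longrightarrow> p i (N i) = r i"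
          "\<And>i. i < n \<Longrightarrow> \<forall>k\<in>{1..N i}. p i (k - 1) < p i k"
          "\<And>i. i < n \<Longrightarrow> D (l i) (r i) - d < (\<Sum>k\<in>{1..N i}. norm (F (p i k) - F (p i (k - 1))))"
        by auto
      have p_le: "l i \<le> p i (k - 1)" "p i (k - 1) \<le> p i k" "p i k \<le> r i" if "i < n" "k \<in> {1..N i}" for i k
      proof -
        have "p i 0 \<le> p i (k - 1)" "p i (k - 1) \<le> p i k" "p i k \<le> p i (N i)"
          using that by (auto intro!: partition_mono[OF p(3)])
        then show "l i \<le> p i (k - 1)" "p i (k - 1) \<le> p i k" "p i k \<le> r i"
          using p(1,2) that by auto
      qed
      define I where "I = Sigma {..<n} (\<lambda>i. {1..N i})"
      have sum_I: "(\<Sum>z\<in>I. f (fst z) (snd z)) = (\<Sum>i<n. \<Sum>k\<in>{1..N i}. f i k)" for f :: "nat \<Rightarrow> nat \<Rightarrow> real"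
        unfolding I_def by (subst sum.Sigma) (auto simp: case_prod_beta)
      have "(\<Sum>z\<in>I. norm (F (p (fst z) (snd z)) - F (p (fst z) (snd z - 1)))) < e / 2"
      proof (rule \<delta>)
        show "finite I" by (auto simp: I_def)
        show "a \<le> p (fst z) (snd z - 1) \<and> p (fst z) (snd z - 1) \<le> p (fst z) (snd z) \<and> p (fst z) (snd z) \<le> b"
          if "z \<in> I" for z
          using that * p_le[of "fst z" "snd z"] by (fastforce simp: I_def)
        show "disjoint_family_on (\<lambda>z. {p (fst z) (snd z - 1)<..<p (fst z) (snd z)}) I"
          unfolding disjoint_family_on_def
        proof (intro ballI impI)
          fix z z' assume z: "z \<in> I" "z' \<in> I" "z \<noteq> z'"
          show "{p (fst z) (snd z - 1)<..<p (fst z) (snd z)} \<inter> {p (fst z') (snd z' - 1)<..<p (fst z') (snd z')} = {}"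
          proof (cases "fst z = fst z'")
            case True
            then have "snd z \<noteq> snd z'" using z by (auto simp: prod_eq_iff)
            then show ?thesis
              using True z partition_disjoint[OF p(3), of "fst z"] unfolding disjoint_family_on_def I_def by auto
          next
            case False
            have "{l (fst z)<..<r (fst z)} \<inter> {l (fst z')<..<r (fst z')} = {}"
              using * z False unfolding disjoint_family_on_def I_def by auto
            moreover have "{p (fst z) (snd z - 1)<..<p (fst z) (snd z)} \<subseteq> {l (fst z)<..<r (fst z)}"
              using p_le[of "fst z" "snd z"] z by (auto simp: I_def)
            moreover have "{p (fst z') (snd z' - 1)<..<p (fst z') (snd z')} \<subseteq> {l (fst z')<..<r (fst z')}"
              using p_le[of "fst z'" "snd z'"] z by (auto simp: I_def)
            ultimately show ?thesis by blast
          qed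
        qed
        have "(\<Sum>z\<in>I. p (fst z) (snd z) - p (fst z) (snd z - 1)) = (\<Sum>i<n. r i - l i)"
          unfolding sum_I[of "\<lambda>i k. p i k - p i (k - 1)"] partition_sum by (simp add: p)
        then show "(\<Sum>z\<in>I. p (fst z) (snd z) - p (fst z) (snd z - 1)) < \<delta>" using * by simp
      qed
      then have "(\<Sum>i<n. \<Sum>k\<in>{1..N i}. norm (F (p i k) - F (p i (k - 1)))) < e / 2"
        unfolding sum_I[of "\<lambda>i k. norm (F (p i k) - F (p i (k - 1)))"] .
      moreover have "(\<Sum>i<n. D (l i) (r i)) \<le> (\<Sum>i<n. (\<Sum>k\<in>{1..N i}. norm (F (p i k) - F (p i (k - 1)))) + d)"
        using p(4) by (intro sum_mono) (force simp: less_diff_eq)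
      ultimately have "(\<Sum>i<n. D (l i) (r i)) < e"
        using \<open>real n * d \<le> e / 2\<close> by (simp add: sum.distrib)
      moreover have "norm (D a (r i) - D a (l i)) = D (l i) (r i)" if "i < n" for i
        using D_add[of a "l i" "r i"] D_nonneg[of "l i" "r i"] * that by auto
      ultimately show "(\<Sum>i<n. norm (D a (r i) - D a (l i))) < e" by simp
    qed
  qed
  then show ?thesis by (simp add: D_def[abs_def])
qed

lemma AC_on_continuous:
  fixes F :: "real \<Rightarrow> 'a::real_normed_vector"
  assumes "AC_on a b F"
  shows "continuous_on {a..b} F"
  unfolding continuous_on_iff
proof (intro ballI allI impI)
  fix x and e :: real assume x: "x \<in> {a..b}" and "0 < e"
  obtain \<delta> where "0 < \<delta>" and \<delta>:
    "\<And>(I :: nat set) l r. \<lbrakk>finite I; \<And>i. i \<in> I \<Longrightarrow> a \<le> l i \<and> l i \<le> r i \<and> r i \<le> b;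
       disjoint_family_on (\<lambda>i. {l i<..<r i}) I; (\<Sum>i\<in>I. r i - l i) < \<delta>\<rbrakk>
       \<Longrightarrow> (\<Sum>i\<in>I. norm (F (r i) - F (l i))) < e"
    using AC_on_finite_index[OF assms \<open>0 < e\<close>, where ?'i = nat] by blast
  have *: "norm (F t - F s) < e" if "a \<le> s" "s \<le> t" "t \<le> b" "t - s < \<delta>" for s t
    using \<delta>[of "{0}" "\<lambda>_. s" "\<lambda>_. t"] that by (simp add: disjoint_family_on_def)
  have "dist (F y) (F x) < e" if "y \<in> {a..b}" "dist y x < \<delta>" for y
    using *[of x y] *[of y x] that x
    by (cases "x \<le> y") (auto simp: dist_norm norm_minus_commute)
  then show "\<exists>d>0. \<forall>x'\<in>{a..b}. dist x' x < d \<longrightarrow> dist (F x') (F x) < e"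
    using \<open>0 < \<delta>\<close> by blast
qed

lemma AC_on_dominated:
  fixes F :: "real \<Rightarrow> 'a::real_normed_vector" and G :: "real \<Rightarrow> 'b::real_normed_vector"
  assumes "AC_on a b F" "0 \<le> K"
    and "\<And>s t. \<lbrakk>a \<le> s; s \<le> t; t \<le> b\<rbrakk> \<Longrightarrow> norm (G t - G s) \<le> K * norm (F t - F s)"
  shows "AC_on a b G"
  unfolding AC_on_def
proof (intro allI impI)
  fix e :: real assume "0 < e"
  \<comment> \<open>\<open>K + 1\<close> instead of \<open>K\<close>, since \<open>K\<close> may
    vanish.\<close>
  obtain \<delta> where "0 < \<delta>" and \<delta>:
    "\<And>(I :: nat set) l r. \<lbrakk>finite I; \<And>i. i \<in> I \<Longrightarrow> a \<le> l i \<and> l i \<le> r i \<and> r i \<le> b;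
       disjoint_family_on (\<lambda>i. {l i<..<r i}) I; (\<Sum>i\<in>I. r i - l i) < \<delta>\<rbrakk>
       \<Longrightarrow> (\<Sum>i\<in>I. norm (F (r i) - F (l i))) < e / (K + 1)"
    using AC_on_finite_index[OF assms(1), of "e / (K + 1)", where ?'i = nat] \<open>0 < e\<close> \<open>0 \<le> K\<close> by auto
  have "(\<Sum>i<n. norm (G (r i) - G (l i))) < e"
    if *: "\<forall>i<n. a \<le> l i \<and> l i \<le> r i \<and> r i \<le> b" "disjoint_family_on (\<lambda>i. {l i<..<r i}) {..<n}"
      "(\<Sum>i<n. r i - l i) < \<delta>" for n :: nat and l r
  proof -
    have "(\<Sum>i<n. norm (G (r i) - G (l i))) \<le> (\<Sum>i<n. K * norm (F (r i) - F (l i)))"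
      using * by (intro sum_mono assms(3)) auto
    also have "\<dots> = K * (\<Sum>i<n. norm (F (r i) - F (l i)))"
      by (simp add: sum_distrib_left)
    also have "\<dots> \<le> (K + 1) * (\<Sum>i<n. norm (F (r i) - F (l i)))"
      by (intro mult_right_mono sum_nonneg) auto
    also have "\<dots> < e"
      using \<delta>[of "{..<n}" l r] * \<open>0 \<le> K\<close> by (simp add: field_simps)
    finally show ?thesis .
  qed
  then show "\<exists>\<delta>>0. \<forall>(n::nat) l r. (\<forall>i<n. a \<le> l i \<and> l i \<le> r i \<and> r i \<le> b) \<and>
      disjoint_family_on (\<lambda>i. {l i<..<r i}) {..<n} \<and> (\<Sum>i<n. r i - l i) < \<delta> \<longrightarrow>
      (\<Sum>i<n. norm (G (r i) - G (l i))) < e"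
    using \<open>0 < \<delta>\<close> by blast
qed

section \<open>Densities and derivatives of absolutely continuous functions\<close>

lemma inner_regular_compact_zero:
  fixes M :: "real measure"
  assumes "sets M = sets borel" "emeasure M (space M) \<noteq> \<infinity>" "B \<in> sets borel"
    and "\<And>K. \<lbrakk>compact K; K \<subseteq> B\<rbrakk> \<Longrightarrow> emeasure M K = 0"
  shows "emeasure M B = 0"
proof -
  have "(SUP K\<in>{K. K \<subseteq> B \<and> compact K}. emeasure M K) \<le> 0"
    by (rule SUP_least) (simp add: assms(4))
  then show ?thesis
    unfolding inner_regular[OF assms(1-3), symmetric] by simp
qed

text \<open>By inner regularity it suffices for Radon-Nikodym that the Stieltjes measure of \<open>P\<close> vanishes on
  compact null sets, and such a set is covered by finitely many cells of a fine grid.\<close>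

lemma AC_mono_density:
  fixes P :: "real \<Rightarrow> real"
  assumes AC: "AC_on 0 1 P" and mono: "mono_on {0..1} P"
  obtains h where "integrable lborel h"
    "\<And>s t. \<lbrakk>0 \<le> s; s \<le> t; t \<le> 1\<rbrakk> \<Longrightarrow> P t - P s = integral {s..t} h"
proof -
  \<comment> \<open>Clamping makes the function monotone and continuous on the whole line. It is
    constant outside the unit interval, so its Stieltjes measure lives on
    \<open>{0<..1}\<close>.\<close>
  define Q where "Q t = P (max 0 (min 1 t))" for t
  have Q_mono: "Q s \<le> Q t" if "s \<le> t" for s t
    using that unfolding Q_def by (intro mono_onD[OF mono]) auto
  have Q_cont: "continuous_on UNIV Q"
    unfolding Q_def by (rule continuous_on_compose2[OF AC_on_continuous[OF AC]]) (auto intro!: continuous_intros)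
  define \<mu> where "\<mu> = interval_measure Q"
  have \<mu>_sets [simp]: "sets \<mu> = sets borel" by (simp add: \<mu>_def)
  have \<mu>: "emeasure \<mu> {s<..t} = ennreal (Q t - Q s)" if "s \<le> t" for s t
    unfolding \<mu>_def using that Q_mono Q_cont
    by (intro emeasure_interval_measure_Ioc) (auto simp: continuous_on_eq_continuous_within intro: continuous_at_imp_continuous_within)
  have out: "emeasure \<mu> (- {0<..1}) = 0"
  proof -
    have "- {0<..1} \<subseteq> (\<Union>n::nat. {- real n<..0} \<union> {1<..1 + real n})"
    proof
      fix x :: real assume x: "x \<in> - {0<..1}"
      obtain n :: nat where "\<bar>x\<bar> < real n" using reals_Archimedean2 by blast
      with x show "x \<in> (\<Union>n::nat. {- real n<..0} \<union> {1<..1 + real n})" by (intro UN_I[of n]) auto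
    qed
    then have "emeasure \<mu> (- {0<..1}) \<le> emeasure \<mu> (\<Union>n::nat. {- real n<..0} \<union> {1<..1 + real n})"
      by (intro emeasure_mono) auto
    also have "\<dots> = 0"
    proof (rule emeasure_UN_eq_0)
      fix n :: nat
      have "emeasure \<mu> ({- real n<..0} \<union> {1<..1 + real n}) \<le> emeasure \<mu> {- real n<..0} + emeasure \<mu> {1<..1 + real n}"
        by (intro emeasure_subadditive) auto
      also have "\<dots> = 0" by (simp add: \<mu> Q_def)
      finally show "emeasure \<mu> ({- real n<..0} \<union> {1<..1 + real n}) = 0" by simp
    qed auto
    finally show ?thesis by simp
  qed
  have fin: "emeasure \<mu> UNIV \<noteq> \<infinity>"
  proof -
    have "emeasure \<mu> ({0<..1} \<union> - {0<..1}) \<le> emeasure \<mu> {0<..1} + emeasure \<mu> (- {0<..1})"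
      by (rule emeasure_subadditive) auto
    also have "\<dots> = ennreal (Q 1 - Q 0)" using \<mu>[of 0 1] out by simp
    finally show ?thesis by (simp add: Compl_partition) (metis ennreal_less_top leD top.not_eq_extremum)
  qed
  have compact0: "emeasure \<mu> K = 0" if K: "compact K" "K \<subseteq> {0<..1}" "emeasure lborel K = 0" for K
  proof -
    have "emeasure \<mu> K \<le> ennreal e" if "0 < e" for e
    proof -
      obtain \<delta> where "0 < \<delta>" and \<delta>:
        "\<And>(I :: nat set) l r. \<lbrakk>finite I; \<And>i. i \<in> I \<Longrightarrow> 0 \<le> l i \<and> l i \<le> r i \<and> r i \<le> 1;
           disjoint_family_on (\<lambda>i. {l i<..<r i}) I; (\<Sum>i\<in>I. r i - l i) < \<delta>\<rbrakk>
           \<Longrightarrow> (\<Sum>i\<in>I. norm (P (r i) - P (l i))) < e"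
        using AC_on_finite_index[OF AC \<open>0 < e\<close>, where ?'i = nat] by blast
      have Kb: "K \<in> sets borel" using K(1) by (simp add: borel_compact)
      obtain U where U: "open U" "K \<subseteq> U" "emeasure lborel (U - K) < ennreal \<delta>"
        using outer_regular_lborel[OF Kb \<open>0 < \<delta>\<close>] by metis
      have "emeasure lborel U \<le> emeasure lborel (U - K) + emeasure lborel K"
        using U Kb by (intro order_trans[OF _ emeasure_subadditive] emeasure_mono) auto
      with U K have lU: "emeasure lborel U < ennreal \<delta>" by simp
      \<comment> \<open>Cells shorter than \<rho> that meet \<open>K\<close> stay inside
        \<open>U\<close>, so that their total length is below \<delta>.\<close>
      obtain \<rho> where \<rho>: "0 < \<rho>" "(\<Union>x\<in>K. ball x \<rho>) \<subseteq> U"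
        using compact_subset_open_imp_ball_epsilon_subset[OF K(1) U(1,2)] by blast
      obtain m where m: "inverse (real (Suc m)) < \<rho>"
        using reals_Archimedean[OF \<rho>(1)] by blast
      \<comment> \<open>Half-open cells are pairwise disjoint, cover \<open>{0<..1}\<close> and have
        the form on which the Stieltjes measure is known. Being open on the left, they are located
        by a ceiling, shifted by one.\<close>
      define c where "c i = {real i / Suc m<..real (Suc i) / Suc m}" for i
      define I where "I = {i. i < Suc m \<and> K \<inter> c i \<noteq> {}}"
      have "finite I" by (simp add: I_def)
      have disj: "c i \<inter> c j = {}" if "i < j" for i j
      proof -
        have "real (Suc i) / Suc m \<le> real j / Suc m" using that by (intro divide_right_mono) auto
        then show ?thesis unfolding c_def by auto
      qed
      have disj_c: "disjoint_family_on c I"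
        unfolding disjoint_family_on_def using disj by (metis Int_commute linorder_neqE_nat)
      have K_sub: "K \<subseteq> (\<Union>i\<in>I. c i)"
      proof
        fix x assume "x \<in> K"
        then have x: "0 < x" "x \<le> 1" using K by auto
        define i where "i = nat \<lceil>x * Suc m\<rceil> - 1"
        have pos: "0 < \<lceil>x * Suc m\<rceil>" using x by simp
        then have i: "real (Suc i) = of_int \<lceil>x * Suc m\<rceil>" by (simp add: i_def)
        have "x \<in> c i"
          using i ceiling_correct[of "x * Suc m"] unfolding c_def by (simp add: field_simps)
        moreover have "i < Suc m"
        proof -
          have "\<lceil>x * Suc m\<rceil> \<le> int (Suc m)"
            using x by (intro ceiling_le) (simp add: mult_left_le_one_le)
          then show ?thesis using pos unfolding i_def by linarith
        qed
        ultimately show "x \<in> (\<Union>i\<in>I. c i)" using \<open>x \<in> K\<close> unfolding I_def by blast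
      qed
      have c_U: "c i \<subseteq> U" if iI: "i \<in> I" for i
      proof
        fix y assume y: "y \<in> c i"
        obtain x where x: "x \<in> K" "x \<in> c i" using iI unfolding I_def by blast
        have "\<bar>x - y\<bar> \<le> inverse (real (Suc m))"
          using x(2) y unfolding c_def by (auto simp: field_simps abs_le_iff)
        then have "y \<in> ball x \<rho>" using m by (simp add: dist_real_def)
        then show "y \<in> U" using \<rho>(2) x(1) by blast
      qed
      have "(\<Sum>i\<in>I. emeasure lborel (c i)) = emeasure lborel (\<Union>i\<in>I. c i)"
        by (rule sum_emeasure[OF _ disj_c \<open>finite I\<close>]) (auto simp: c_def)
      also have "\<dots> \<le> emeasure lborel U"
        using c_U U by (intro emeasure_mono) auto
      finally have "(\<Sum>i\<in>I. emeasure lborel (c i)) < ennreal \<delta>" using lU by simp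
      moreover have "(\<Sum>i\<in>I. emeasure lborel (c i)) = ennreal (\<Sum>i\<in>I. real (Suc i) / Suc m - real i / Suc m)"
        unfolding c_def by (subst sum_ennreal[symmetric]) (auto simp: divide_right_mono)
      ultimately have len: "(\<Sum>i\<in>I. real (Suc i) / Suc m - real i / Suc m) < \<delta>"
        by (simp add: ennreal_less_iff sum_nonneg divide_right_mono)
      have "(\<Sum>i\<in>I. norm (P (real (Suc i) / Suc m) - P (real i / Suc m))) < e"
      proof (rule \<delta>[OF \<open>finite I\<close> _ _ len])
        show "0 \<le> real i / Suc m \<and> real i / Suc m \<le> real (Suc i) / Suc m \<and> real (Suc i) / Suc m \<le> 1"
          if "i \<in> I" for i
          using that by (auto simp: I_def divide_right_mono)
        show "disjoint_family_on (\<lambda>i. {real i / Suc m<..<real (Suc i) / Suc m}) I"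
          using disj_c unfolding disjoint_family_on_def c_def by (simp add: set_eq_iff) (meson less_imp_le)
      qed
      moreover have "emeasure \<mu> K \<le> ennreal (\<Sum>i\<in>I. norm (P (real (Suc i) / Suc m) - P (real i / Suc m)))"
      proof -
        have "emeasure \<mu> K \<le> emeasure \<mu> (\<Union>i\<in>I. c i)"
          using K_sub by (intro emeasure_mono) (auto simp: c_def)
        also have "\<dots> \<le> (\<Sum>i\<in>I. emeasure \<mu> (c i))"
          using \<open>finite I\<close> by (intro emeasure_subadditive_finite) (auto simp: c_def)
        also have "\<dots> \<le> (\<Sum>i\<in>I. ennreal (norm (P (real (Suc i) / Suc m) - P (real i / Suc m))))"
        proof (rule sum_mono)
          fix i assume i: "i \<in> I"
          have le: "real i / Suc m \<le> real (Suc i) / Suc m" by (simp add: divide_right_mono)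
          have Q: "Q (real i / Suc m) = P (real i / Suc m)" "Q (real (Suc i) / Suc m) = P (real (Suc i) / Suc m)"
            using i by (simp_all add: Q_def I_def min_absorb2 max_absorb2)
          show "emeasure \<mu> (c i) \<le> ennreal (norm (P (real (Suc i) / Suc m) - P (real i / Suc m)))"
            unfolding c_def \<mu>[OF le] Q by (intro ennreal_leI) simp
        qed
        also have "\<dots> = ennreal (\<Sum>i\<in>I. norm (P (real (Suc i) / Suc m) - P (real i / Suc m)))"
          by (simp add: sum_ennreal)
        finally show ?thesis .
      qed
      ultimately show ?thesis
        by (meson ennreal_leI less_imp_le order_trans)
    qed
    then have "emeasure \<mu> K \<le> 0 + ennreal e" if "0 < e" for e
      using that by simp
    then have "emeasure \<mu> K \<le> 0" by (rule ennreal_le_epsilon)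
    then show ?thesis by simp
  qed
  have "absolutely_continuous lborel \<mu>"
    unfolding absolutely_continuous_def
  proof
    fix N :: "real set" assume N: "N \<in> null_sets lborel"
    have Nb: "N \<in> sets borel" using null_setsD2[OF N] by simp
    have "emeasure \<mu> (N \<inter> {0<..1}) = 0"
    proof (rule inner_regular_compact_zero)
      fix K assume K: "compact K" "K \<subseteq> N \<inter> {0<..1}"
      have "emeasure lborel K \<le> emeasure lborel N" using K Nb by (intro emeasure_mono) simp_all
      then show "emeasure \<mu> K = 0" using K null_setsD1[OF N] by (intro compact0) simp_all
    qed (use fin Nb in \<open>auto simp: \<mu>_def\<close>)
    moreover have "emeasure \<mu> N \<le> emeasure \<mu> (N \<inter> {0<..1}) + emeasure \<mu> (- {0<..1})"
      using Nb by (intro order_trans[OF _ emeasure_subadditive] emeasure_mono) auto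
    ultimately show "N \<in> null_sets \<mu>" using out Nb by (simp add: null_sets_def)
  qed
  then obtain f where f: "f \<in> borel_measurable lborel" "density lborel f = \<mu>"
    using sigma_finite_measure.Radon_Nikodym[OF sigma_finite_lborel, of \<mu>] by auto
  have fb: "f \<in> borel_measurable borel" using f(1) by simp
  have f_Ioc: "(\<integral>\<^sup>+x. f x * indicator {s<..t} x \<partial>lborel) = ennreal (Q t - Q s)" if "s \<le> t" for s t
    using emeasure_density[OF f(1), of "{s<..t}"] \<mu>[OF that] f(2) by simp
  have f_UNIV: "(\<integral>\<^sup>+x. f x \<partial>lborel) < \<infinity>"
    using emeasure_density[OF f(1), of UNIV] f(2) fin by (simp add: less_top)
  then have f_fin: "AE x in lborel. f x \<noteq> \<infinity>"
    using f(1) by (intro nn_integral_noteq_infinite) auto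
  \<comment> \<open>The measure is finite, so the Radon-Nikodym density is finite almost everywhere
    and passing to reals changes it only on a null set.\<close>
  define h where "h x = enn2real (f x)" for x
  have h_meas [measurable]: "h \<in> borel_measurable borel"
    unfolding h_def using fb by measurable
  have h_f: "AE x in lborel. ennreal (h x) = f x"
    using f_fin by eventually_elim (simp add: h_def less_top)
  have int_h: "integrable lborel h"
  proof (rule integrableI_nonneg)
    have "(\<integral>\<^sup>+x. ennreal (h x) \<partial>lborel) = (\<integral>\<^sup>+x. f x \<partial>lborel)"
      using h_f by (rule nn_integral_cong_AE)
    then show "(\<integral>\<^sup>+x. ennreal (h x) \<partial>lborel) < \<infinity>" using f_UNIV by simp
  qed (auto simp: h_def)
  show thesis
  proof (rule that[OF int_h])
    fix s t :: real assume st: "0 \<le> s" "s \<le> t" "t \<le> 1"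
    have ih: "set_integrable lborel {s..t} h"
      using int_h unfolding set_integrable_def by (rule integrable_mult_indicator[rotated]) auto
    have "ennreal (P t - P s) = (\<integral>\<^sup>+x. f x * indicator {s<..t} x \<partial>lborel)"
      using f_Ioc[OF st(2)] st by (simp add: Q_def min_absorb2 max_absorb2)
    \<comment> \<open>The half-open interval may be closed because the point \<open>s\<close> is a
      null set.\<close>
    also have "\<dots> = (\<integral>\<^sup>+x. ennreal (indicator {s..t} x *\<^sub>R h x) \<partial>lborel)"
      using h_f AE_lborel_singleton[of s]
      by (intro nn_integral_cong_AE, eventually_elim) (auto simp: indicator_def)
    also have "\<dots> = ennreal (LINT x:{s..t}|lborel. h x)"
      unfolding set_lebesgue_integral_def
      using ih by (intro nn_integral_eq_integral) (auto simp: set_integrable_def h_def)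
    finally have "P t - P s = (LINT x:{s..t}|lborel. h x)"
      using mono_onD[OF mono, of s t] st
      by (subst (asm) ennreal_inj) (auto simp: set_lebesgue_integral_def h_def intro!: integral_nonneg_AE)
    then show "P t - P s = integral {s..t} h"
      using set_borel_integral_eq_integral(2)[OF ih] by simp
  qed
qed

text \<open>Averages over intervals to the right of a point converge to \<open>h\<close> almost
  everywhere, which controls the right difference quotients. The left ones become right ones after
  reflecting \<open>h\<close>.\<close>

lemma integral_has_derivative_ae:
  fixes h F :: "real \<Rightarrow> real"
  assumes int: "\<And>a b. h integrable_on {a..b}"
    and F: "\<And>s t. \<lbrakk>a \<le> s; s \<le> t; t \<le> b\<rbrakk> \<Longrightarrow> F t - F s = integral {s..t} h"
  obtains N where "negligible N" "\<And>s. \<lbrakk>s \<in> {a<..<b}; s \<notin> N\<rbrakk> \<Longrightarrow> (F has_real_derivative h s) (at s)"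
proof -
  obtain N where N: "negligible N" "\<And>x e. \<lbrakk>x \<notin> N; 0 < e\<rbrakk> \<Longrightarrow> \<exists>d>0. \<forall>k. 0 < k \<and> k < d \<longrightarrow>
      norm (integral {x..x + k} h /\<^sub>R k - h x) < e"
    using integrable_ccontinuous_explicit[of h] int by (auto simp: cbox_interval)
  have int': "(\<lambda>x. h (- x)) integrable_on {a..b}" for a b
    using int[of "-b" "-a"] Henstock_Kurzweil_Integration.integrable_reflect_real[where f = h and a = "-b" and b = "-a"] by simp
  obtain N' where N': "negligible N'" "\<And>x e. \<lbrakk>x \<notin> N'; 0 < e\<rbrakk> \<Longrightarrow> \<exists>d>0. \<forall>k. 0 < k \<and> k < d \<longrightarrow>
      norm (integral {x..x + k} (\<lambda>x. h (- x)) /\<^sub>R k - h (- x)) < e"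
    using integrable_ccontinuous_explicit[of "\<lambda>x. h (- x)"] int' by (auto simp: cbox_interval)
  show thesis
  proof (rule that)
    \<comment> \<open>The exceptional set of the reflected function is reflected back; a
      differentiable map preserves null sets.\<close>
    show "negligible (N \<union> uminus ` N')"
      using N(1) N'(1) by (intro negligible_Un negligible_differentiable_image_negligible[OF order_refl])
        (auto simp: differentiable_on_def)
    fix s assume s: "s \<in> {a<..<b}" "s \<notin> N \<union> uminus ` N'"
    then have sN: "s \<notin> N" "- s \<notin> N'" by (auto simp: image_iff)
    show "(F has_real_derivative h s) (at s)"
      unfolding DERIV_def LIM_eq
    proof (intro allI impI)
      fix e :: real assume "0 < e"
      obtain d1 where d1: "0 < d1" "\<And>k. 0 < k \<Longrightarrow> k < d1 \<Longrightarrow> \<bar>integral {s..s + k} h / k - h s\<bar> < e"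
        using N(2)[OF sN(1) \<open>0 < e\<close>] by (auto simp: divide_inverse mult.commute)
      obtain d2 where d2: "0 < d2" "\<And>k. 0 < k \<Longrightarrow> k < d2 \<Longrightarrow> \<bar>integral {- s..- s + k} (\<lambda>x. h (- x)) / k - h s\<bar> < e"
        using N'(2)[OF sN(2) \<open>0 < e\<close>] by (auto simp: divide_inverse mult.commute)
      define d where "d = Min {d1, d2, s - a, b - s}"
      have "0 < d" using d1(1) d2(1) s by (simp add: d_def)
      have "\<bar>(F (s + k) - F s) / k - h s\<bar> < e" if k: "k \<noteq> 0" "\<bar>k\<bar> < d" for k
      proof (cases "0 < k")
        case True
        then show ?thesis using d1(2)[of k] F[of s "s + k"] k s by (simp add: d_def)
      next
        case False
        have "integral {- s..- s + (- k)} (\<lambda>x. h (- x)) = integral {s + k..s} h"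
          using Henstock_Kurzweil_Integration.integral_reflect_real[of s "s + k" h] by (simp add: algebra_simps)
        also have "\<dots> = F s - F (s + k)"
          using F[of "s + k" s] k s False by (simp add: d_def)
        finally show ?thesis
          using d2(2)[of "- k"] False k s by (simp add: d_def) (metis minus_diff_eq minus_divide_left)
      qed
      then show "\<exists>d>0. \<forall>k. k \<noteq> 0 \<and> norm (k - 0) < d \<longrightarrow> norm ((F (s + k) - F s) / k - h s) < e"
        using \<open>0 < d\<close> by auto
    qed
  qed
qed

text \<open>Jordan decomposition: with \<open>V\<close> the variation function, \<open>F\<close> is
  the difference of \<open>V + F\<close> and \<open>V\<close>, both monotone and absolutely
  continuous, so the monotone case supplies two densities.\<close>

lemma AC_on_FTC:
  fixes F :: "real \<Rightarrow> real"
  assumes "AC_on 0 1 F"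
  obtains h N where "integrable lborel h" "negligible N"
    "\<And>s t. \<lbrakk>0 \<le> s; s \<le> t; t \<le> 1\<rbrakk> \<Longrightarrow> F t - F s = integral {s..t} h"
    "\<And>s. \<lbrakk>s \<in> {0<..<1}; s \<notin> N\<rbrakk> \<Longrightarrow> (F has_real_derivative h s) (at s)"
proof -
  interpret finite_diss norm F 0 1
    using AC_on_finite_variation[OF assms] by (intro finite_diss_norm) auto
  define V where "V = D 0"
  have V_AC: "AC_on 0 1 V"
    using AC_on_variation[OF assms] by (simp add: V_def D_def[abs_def])
  have V: "\<bar>F t - F s\<bar> \<le> V t - V s" if "0 \<le> s" "s \<le> t" "t \<le> 1" for s t
    using D_append[OF that] by (simp add: V_def)
  have V_mono: "mono_on {0..1} V"
    using V by (fastforce simp: mono_on_def)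
  have VF_mono: "mono_on {0..1} (\<lambda>t. V t + F t)"
    using V by (fastforce simp: mono_on_def abs_le_iff)
  \<comment> \<open>An increment of \<open>V + F\<close> is at most that of \<open>V\<close> plus
    the modulus of that of \<open>F\<close>, hence the factor 2.\<close>
  have VF_AC: "AC_on 0 1 (\<lambda>t. V t + F t)"
    by (rule AC_on_dominated[OF V_AC, of 2]) (use V in \<open>fastforce simp: abs_le_iff\<close>)+
  obtain h1 where h1: "integrable lborel h1"
    "\<And>s t. \<lbrakk>0 \<le> s; s \<le> t; t \<le> 1\<rbrakk> \<Longrightarrow> V t - V s = integral {s..t} h1"
    using AC_mono_density[OF V_AC V_mono] by blast
  obtain h2 where h2: "integrable lborel h2"
    "\<And>s t. \<lbrakk>0 \<le> s; s \<le> t; t \<le> 1\<rbrakk> \<Longrightarrow> (V t + F t) - (V s + F s) = integral {s..t} h2"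
    using AC_mono_density[OF VF_AC VF_mono] by blast
  have on: "h integrable_on {a..b}" if "integrable lborel h" for h :: "real \<Rightarrow> real" and a b
    using integrable_on_subcbox[OF integrable_on_lborel[OF that], of a b] by (simp add: cbox_interval)
  define h where "h = (\<lambda>x. h2 x - h1 x)"
  have h: "integrable lborel h" using h1(1) h2(1) by (simp add: h_def)
  have F: "F t - F s = integral {s..t} h" if "0 \<le> s" "s \<le> t" "t \<le> 1" for s t
    using h1(2)[OF that] h2(2)[OF that] integral_diff[OF on[OF h2(1)] on[OF h1(1)], of s t]
    by (simp add: h_def)
  obtain N where "negligible N" "\<And>s. \<lbrakk>s \<in> {0<..<1}; s \<notin> N\<rbrakk> \<Longrightarrow> (F has_real_derivative h s) (at s)"
    using integral_has_derivative_ae[OF on[OF h] F] by blast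
  then show thesis using that h F by blast
qed

lemma AC_on_differentiable_ae:
  fixes \<gamma> :: "real \<Rightarrow> 'a::euclidean_space"
  assumes "AC_on 0 1 \<gamma>"
  obtains N where "negligible N"
    "\<And>s. \<lbrakk>s \<in> {0<..<1}; s \<notin> N\<rbrakk> \<Longrightarrow> (\<gamma> has_vector_derivative vector_derivative \<gamma> (at s)) (at s)"
proof -
  have "\<exists>N. negligible N \<and> (\<forall>s\<in>{0<..<1} - N. (\<lambda>t. \<gamma> t \<bullet> i) differentiable (at s))" if "i \<in> Basis" for i :: 'a
  proof -
    have "AC_on 0 1 (\<lambda>t. \<gamma> t \<bullet> i)"
      using that by (intro AC_on_dominated[OF assms, of 1])
        (auto simp: inner_diff_left[symmetric] intro: order_trans[OF Basis_le_norm])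
    then show ?thesis
      by (rule AC_on_FTC) (meson DiffE real_differentiable_def)
  qed
  then obtain N where N: "\<And>i. i \<in> Basis \<Longrightarrow> negligible (N i)"
    "\<And>i s. i \<in> Basis \<Longrightarrow> s \<in> {0<..<1} - N i \<Longrightarrow> (\<lambda>t. \<gamma> t \<bullet> i) differentiable (at s)"
    by metis
  show thesis
  proof (rule that)
    show "negligible (\<Union>i\<in>Basis. N i)"
      using N(1) by (intro negligible_Union) auto
    fix s assume "s \<in> {0<..<1}" "s \<notin> (\<Union>i\<in>Basis. N i)"
    then have "\<gamma> differentiable (at s)"
      using N(2) by (subst differentiable_componentwise_within) auto
    then show "(\<gamma> has_vector_derivative vector_derivative \<gamma> (at s)) (at s)"
      by (simp add: vector_derivative_works)
  qed
qed

text \<open>The source of all lower bounds for transition costs: \<open>f\<close> is the energy at a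
  frozen time in one application and a linear functional in the other. On a ball containing the
  curve \<open>f\<close> is Lipschitz, so the composition is absolutely continuous and the chain
  rule holds almost everywhere. No measurability of \<open>g\<close> is assumed; the comparison is
  with a measurable function below it.\<close>

lemma AC_on_chain_bound:
  fixes \<gamma> :: "real \<Rightarrow> 'a::euclidean_space" and f :: "'a \<Rightarrow> real" and f' :: "'a \<Rightarrow> 'a \<Rightarrow>\<^sub>L real"
  assumes AC: "AC_on 0 1 \<gamma>"
    and f: "\<And>x. (f has_derivative blinfun_apply (f' x)) (at x)" and f': "continuous_on UNIV f'"
    and g: "\<And>s. - blinfun_apply (f' (\<gamma> s)) (vector_derivative \<gamma> (at s)) \<le> g s"
  shows "ennreal (f (\<gamma> 0) - f (\<gamma> 1)) \<le> (\<integral>\<^sup>+s\<in>{0..1}. ennreal (g s) \<partial>lebesgue)"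
proof -
  have "compact (\<gamma> ` {0..1})"
    using AC_on_continuous[OF AC] by (intro compact_continuous_image) auto
  then obtain R where R: "\<gamma> ` {0..1} \<subseteq> cball 0 R"
    using bounded_subset_ballD[OF compact_imp_bounded, of _ 0] ball_subset_cball by (metis subset_trans)
  have "compact (f' ` cball 0 R)"
    using f' by (intro compact_continuous_image) (auto intro: continuous_on_subset)
  then obtain K where K: "0 < K" "\<And>x. x \<in> cball 0 R \<Longrightarrow> norm (f' x) \<le> K"
    using bounded_pos[THEN iffD1, OF compact_imp_bounded] by (metis imageI)
  have "AC_on 0 1 (\<lambda>s. f (\<gamma> s))"
  proof (rule AC_on_dominated[OF AC])
    fix s t :: real assume st: "0 \<le> s" "s \<le> t" "t \<le> 1"
    show "norm (f (\<gamma> t) - f (\<gamma> s)) \<le> K * norm (\<gamma> t - \<gamma> s)"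
    proof (rule differentiable_bound[where f' = "\<lambda>x. blinfun_apply (f' x)"])
      show "onorm (blinfun_apply (f' x)) \<le> K" if "x \<in> cball 0 R" for x
        using K(2)[OF that] by (simp add: norm_blinfun.rep_eq)
    qed (use R st f in \<open>auto intro: has_derivative_at_withinI simp: image_subset_iff\<close>)
  qed (use K in simp)
  then obtain h N where h: "integrable lborel h" "negligible N"
    "\<And>s t. \<lbrakk>0 \<le> s; s \<le> t; t \<le> 1\<rbrakk> \<Longrightarrow> f (\<gamma> t) - f (\<gamma> s) = integral {s..t} h"
    "\<And>s. \<lbrakk>s \<in> {0<..<1}; s \<notin> N\<rbrakk> \<Longrightarrow> ((\<lambda>s. f (\<gamma> s)) has_real_derivative h s) (at s)"
    using AC_on_FTC by metis
  obtain N' where N': "negligible N'"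
    "\<And>s. \<lbrakk>s \<in> {0<..<1}; s \<notin> N'\<rbrakk> \<Longrightarrow> (\<gamma> has_vector_derivative vector_derivative \<gamma> (at s)) (at s)"
    using AC_on_differentiable_ae[OF AC] by blast
  have h_le: "- h s \<le> g s" if "s \<in> {0<..<1}" "s \<notin> N" "s \<notin> N'" for s
  proof -
    have "((\<lambda>s. f (\<gamma> s)) has_derivative (\<lambda>k. blinfun_apply (f' (\<gamma> s)) (k *\<^sub>R vector_derivative \<gamma> (at s)))) (at s)"
      using has_derivative_compose[OF N'(2)[OF that(1,3), unfolded has_vector_derivative_def] f] .
    then have "((\<lambda>s. f (\<gamma> s)) has_real_derivative blinfun_apply (f' (\<gamma> s)) (vector_derivative \<gamma> (at s))) (at s)"
      unfolding has_field_derivative_def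
      by (rule has_derivative_eq_rhs) (simp add: fun_eq_iff blinfun.scaleR_right)
    then have "h s = blinfun_apply (f' (\<gamma> s)) (vector_derivative \<gamma> (at s))"
      using DERIV_unique h(4)[OF that(1,2)] by blast
    then show ?thesis using g[of s] by simp
  qed
  have int_h: "set_integrable lborel {0..1} h"
    using h(1) unfolding set_integrable_def by (rule integrable_mult_indicator[rotated]) auto
  \<comment> \<open>The positive part matches the truncation of negative numbers by
    \<open>ennreal\<close>.\<close>
  define k where "k s = max 0 (- (indicator {0..1} s * h s))" for s :: real
  have int_k: "integrable lborel (\<lambda>s. k s)"
    using int_h unfolding k_def set_integrable_def by auto
  have "f (\<gamma> 0) - f (\<gamma> 1) = - (LINT s:{0..1}|lborel. h s)"
    using h(3)[of 0 1] set_borel_integral_eq_integral(2)[OF int_h] by simp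
  also have "\<dots> = (LINT s|lborel. - (indicator {0..1} s * h s))"
    by (simp add: set_lebesgue_integral_def)
  also have "\<dots> \<le> (LINT s|lborel. k s)"
    using int_h by (intro integral_mono int_k) (auto simp: k_def set_integrable_def)
  finally have "ennreal (f (\<gamma> 0) - f (\<gamma> 1)) \<le> ennreal (LINT s|lborel. k s)"
    by (rule ennreal_leI)
  also have "\<dots> = (\<integral>\<^sup>+s. ennreal (k s) \<partial>lborel)"
    using int_k by (intro nn_integral_eq_integral[symmetric]) (auto simp: k_def)
  also have "\<dots> = (\<integral>\<^sup>+s. ennreal (k s) \<partial>lebesgue)"
    by (simp add: nn_integral_completion)
  also have "\<dots> \<le> (\<integral>\<^sup>+s\<in>{0..1}. ennreal (g s) \<partial>lebesgue)"
  proof (rule nn_integral_mono_AE, rule AE_I')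
    \<comment> \<open>The end points join the null set because derivatives are controlled only in
      the open interval.\<close>
    show "N \<union> N' \<union> {0, 1} \<in> null_sets lebesgue"
      using h(2) N'(1) by (simp add: negligible_iff_null_sets[symmetric] negligible_Un_eq)
    show "{s \<in> space lebesgue. \<not> ennreal (k s) \<le> ennreal (g s) * indicator {0..1} s} \<subseteq> N \<union> N' \<union> {0, 1}"
    proof (rule subsetI, rule ccontr)
      fix s assume "s \<in> {s \<in> space lebesgue. \<not> ennreal (k s) \<le> ennreal (g s) * indicator {0..1} s}"
        "s \<notin> N \<union> N' \<union> {0, 1}"
      then have s: "\<not> ennreal (k s) \<le> ennreal (g s) * indicator {0..1} s" "s \<notin> {0, 1}" "s \<notin> N'" "s \<notin> N"
        by auto
      show False
      proof (cases "s \<in> {0<..<1}")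
        case True
        then have "ennreal (k s) \<le> ennreal (g s)"
          using h_le[of s] s by (cases "h s \<le> 0") (auto simp: k_def max_def intro!: ennreal_leI)
        then show False using s True by simp
      next
        case False
        then have "s \<notin> {0..1}" using s by auto
        then show False using s by (simp add: k_def)
      qed
    qed
  qed
  finally show ?thesis .
qed

section \<open>The dissipation and the slope of the energy\<close>

lemma sublinear_bounds:
  fixes p :: "'a::euclidean_space \<Rightarrow> real"
  assumes "continuous_on UNIV p" "\<And>c v. 0 < c \<Longrightarrow> p (c *\<^sub>R v) = c * p v"
    and "\<And>v. v \<noteq> 0 \<Longrightarrow> 0 < p v" "p 0 = 0"
  obtains c C where "0 < c" "0 < C" "\<And>v. c * norm v \<le> p v" "\<And>v. p v \<le> C * norm v"
proof -
  have sphere: "compact (sphere (0::'a) 1)" "sphere (0::'a) 1 \<noteq> {}" by auto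
  have cont: "continuous_on (sphere 0 1) p" using assms(1) by (rule continuous_on_subset) auto
  obtain a where a: "a \<in> sphere 0 1" "\<And>y. y \<in> sphere 0 1 \<Longrightarrow> p a \<le> p y"
    using continuous_attains_inf[OF sphere cont] by auto
  obtain b where b: "b \<in> sphere 0 1" "\<And>y. y \<in> sphere 0 1 \<Longrightarrow> p y \<le> p b"
    using continuous_attains_sup[OF sphere cont] by auto
  have scale: "p v = norm v * p (v /\<^sub>R norm v)" "v /\<^sub>R norm v \<in> sphere 0 1" if "v \<noteq> 0" for v
    using assms(2)[of "norm v" "v /\<^sub>R norm v"] that by auto
  show thesis
  proof (rule that)
    have "a \<noteq> 0" "b \<noteq> 0" using a(1) b(1) by auto
    then show "0 < p a" "0 < p b" using assms(3) by auto
    show "p a * norm v \<le> p v" for v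
    proof (cases "v = 0")
      case False
      then show ?thesis using scale[OF False] mult_left_mono[OF a(2)[OF scale(2)[OF False]], of "norm v"]
        by (simp add: mult.commute)
    qed (simp add: assms)
    show "p v \<le> p b * norm v" for v
    proof (cases "v = 0")
      case False
      then show ?thesis using scale[OF False] mult_left_mono[OF b(2)[OF scale(2)[OF False]], of "norm v"]
        by (simp add: mult.commute)
    qed (simp add: assms)
  qed
qed

text \<open>Only \<open>f\<close> is differentiated. The constant \<open>c\<close> stands for the
  change of the dissipation, which is nonsmooth and is estimated by convexity instead.\<close>

lemma first_order_condition:
  fixes f :: "'a::real_normed_vector \<Rightarrow> real"
  assumes f: "(f has_derivative f') (at y)"
    and le: "\<And>h. \<lbrakk>0 < h; h < 1\<rbrakk> \<Longrightarrow> f y \<le> f (y + h *\<^sub>R d) + h * c"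
  shows "0 \<le> f' d + c"
proof -
  have "((\<lambda>h. f (y + h *\<^sub>R d)) has_derivative (\<lambda>h. f' (h *\<^sub>R d))) (at 0)"
    by (rule has_derivative_compose[of "\<lambda>h. y + h *\<^sub>R d"]) (auto intro!: derivative_eq_intros f)
  moreover have "f' (h *\<^sub>R d) = h * f' d" for h
    using linear_scale[OF has_derivative_linear[OF f]] by simp
  ultimately have "((\<lambda>h. f (y + h *\<^sub>R d)) has_real_derivative f' d) (at 0)"
    unfolding has_field_derivative_def by (simp add: mult_commute_abs)
  then have "(\<lambda>h. (f (y + h *\<^sub>R d) - f y) / h) \<midarrow>0\<rightarrow> f' d"
    by (simp add: DERIV_def)
  then have lim: "((\<lambda>h. (f (y + h *\<^sub>R d) - f y) / h + c) \<longlongrightarrow> f' d + c) (at_right 0)"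
    by (intro tendsto_intros) (rule filterlim_mono[OF _ order_refl at_le], auto)
  show ?thesis
  proof (rule tendsto_lowerbound[OF lim])
    have "\<forall>\<^sub>F h in at_right (0::real). h \<in> {0<..<1}"
      by (rule eventually_at_right_real) simp
    then show "\<forall>\<^sub>F h in at_right 0. 0 \<le> (f (y + h *\<^sub>R d) - f y) / h + c"
    proof eventually_elim
      case (elim h)
      then show ?case using le[of h] by (simp add: field_simps)
    qed
  qed simp
qed

text \<open>A hyperplane separates the strict hypograph of \<open>- n\<close> from the epigraph of
  \<open>p\<close>; normalized by its last coefficient it is the graph of the desired
  functional.\<close>

lemma convex_sandwich:
  fixes p n :: "'a::euclidean_space \<Rightarrow> real"
  assumes p: "convex_on UNIV p" and n: "convex_on UNIV n" and p_ge: "\<And>w. - n w \<le> p w" and "p 0 = 0" "n 0 = 0"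
  obtains l :: "'a \<Rightarrow>\<^sub>L real" where "\<And>w. - n w \<le> blinfun_apply l w" "\<And>w. blinfun_apply l w \<le> p w"
proof -
  \<comment> \<open>The strict inequality keeps the sets disjoint even where \<open>p\<close> and
    \<open>- n\<close> touch, as they do at 0.\<close>
  define A where "A = {(w, r). r < - n w}"
  define B where "B = epigraph UNIV p"
  have "convex B"
    using convex_epigraphI[OF p] by (simp add: B_def)
  have "convex A"
    unfolding convex_alt
  proof (intro ballI allI impI)
    fix a b and t :: real assume ab: "a \<in> A" "b \<in> A" and t: "0 \<le> t \<and> t \<le> 1"
    obtain w r w' r' where eq: "a = (w, r)" "b = (w', r')" by fastforce
    have "r < - n w" "r' < - n w'" using ab eq by (auto simp: A_def)
    then have "(1 - t) * r + t * r' < (1 - t) * (- n w) + t * (- n w')"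
    proof (cases "t = 0")
      case False
      with \<open>r < - n w\<close> \<open>r' < - n w'\<close> show ?thesis
        using t by (intro add_le_less_mono mult_left_mono mult_strict_left_mono) auto
    qed (use \<open>r < - n w\<close> in simp)
    also have "\<dots> \<le> - n ((1 - t) *\<^sub>R w + t *\<^sub>R w')"
      using convex_onD[OF n, of t w w'] t by simp
    finally show "(1 - t) *\<^sub>R a + t *\<^sub>R b \<in> A" by (simp add: eq A_def)
  qed
  have "x \<notin> B" if "x \<in> A" for x
    using p_ge[of "fst x"] that by (auto simp: A_def B_def epigraph_def)
  then have "A \<inter> B = {}" by blast
  moreover have "(0, -1) \<in> A" "(0, 0) \<in> B" by (auto simp: A_def B_def epigraph_def assms(4,5))
  ultimately obtain a b where a: "a \<noteq> 0" "\<And>x. x \<in> A \<Longrightarrow> inner a x \<le> b" "\<And>x. x \<in> B \<Longrightarrow> b \<le> inner a x"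
    using separating_hyperplane_sets[OF \<open>convex A\<close> \<open>convex B\<close>] by blast
  obtain q \<alpha> where q\<alpha>: "a = (q, \<alpha>)" by fastforce
  have A: "inner q w + \<alpha> * r \<le> b" if "r < - n w" for w r
    using a(2)[of "(w, r)"] that by (simp add: q\<alpha> A_def)
  have B: "b \<le> inner q w + \<alpha> * r" if "p w \<le> r" for w r
    using a(3)[of "(w, r)"] that by (simp add: q\<alpha> B_def epigraph_def)
  have "b \<le> 0" using B[of 0 0] by (simp add: assms(4,5))
  have "- \<alpha> \<le> b" "b \<le> \<alpha>" using A[of "-1" 0] B[of 0 1] by (auto simp: assms(4,5))
  then have "0 \<le> \<alpha>" by simp
  \<comment> \<open>A vertical hyperplane is impossible because both functions are finite on the
    whole space.\<close>
  have "\<alpha> \<noteq> 0"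
  proof
    assume "\<alpha> = 0"
    then have "inner q w \<le> inner q w'" for w w'
      using A[of "- n w - 1" w] B[of w' "p w'"] by simp
    from this[of q 0] have "q = 0" using inner_gt_zero_iff[of q] by fastforce
    then show False using a(1) \<open>\<alpha> = 0\<close> q\<alpha> by (simp add: zero_prod_def)
  qed
  with \<open>0 \<le> \<alpha>\<close> have "0 < \<alpha>" by simp
  \<comment> \<open>Points just below the origin belong to \<open>A\<close>, and the origin itself
    to \<open>B\<close>; the hyperplane passes through it.\<close>
  have "0 \<le> b"
  proof (rule field_le_epsilon)
    show "0 \<le> b + e" if "0 < e" for e
      using A[of "- e / \<alpha>" 0] that \<open>0 < \<alpha>\<close> by (simp add: field_simps assms(4,5))
  qed
  with \<open>b \<le> 0\<close> have "b = 0" by simp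
  define l where "l = blinfun_inner_right (- (inverse \<alpha> *\<^sub>R q))"
  have l: "blinfun_apply l w = - (inner q w / \<alpha>)" for w
    by (simp add: l_def divide_inverse mult.commute)
  have l_le: "blinfun_apply l w \<le> p w" for w
    using B[of w "p w"] \<open>b = 0\<close> \<open>0 < \<alpha>\<close> by (simp add: l field_simps)
  have l_ge: "- n w \<le> blinfun_apply l w" for w
  proof (rule field_le_epsilon)
    fix e :: real assume "0 < e"
    have "inner q w + \<alpha> * (- n w - e) \<le> 0"
      using A[of "- n w - e" w] \<open>0 < e\<close> \<open>b = 0\<close> by simp
    then show "- n w \<le> blinfun_apply l w + e"
      using \<open>0 < \<alpha>\<close> by (simp add: l field_simps)
  qed
  show thesis using that l_le l_ge by blast
qed

locale rate_independent =
  fixes T lam :: real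
    and nrm :: "'a::euclidean_space \<Rightarrow> real"
    and E :: "real \<Rightarrow> 'a \<Rightarrow> real"
    and \<Psi> :: "'a \<Rightarrow> real"
  assumes T_pos: "0 < T"
    and norm_nrm: "is_norm nrm"
    and E_nonneg: "t \<in> {0..T} \<Longrightarrow> 0 \<le> E t x"
    and E_C1: "C1_on ({0..T} \<times> UNIV) (\<lambda>(t, x). E t x)"
    and dt_bound: "t \<in> {0..T} \<Longrightarrow> \<bar>dt T E t x\<bar> \<le> lam * E t x"
    and \<Psi>_nonneg: "0 \<le> \<Psi> v"
    and \<Psi>_convex: "convex_on UNIV \<Psi>"
    and \<Psi>_scale: "0 < c \<Longrightarrow> \<Psi> (c *\<^sub>R v) = c * \<Psi> v"
    and \<Psi>_pos: "v \<noteq> 0 \<Longrightarrow> 0 < \<Psi> v"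
begin

section \<open>The norms, the dual norm and the slope\<close>

lemma \<Psi>_0 [simp]: "\<Psi> 0 = 0"
  using \<Psi>_scale[of 2 0] by simp

lemma \<Psi>_triangle: "\<Psi> (v + w) \<le> \<Psi> v + \<Psi> w"
proof -
  have "\<Psi> (v + w) = 2 * \<Psi> ((1 / 2) *\<^sub>R v + (1 / 2) *\<^sub>R w)"
    using \<Psi>_scale[of 2 "(1 / 2) *\<^sub>R v + (1 / 2) *\<^sub>R w"] by (simp add: scaleR_add_right)
  also have "\<dots> \<le> 2 * ((1 / 2) * \<Psi> v + (1 / 2) * \<Psi> w)"
    using convex_onD[OF \<Psi>_convex, of "1 / 2" v w] by simp
  finally show ?thesis by simp
qed

lemma \<Psi>_continuous: "continuous_on UNIV \<Psi>"
  using \<Psi>_convex by (intro convex_on_continuous) auto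

lemma \<Psi>_tendsto: "(f \<longlongrightarrow> l) F \<Longrightarrow> ((\<lambda>x. \<Psi> (f x)) \<longlongrightarrow> \<Psi> l) F"
  using \<Psi>_continuous by (intro isCont_tendsto_compose[of _ \<Psi>]) (auto simp: continuous_on_eq_continuous_at)

lemma \<Psi>_bounds:
  obtains c C where "0 < c" "0 < C" "\<And>v. c * norm v \<le> \<Psi> v" "\<And>v. \<Psi> v \<le> C * norm v"
  using sublinear_bounds[OF \<Psi>_continuous \<Psi>_scale \<Psi>_pos \<Psi>_0] by blast

lemma nrm_nonneg [simp]: "0 \<le> nrm v" and nrm_0 [simp]: "nrm 0 = 0"
  and nrm_scale: "nrm (c *\<^sub>R v) = \<bar>c\<bar> * nrm v" and nrm_triangle: "nrm (v + w) \<le> nrm v + nrm w"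
  using norm_nrm by (auto simp: is_norm_def)

lemma nrm_minus [simp]: "nrm (- v) = nrm v"
  using nrm_scale[of "-1" v] by simp

lemma nrm_pos: "v \<noteq> 0 \<Longrightarrow> 0 < nrm v"
  using norm_nrm by (simp add: is_norm_def order_less_le)

lemma nrm_convex: "convex_on UNIV nrm"
proof (rule convex_onI)
  show "nrm ((1 - t) *\<^sub>R x + t *\<^sub>R y) \<le> (1 - t) * nrm x + t * nrm y" if "0 < t" "t < 1" for t x y
    using nrm_triangle[of "(1 - t) *\<^sub>R x" "t *\<^sub>R y"] that by (simp add: nrm_scale)
qed simp

lemma nrm_continuous: "continuous_on UNIV nrm"
  using nrm_convex by (intro convex_on_continuous) auto

lemma nrm_bounds:
  obtains c C where "0 < c" "0 < C" "\<And>v. c * norm v \<le> nrm v" "\<And>v. nrm v \<le> C * norm v"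
  using sublinear_bounds[OF nrm_continuous, of thesis] nrm_scale nrm_pos by auto

text \<open>A supremum of reals can be estimated only for sets bounded above, so this underlies all
  bounds on \<open>dual_norm\<close>.\<close>

lemma dual_norm_bdd: "bdd_above ((\<lambda>v. \<bar>blinfun_apply \<eta> v\<bar> / nrm v) ` (- {0}))"
proof -
  obtain c where c: "0 < c" "\<And>v. c * norm v \<le> nrm v" using nrm_bounds by metis
  have "\<bar>blinfun_apply \<eta> v\<bar> / nrm v \<le> norm \<eta> / c" if "v \<noteq> 0" for v
  proof -
    have "\<bar>blinfun_apply \<eta> v\<bar> * c \<le> norm \<eta> * (c * norm v)"
      using norm_blinfun[of \<eta> v] c(1) by (simp add: mult.left_commute mult.commute)
    also have "\<dots> \<le> norm \<eta> * nrm v"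
      using c(2) by (intro mult_left_mono) auto
    finally show ?thesis using c(1) nrm_pos[OF that] by (simp add: field_simps)
  qed
  then show ?thesis by (intro bdd_aboveI2[of _ _ "norm \<eta> / c"]) auto
qed

lemma dual_norm_apply: "\<bar>blinfun_apply \<eta> v\<bar> \<le> dual_norm nrm \<eta> * nrm v"
proof (cases "v = 0")
  case False
  then have "\<bar>blinfun_apply \<eta> v\<bar> / nrm v \<le> dual_norm nrm \<eta>"
    unfolding dual_norm_def by (intro cSUP_upper dual_norm_bdd) auto
  then show ?thesis using nrm_pos[OF False] by (simp add: field_simps)
qed simp

lemma dual_norm_leI:
  assumes "\<And>v. \<bar>blinfun_apply \<eta> v\<bar> \<le> k * nrm v"
  shows "dual_norm nrm \<eta> \<le> k"
  unfolding dual_norm_def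
proof (rule cSUP_least)
  obtain b :: 'a where "b \<in> Basis" using nonempty_Basis by blast
  then have "b \<noteq> 0" using nonzero_Basis by blast
  then show "- {0::'a} \<noteq> {}" by auto
  show "\<bar>blinfun_apply \<eta> v\<bar> / nrm v \<le> k" if "v \<in> - {0}" for v
    using assms[of v] nrm_pos[of v] that by (simp add: field_simps)
qed

lemma dual_norm_nonneg: "0 \<le> dual_norm nrm \<eta>"
proof -
  obtain b :: 'a where "b \<in> Basis" using nonempty_Basis by blast
  then have "b \<noteq> 0" using nonzero_Basis by blast
  have "0 \<le> \<bar>blinfun_apply \<eta> b\<bar>" by simp
  also have "\<dots> \<le> dual_norm nrm \<eta> * nrm b" by (rule dual_norm_apply)
  finally show ?thesis using nrm_pos[OF \<open>b \<noteq> 0\<close>] by (simp add: zero_le_mult_iff)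
qed

lemma dual_norm_triangle: "dual_norm nrm (\<eta> + \<zeta>) \<le> dual_norm nrm \<eta> + dual_norm nrm \<zeta>"
proof (rule dual_norm_leI)
  show "\<bar>blinfun_apply (\<eta> + \<zeta>) v\<bar> \<le> (dual_norm nrm \<eta> + dual_norm nrm \<zeta>) * nrm v" for v
    using dual_norm_apply[of \<eta> v] dual_norm_apply[of \<zeta> v] by (simp add: blinfun.add_left distrib_right)
qed

lemma dual_norm_le_norm:
  obtains K where "0 < K" "\<And>\<eta>. dual_norm nrm \<eta> \<le> K * norm \<eta>"
proof -
  obtain c where c: "0 < c" "\<And>v. c * norm v \<le> nrm v" using nrm_bounds by metis
  have "dual_norm nrm \<eta> \<le> 1 / c * norm \<eta>" for \<eta>
  proof (rule dual_norm_leI)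
    fix v
    have "\<bar>blinfun_apply \<eta> v\<bar> \<le> norm \<eta> * norm v" using norm_blinfun[of \<eta> v] by simp
    also have "\<dots> \<le> norm \<eta> * (nrm v / c)"
      using c by (intro mult_left_mono) (auto simp: field_simps)
    finally show "\<bar>blinfun_apply \<eta> v\<bar> \<le> 1 / c * norm \<eta> * nrm v" by (simp add: field_simps)
  qed
  then show thesis using that[of "1 / c"] c(1) by simp
qed

text \<open>The distance of \<open>- \<xi>\<close> from the convex set
  \<open>subdiff0 \<Psi>\<close> in the dual norm. It vanishes if \<open>- \<xi>\<close> belongs to
  this set, that is, at stable points when \<xi> is the differential of the energy.\<close>

definition slope :: "('a \<Rightarrow>\<^sub>L real) \<Rightarrow> real" where
  "slope \<xi> = (INF z\<in>subdiff0 \<Psi>. dual_norm nrm (\<xi> + z))"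

lemma zero_in_subdiff0: "0 \<in> subdiff0 \<Psi>"
  by (simp add: subdiff0_def \<Psi>_nonneg)

lemma slope_bdd: "bdd_below ((\<lambda>z. dual_norm nrm (\<xi> + z)) ` subdiff0 \<Psi>)"
  by (intro bdd_belowI2[of _ 0] dual_norm_nonneg)

lemma slope_le: "z \<in> subdiff0 \<Psi> \<Longrightarrow> slope \<xi> \<le> dual_norm nrm (\<xi> + z)"
  unfolding slope_def by (intro cINF_lower slope_bdd)

lemma slope_nonneg: "0 \<le> slope \<xi>"
  unfolding slope_def using zero_in_subdiff0 by (intro cINF_greatest dual_norm_nonneg) auto

text \<open>A distance function is 1-Lipschitz. Together with continuity of \<open>dx\<close> this
  moves slope estimates to nearby points and times.\<close>

lemma slope_diff: "slope \<xi> \<le> slope \<zeta> + dual_norm nrm (\<xi> - \<zeta>)"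
proof -
  have "slope \<xi> - dual_norm nrm (\<xi> - \<zeta>) \<le> slope \<zeta>"
    unfolding slope_def[of \<zeta>]
  proof (rule cINF_greatest)
    show "slope \<xi> - dual_norm nrm (\<xi> - \<zeta>) \<le> dual_norm nrm (\<zeta> + z)" if "z \<in> subdiff0 \<Psi>" for z
      using slope_le[OF that, of \<xi>] dual_norm_triangle[of "\<xi> - \<zeta>" "\<zeta> + z"] by simp
  qed (use zero_in_subdiff0 in auto)
  then show ?thesis by simp
qed

text \<open>For each \<open>z\<close> in the subdifferential, \<open>- \<xi>\<close> is
  \<open>z\<close> minus \<open>\<xi> + z\<close>; the first part is bounded by \<Psi>, the second
  by the dual norm. Hence the integrand of the transition cost dominates the rate at which energy
  decreases along a curve.\<close>

lemma slope_pairing: "- blinfun_apply \<xi> v \<le> \<Psi> v + nrm v * slope \<xi>"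
proof (cases "v = 0")
  case False
  have "(- blinfun_apply \<xi> v - \<Psi> v) / nrm v \<le> slope \<xi>"
    unfolding slope_def
  proof (rule cINF_greatest)
    fix z assume "z \<in> subdiff0 \<Psi>"
    then have "- blinfun_apply \<xi> v - \<Psi> v \<le> \<bar>blinfun_apply (\<xi> + z) v\<bar>"
      by (auto simp: subdiff0_def blinfun.add_left dest!: spec[of _ v])
    also have "\<dots> \<le> dual_norm nrm (\<xi> + z) * nrm v" by (rule dual_norm_apply)
    finally show "(- blinfun_apply \<xi> v - \<Psi> v) / nrm v \<le> dual_norm nrm (\<xi> + z)"
      using nrm_pos[OF False] by (simp add: field_simps)
  qed (use zero_in_subdiff0 in auto)
  then show ?thesis using nrm_pos[OF False] by (simp add: field_simps)
qed simp

text \<open>If the minimum is \<open>- k * \<epsilon>\<close>, then \<open>- k * nrm \<le> \<xi> + \<Psi>\<close> everywhere by homogeneity, and any linear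
  functional in between has the form \<open>\<xi> + z\<close> with \<open>z\<close> in the subdifferential and dual norm at most \<open>k\<close>.\<close>

lemma slope_minimizer:
  assumes "0 < \<epsilon>" "nrm v \<le> \<epsilon>"
    and min: "\<And>w. nrm w \<le> \<epsilon> \<Longrightarrow> blinfun_apply \<xi> v + \<Psi> v \<le> blinfun_apply \<xi> w + \<Psi> w"
  shows "\<Psi> v + nrm v * slope \<xi> \<le> - blinfun_apply \<xi> v"
proof -
  define p where "p w = blinfun_apply \<xi> w + \<Psi> w" for w
  define k where "k = - p v / \<epsilon>"
  have "0 \<le> k" using min[of 0] \<open>0 < \<epsilon>\<close> by (simp add: k_def p_def field_simps)
  have p_ge: "- k * nrm w \<le> p w" for w
  proof (cases "w = 0")
    case False
    have "p v \<le> p ((\<epsilon> / nrm w) *\<^sub>R w)"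
      using min[of "(\<epsilon> / nrm w) *\<^sub>R w"] nrm_pos[OF False] \<open>0 < \<epsilon>\<close> by (simp add: p_def nrm_scale)
    also have "\<dots> = \<epsilon> / nrm w * p w"
      using nrm_pos[OF False] \<open>0 < \<epsilon>\<close> by (simp add: p_def \<Psi>_scale blinfun.scaleR_right algebra_simps)
    finally show ?thesis using nrm_pos[OF False] \<open>0 < \<epsilon>\<close> by (simp add: k_def field_simps)
  qed (simp add: p_def)
  have p_convex: "convex_on UNIV p"
    unfolding p_def by (intro convex_on_add \<Psi>_convex)
      (simp add: convex_on_def blinfun.add_right blinfun.scaleR_right)
  have n_convex: "convex_on UNIV (\<lambda>w. k * nrm w)"
    using \<open>0 \<le> k\<close> by (intro convex_on_cmul nrm_convex)
  obtain l :: "'a \<Rightarrow>\<^sub>L real" where l: "\<And>w. - (k * nrm w) \<le> blinfun_apply l w" "\<And>w. blinfun_apply l w \<le> p w"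
    by (rule convex_sandwich[OF p_convex n_convex]) (use p_ge in \<open>auto simp: p_def\<close>)
  have "l - \<xi> \<in> subdiff0 \<Psi>"
    using l(2) by (auto simp: subdiff0_def blinfun.diff_left p_def algebra_simps)
  then have "slope \<xi> \<le> dual_norm nrm l"
    using slope_le[of "l - \<xi>" \<xi>] by simp
  also have "\<dots> \<le> k"
  proof (rule dual_norm_leI)
    show "\<bar>blinfun_apply l w\<bar> \<le> k * nrm w" for w
      using l(1)[of w] l(1)[of "- w"] by (simp add: blinfun.minus_right abs_le_iff)
  qed
  finally have "nrm v * slope \<xi> \<le> nrm v * k"
    by (intro mult_left_mono) auto
  also have "\<dots> \<le> \<epsilon> * k" using assms(2) \<open>0 \<le> k\<close> by (intro mult_right_mono) auto
  also have "\<dots> = - p v" using \<open>0 < \<epsilon>\<close> by (simp add: k_def)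
  finally show ?thesis by (simp add: p_def)
qed


section \<open>Calculus for the energy and its minimizers\<close>

abbreviation "strip \<equiv> {0..T} \<times> (UNIV :: 'a set)"

text \<open>\<open>dt\<close> and \<open>dx\<close> are defined separately, one within the interval
  and one on the space. They are the two blocks of the joint derivative on the strip and inherit its
  continuity.\<close>

lemma E_derivatives:
  shows E_has_derivative: "t \<in> {0..T} \<Longrightarrow>
      ((\<lambda>(s, y). E s y) has_derivative (\<lambda>(h, k). dt T E t x * h + blinfun_apply (dx E t x) k)) (at (t, x) within strip)"
    and E_dx: "t \<in> {0..T} \<Longrightarrow> (E t has_derivative blinfun_apply (dx E t x)) (at x)"
    and E_dt: "t \<in> {0..T} \<Longrightarrow> ((\<lambda>s. E s x) has_real_derivative dt T E t x) (at t within {0..T})"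
    and dx_continuous: "continuous_on strip (\<lambda>(t, x). dx E t x)"
    and dt_continuous: "continuous_on strip (\<lambda>(t, x). dt T E t x)"
proof -
  obtain E' :: "real \<times> 'a \<Rightarrow> (real \<times> 'a) \<Rightarrow>\<^sub>L real" where
    E': "\<And>z. z \<in> strip \<Longrightarrow> ((\<lambda>(t, x). E t x) has_derivative blinfun_apply (E' z)) (at z within strip)"
    and cont: "continuous_on strip E'"
    using E_C1 unfolding C1_on_def by blast
  have incl: "bounded_linear (\<lambda>k::'a. (0::real, k))"
    by (intro bounded_linear_Pair bounded_linear_zero bounded_linear_ident)
  have d1: "(E t has_derivative (\<lambda>k. blinfun_apply (E' (t, x)) (0, k))) (at x)" if "t \<in> {0..T}" for t x
  proof -
    have "((\<lambda>(t, x). E t x) has_derivative blinfun_apply (E' (t, x))) (at (t, x) within range (Pair t))"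
      using E'[of "(t, x)"] that by (auto intro: has_derivative_subset)
    moreover have "(Pair t has_derivative (\<lambda>k. (0, k))) (at x)"
      by (auto intro!: derivative_eq_intros)
    ultimately show ?thesis
      using has_derivative_in_compose[of "Pair t" "\<lambda>k. (0, k)" x UNIV "\<lambda>(t, x). E t x"] by simp
  qed
  have dx_eq: "blinfun_apply (dx E t x) k = blinfun_apply (E' (t, x)) (0, k)" if "t \<in> {0..T}" for t x k
    unfolding dx_def frechet_derivative_at[OF d1[OF that], symmetric]
    by (subst bounded_linear_Blinfun_apply) (auto intro: has_derivative_bounded_linear[OF d1[OF that]])
  have d2: "((\<lambda>s. E s x) has_real_derivative blinfun_apply (E' (t, x)) (1, 0)) (at t within {0..T})"
    if "t \<in> {0..T}" for t x
  proof -
    have "((\<lambda>(t, x). E t x) has_derivative blinfun_apply (E' (t, x))) (at (t, x) within (\<lambda>s. (s, x)) ` {0..T})"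
      using E'[of "(t, x)"] that by (auto intro: has_derivative_subset)
    moreover have "((\<lambda>s. (s, x)) has_derivative (\<lambda>h. (h, 0))) (at t within {0..T})"
      by (auto intro!: derivative_eq_intros)
    ultimately have 1: "((\<lambda>s. E s x) has_derivative (\<lambda>h. blinfun_apply (E' (t, x)) (h, 0))) (at t within {0..T})"
      using has_derivative_in_compose[of "\<lambda>s. (s, x)" "\<lambda>h. (h, 0)" t "{0..T}" "\<lambda>(t, x). E t x"] by simp
    have 2: "blinfun_apply (E' (t, x)) (h, 0) = h * blinfun_apply (E' (t, x)) (1, 0)" for h
      using blinfun.scaleR_right[of "E' (t, x)" h "(1, 0)"] by simp
    show ?thesis
      unfolding has_field_derivative_def by (rule has_derivative_eq_rhs[OF 1]) (rule ext, subst 2, rule mult.commute)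
  qed
  have dt_eq: "dt T E t x = blinfun_apply (E' (t, x)) (1, 0)" if "t \<in> {0..T}" for t x
    unfolding dt_def cbox_interval[symmetric]
  proof (rule vector_derivative_within_cbox[OF T_pos])
    show "((\<lambda>s. E s x) has_vector_derivative blinfun_apply (E' (t, x)) (1, 0)) (at t within cbox 0 T)"
      using d2[OF that] unfolding has_real_derivative_iff_has_vector_derivative by simp
  qed (use that in simp)
  show "((\<lambda>(s, y). E s y) has_derivative (\<lambda>(h, k). dt T E t x * h + blinfun_apply (dx E t x) k)) (at (t, x) within strip)"
    if "t \<in> {0..T}"
  proof -
    have 1: "blinfun_apply (E' (t, x)) (h, k) = dt T E t x * h + blinfun_apply (dx E t x) k" for h k
      using blinfun.add_right[of "E' (t, x)" "h *\<^sub>R (1, 0)" "(0, k)"] blinfun.scaleR_right[of "E' (t, x)" h "(1, 0)"]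
      by (simp add: dx_eq[OF that] dt_eq[OF that])
    show ?thesis
      by (rule has_derivative_eq_rhs[OF E']) (use that 1 in \<open>auto simp: fun_eq_iff\<close>)
  qed
  show "(E t has_derivative blinfun_apply (dx E t x)) (at x)" if "t \<in> {0..T}"
    by (rule has_derivative_eq_rhs[OF d1[OF that]]) (simp add: fun_eq_iff dx_eq[OF that])
  show "((\<lambda>s. E s x) has_real_derivative dt T E t x) (at t within {0..T})" if "t \<in> {0..T}"
    using d2[OF that] by (simp add: dt_eq[OF that])
  have "continuous_on strip (\<lambda>z. E' z o\<^sub>L Blinfun (\<lambda>k. (0, k)))"
    by (intro bounded_bilinear.continuous_on[OF bounded_bilinear_blinfun_compose] cont continuous_on_const)
  then show "continuous_on strip (\<lambda>(t, x). dx E t x)"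
  proof (rule continuous_on_eq)
    show "E' z o\<^sub>L Blinfun (\<lambda>k. (0, k)) = (case z of (t, x) \<Rightarrow> dx E t x)" if "z \<in> strip" for z
      using that by (auto intro!: blinfun_eqI simp: dx_eq bounded_linear_Blinfun_apply[OF incl])
  qed
  have "continuous_on strip (\<lambda>z. blinfun_apply (E' z) (1, 0))"
    by (intro continuous_intros cont)
  then show "continuous_on strip (\<lambda>(t, x). dt T E t x)"
    by (rule continuous_on_eq) (auto simp: dt_eq)
qed

lemma tendsto_strip:
  fixes g :: "real \<Rightarrow> 'a \<Rightarrow> 'c::topological_space"
  assumes "continuous_on strip (\<lambda>(t, x). g t x)"
    and "(f \<longlongrightarrow> t) F" "(h \<longlongrightarrow> x) F" "t \<in> {0..T}" "\<forall>\<^sub>F i in F. f i \<in> {0..T}"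
  shows "((\<lambda>i. g (f i) (h i)) \<longlongrightarrow> g t x) F"
  using continuous_on_tendsto_compose[OF assms(1), of "\<lambda>i. (f i, h i)" "(t, x)" F]
    tendsto_Pair[OF assms(2,3)] assms(4,5) by simp

lemma E_continuous: "continuous_on strip (\<lambda>(t, x). E t x)"
  unfolding continuous_on_eq_continuous_within
  using has_derivative_continuous[OF E_has_derivative] by auto

lemmas E_tendsto = tendsto_strip[OF E_continuous]
  and dx_tendsto = tendsto_strip[OF dx_continuous]
  and dt_tendsto = tendsto_strip[OF dt_continuous]

lemma E_x_continuous: "t \<in> {0..T} \<Longrightarrow> continuous_on UNIV (E t)"
  using E_dx by (intro has_derivative_continuous_on) auto

text \<open>Gronwall: \<open>exp (- \<bar>lam\<bar> * r) * E r x\<close> is nonincreasing in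
  \<open>r\<close>. The modulus is used because the sign of \<open>lam\<close> is not
  prescribed.\<close>

lemma E_growth:
  assumes "0 \<le> s" "s \<le> t" "t \<le> T"
  shows "E t x \<le> exp (\<bar>lam\<bar> * (t - s)) * E s x"
proof -
  define f where "f r = exp (- \<bar>lam\<bar> * r) * E r x" for r
  have f: "(f has_real_derivative exp (- \<bar>lam\<bar> * r) * (dt T E r x - \<bar>lam\<bar> * E r x)) (at r within {0..T})"
    if "r \<in> {0..T}" for r
    unfolding f_def using that by (auto intro!: derivative_eq_intros E_dt simp: algebra_simps)
  have "f t \<le> f s"
  proof (rule DERIV_nonpos_imp_decreasing_open[OF assms(2)])
    fix r assume r: "s < r" "r < t"
    then have "at r within {0..T} = at r" using assms by (intro at_within_Icc_at) auto
    moreover have "exp (- \<bar>lam\<bar> * r) * (dt T E r x - \<bar>lam\<bar> * E r x) \<le> 0"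
    proof (rule mult_nonneg_nonpos)
      have "lam * E r x \<le> \<bar>lam\<bar> * E r x"
        using E_nonneg[of r x] r assms by (intro mult_right_mono) auto
      then show "dt T E r x - \<bar>lam\<bar> * E r x \<le> 0"
        using dt_bound[of r x] r assms by simp
    qed simp
    ultimately show "\<exists>y. (f has_real_derivative y) (at r) \<and> y \<le> 0"
      using f[of r] r assms by auto
  next
    show "continuous_on {s..t} f"
    proof (rule continuous_on_subset)
      show "continuous_on {0..T} f" using f by (rule DERIV_continuous_on)
    qed (use assms in auto)
  qed
  then have "exp (\<bar>lam\<bar> * t) * f t \<le> exp (\<bar>lam\<bar> * t) * f s"
    by (intro mult_left_mono) auto
  also have "\<dots> = exp (\<bar>lam\<bar> * t) * exp (- \<bar>lam\<bar> * s) * E s x" by (simp add: f_def)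
  also have "exp (\<bar>lam\<bar> * t) * exp (- \<bar>lam\<bar> * s) = exp (\<bar>lam\<bar> * (t - s))"
    by (simp add: exp_add[symmetric] algebra_simps)
  also have "exp (\<bar>lam\<bar> * t) * f t = E t x"
    by (simp add: f_def exp_minus_inverse mult.assoc[symmetric])
  finally show ?thesis .
qed

lemma E_dt_integral:
  assumes "0 \<le> s" "s \<le> t" "t \<le> T"
  shows "((\<lambda>r. dt T E r x) has_integral (E t x - E s x)) {s..t}"
  using assms
  by (intro fundamental_theorem_of_calculus)
    (auto intro!: has_vector_derivative_within_subset[OF E_dt[unfolded has_real_derivative_iff_has_vector_derivative]])

lemma dt_abs_bound:
  assumes "t \<in> {0..T}" "E t x \<le> M"
  shows "\<bar>dt T E t x\<bar> \<le> \<bar>lam\<bar> * M"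
proof -
  have "\<bar>dt T E t x\<bar> \<le> lam * E t x" using assms dt_bound by auto
  also have "\<dots> \<le> \<bar>lam\<bar> * E t x" using E_nonneg[OF assms(1)] by (intro mult_right_mono) auto
  also have "\<dots> \<le> \<bar>lam\<bar> * M" using assms(2) by (intro mult_left_mono) auto
  finally show ?thesis .
qed

lemma stable_iff_slope: "- \<xi> \<in> subdiff0 \<Psi> \<longleftrightarrow> (\<forall>v. - blinfun_apply \<xi> v \<le> \<Psi> v)"
  by (simp add: subdiff0_def blinfun.minus_left)

lemma local_min_stable:
  assumes "t \<in> {0..T}" "0 < \<epsilon>" "\<And>y. nrm (y - x) \<le> \<epsilon> \<Longrightarrow> E t x \<le> E t y + \<Psi> (y - x)"
  shows "- dx E t x \<in> subdiff0 \<Psi>"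
  unfolding stable_iff_slope
proof
  fix v
  \<comment> \<open>Scales \<open>v\<close> so that the whole segment to
    \<open>x + c *\<^sub>R v\<close> stays in the ball; the 1 avoids dividing by 0.\<close>
  define c where "c = \<epsilon> / (1 + nrm v)"
  have "0 < c" using assms(2) nrm_nonneg[of v] by (simp add: c_def add_pos_nonneg)
  have "0 \<le> blinfun_apply (dx E t x) (c *\<^sub>R v) + \<Psi> (c *\<^sub>R v)"
  proof (rule first_order_condition[OF E_dx[OF assms(1)]])
    fix h :: real assume h: "0 < h" "h < 1"
    have "nrm (h *\<^sub>R c *\<^sub>R v) = h * (\<epsilon> * (nrm v / (1 + nrm v)))"
      using h assms(2) \<open>0 < c\<close> by (simp add: nrm_scale c_def)
    also have "\<dots> \<le> 1 * (\<epsilon> * 1)"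
      using h assms(2) nrm_nonneg[of v] by (intro mult_mono) (auto simp: divide_le_eq_1 add_pos_nonneg)
    finally show "E t x \<le> E t (x + h *\<^sub>R c *\<^sub>R v) + h * \<Psi> (c *\<^sub>R v)"
      using assms(3)[of "x + h *\<^sub>R c *\<^sub>R v"] \<Psi>_scale[OF h(1), of "c *\<^sub>R v"] by simp
  qed
  also have "\<dots> = c * (blinfun_apply (dx E t x) v + \<Psi> v)"
    using \<open>0 < c\<close> by (simp add: \<Psi>_scale blinfun.scaleR_right algebra_simps)
  finally show "- blinfun_apply (dx E t x) v \<le> \<Psi> v"
    using \<open>0 < c\<close> by (simp add: zero_le_mult_iff)
qed

text \<open>The ball and \<Psi> are convex, so moving from \<open>y\<close> towards
  \<open>x + w\<close> is an allowed variation. It shows that \<open>y - x\<close> minimizes the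
  linearized functional on the ball, to which \<open>slope_minimizer\<close> applies.\<close>

lemma incremental_slope:
  assumes "t \<in> {0..T}" "0 < \<epsilon>" "nrm (y - x) \<le> \<epsilon>"
    and min: "\<And>z. nrm (z - x) \<le> \<epsilon> \<Longrightarrow> E t y + \<Psi> (y - x) \<le> E t z + \<Psi> (z - x)"
  shows "\<Psi> (y - x) + nrm (y - x) * slope (dx E t y) \<le> - blinfun_apply (dx E t y) (y - x)"
proof (rule slope_minimizer[OF assms(2,3)])
  fix w assume w: "nrm w \<le> \<epsilon>"
  define v where "v = y - x"
  have "0 \<le> blinfun_apply (dx E t y) (w - v) + (\<Psi> w - \<Psi> v)"
  proof (rule first_order_condition[OF E_dx[OF assms(1)]])
    fix h :: real assume h: "0 < h" "h < 1"
    have *: "y + h *\<^sub>R (w - v) - x = (1 - h) *\<^sub>R v + h *\<^sub>R w"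
      by (simp add: v_def algebra_simps)
    have "nrm (y + h *\<^sub>R (w - v) - x) \<le> (1 - h) * nrm v + h * nrm w"
      unfolding * using convex_onD[OF nrm_convex, of h v w] h by simp
    also have "\<dots> \<le> (1 - h) * \<epsilon> + h * \<epsilon>"
      using h w assms(3) by (intro add_mono mult_left_mono) (auto simp: v_def)
    finally have "E t y + \<Psi> v \<le> E t (y + h *\<^sub>R (w - v)) + \<Psi> (y + h *\<^sub>R (w - v) - x)"
      using min[of "y + h *\<^sub>R (w - v)"] by (simp add: v_def algebra_simps)
    also have "\<Psi> (y + h *\<^sub>R (w - v) - x) \<le> (1 - h) * \<Psi> v + h * \<Psi> w"
      unfolding * using convex_onD[OF \<Psi>_convex, of h v w] h by simp
    finally show "E t y \<le> E t (y + h *\<^sub>R (w - v)) + h * (\<Psi> w - \<Psi> v)"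
      by (simp add: algebra_simps)
  qed
  then show "blinfun_apply (dx E t y) (y - x) + \<Psi> (y - x) \<le> blinfun_apply (dx E t y) w + \<Psi> w"
    by (simp add: v_def blinfun.diff_right)
qed

end

section \<open>Helly's selection theorem\<close>

lemma mono_one_sided_limits:
  fixes V :: "real \<Rightarrow> real"
  assumes "mono V"
  shows "\<exists>l. (V \<longlongrightarrow> l) (at_right t)" "\<exists>l. (V \<longlongrightarrow> l) (at_left t)"
  using Lim_right_bound[of UNIV t V "V t"] Lim_left_bound[of UNIV t V "V t"] monoD[OF assms]
  by (auto simp: less_imp_le)

lemma mono_on_one_sided_limits:
  fixes V :: "real \<Rightarrow> real"
  assumes "mono_on {a..b} V"
  shows "a \<le> t \<Longrightarrow> t < b \<Longrightarrow> \<exists>l. (V \<longlongrightarrow> l) (at_right t)"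
    and "a < t \<Longrightarrow> t \<le> b \<Longrightarrow> \<exists>l. (V \<longlongrightarrow> l) (at_left t)"
proof -
  define W where "W t = V (max a (min b t))" for t
  have W: "mono W" if "a \<le> b"
    unfolding W_def using that by (intro monoI mono_onD[OF assms]) auto
  have WV: "W t = V t" if "t \<in> {a..b}" for t
    using that by (simp add: W_def min_absorb2 max_absorb2)
  show "\<exists>l. (V \<longlongrightarrow> l) (at_right t)" if t: "a \<le> t" "t < b"
  proof -
    have "mono W" using t by (intro W) simp
    then obtain l where l: "(W \<longlongrightarrow> l) (at_right t)" using mono_one_sided_limits by blast
    have "\<forall>\<^sub>F s in at_right t. s \<in> {t<..<b}" using t by (intro eventually_at_right_real)
    then have "\<forall>\<^sub>F s in at_right t. W s = V s" by eventually_elim (use t WV in auto)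
    then show ?thesis using l tendsto_cong by blast
  qed
  show "\<exists>l. (V \<longlongrightarrow> l) (at_left t)" if t: "a < t" "t \<le> b"
  proof -
    have "mono W" using t by (intro W) simp
    then obtain l where l: "(W \<longlongrightarrow> l) (at_left t)" using mono_one_sided_limits by blast
    have "\<forall>\<^sub>F s in at_left t. s \<in> {a<..<t}" using t by (intro eventually_at_left_real)
    then have "\<forall>\<^sub>F s in at_left t. W s = V s" by eventually_elim (use t WV in auto)
    then show ?thesis using l tendsto_cong by blast
  qed
qed

text \<open>Both \<open>V\<close> and \<open>V + x \<bullet> i\<close> are monotone, so one-sided
  limits and countability of the jumps carry over from monotone scalar functions to the
  curve.\<close>

locale dominated_increments =
  fixes x :: "real \<Rightarrow> 'a::euclidean_space" and V :: "real \<Rightarrow> real" and T :: real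
  assumes increments: "\<lbrakk>0 \<le> s; s \<le> t; t \<le> T\<rbrakk> \<Longrightarrow> norm (x t - x s) \<le> V t - V s"
begin

lemma V_mono: "mono_on {0..T} V"
proof (rule mono_onI)
  show "V s \<le> V t" if "s \<in> {0..T}" "t \<in> {0..T}" "s \<le> t" for s t
    using order_trans[OF norm_ge_zero increments[of s t]] that by simp
qed

lemma component_mono: "i \<in> Basis \<Longrightarrow> mono_on {0..T} (\<lambda>t. V t + x t \<bullet> i)"
proof (rule mono_onI)
  show "V s + x s \<bullet> i \<le> V t + x t \<bullet> i" if "s \<in> {0..T}" "t \<in> {0..T}" "s \<le> t" "i \<in> Basis" for s t
    using increments[of s t] Basis_le_norm[OF that(4), of "x t - x s"] that
    by (simp add: inner_diff_left abs_le_iff)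
qed

lemma one_sided_limit:
  assumes "\<exists>l. (V \<longlongrightarrow> l) F" "\<And>i. i \<in> Basis \<Longrightarrow> \<exists>l. ((\<lambda>t. V t + x t \<bullet> i) \<longlongrightarrow> l) F"
  shows "\<exists>l. (x \<longlongrightarrow> l) F"
proof -
  obtain v where v: "(V \<longlongrightarrow> v) F" using assms(1) by blast
  obtain w where w: "\<And>i. i \<in> Basis \<Longrightarrow> ((\<lambda>t. V t + x t \<bullet> i) \<longlongrightarrow> w i) F"
    using assms(2) by metis
  have "(x \<longlongrightarrow> (\<Sum>i\<in>Basis. (w i - v) *\<^sub>R i)) F"
    unfolding tendsto_componentwise_iff[of x]
  proof
    fix i :: 'a assume "i \<in> Basis"
    then show "((\<lambda>t. x t \<bullet> i) \<longlongrightarrow> (\<Sum>i\<in>Basis. (w i - v) *\<^sub>R i) \<bullet> i) F"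
      using tendsto_diff[OF w[of i] v] by simp
  qed
  then show ?thesis by blast
qed

lemma right_limit: "0 \<le> t \<Longrightarrow> t < T \<Longrightarrow> (x \<longlongrightarrow> right_lim x t) (at_right t)"
  using one_sided_limit[OF mono_on_one_sided_limits(1)[OF V_mono] mono_on_one_sided_limits(1)[OF component_mono], of t]
    tendsto_Lim[OF trivial_limit_at_right_real] by metis

lemma left_limit: "0 < t \<Longrightarrow> t \<le> T \<Longrightarrow> (x \<longlongrightarrow> left_lim x t) (at_left t)"
  using one_sided_limit[OF mono_on_one_sided_limits(2)[OF V_mono] mono_on_one_sided_limits(2)[OF component_mono], of t]
    tendsto_Lim[OF trivial_limit_at_left_real] by metis

lemma continuous_where_V:
  assumes "t \<in> {0..T}" "continuous (at t within {0..T}) V"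
  shows "continuous (at t within {0..T}) x"
  unfolding continuous_within
proof (rule Lim_null[THEN iffD2], rule Lim_null_comparison)
  show "\<forall>\<^sub>F s in at t within {0..T}. norm (x s - x t) \<le> \<bar>V s - V t\<bar>"
    unfolding eventually_at_filter
  proof (rule always_eventually, intro allI impI)
    fix s assume "s \<in> {0..T}"
    then show "norm (x s - x t) \<le> \<bar>V s - V t\<bar>"
      using increments[of s t] increments[of t s] assms(1)
      by (cases "s \<le> t") (auto simp: norm_minus_commute)
  qed
  have "((\<lambda>s. \<bar>V s - V t\<bar>) \<longlongrightarrow> \<bar>V t - V t\<bar>) (at t within {0..T})"
    using assms(2) unfolding continuous_within by (intro tendsto_intros)
  then show "((\<lambda>s. \<bar>V s - V t\<bar>) \<longlongrightarrow> 0) (at t within {0..T})" by simp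
qed

lemma countable_jumps: "countable (jump_set T x)"
  by (rule countable_subset[OF _ mono_on_ctble_discont[OF V_mono]])
    (use continuous_where_V in \<open>auto simp: jump_set_def\<close>)

lemma not_jump:
  assumes "0 < t" "t < T" "t \<notin> jump_set T x"
  shows "left_lim x t = x t" "right_lim x t = x t"
proof -
  have "at t within {0..T} = at t" using assms by (intro at_within_Icc_at) auto
  then have "(x \<longlongrightarrow> x t) (at t)"
    using assms by (auto simp: jump_set_def continuous_within)
  then have "(x \<longlongrightarrow> x t) (at_left t)" "(x \<longlongrightarrow> x t) (at_right t)"
    by (auto simp: filterlim_at_split)
  then show "left_lim x t = x t" "right_lim x t = x t"
    by (auto intro!: tendsto_Lim)
qed

end

text \<open>A diagonal sequence makes \<open>V n\<close> and \<open>x n\<close> converge at rational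
  times. Where the limit of \<open>V n\<close> is continuous, its small increment over a rational
  neighborhood makes \<open>x n t\<close> a Cauchy sequence. The remaining times are countable and
  are treated by a second extraction.\<close>

lemma Helly_selection:
  fixes x :: "nat \<Rightarrow> real \<Rightarrow> 'a::euclidean_space" and V :: "nat \<Rightarrow> real \<Rightarrow> real"
  assumes inc: "\<And>n s t. \<lbrakk>0 \<le> s; s \<le> t; t \<le> T\<rbrakk> \<Longrightarrow> norm (x n t - x n s) \<le> V n t - V n s"
    and bound: "\<And>n t. t \<in> {0..T} \<Longrightarrow> norm (x n t) \<le> B" "\<And>n t. t \<in> {0..T} \<Longrightarrow> norm (V n t) \<le> B"
  obtains k :: "nat \<Rightarrow> nat" where "strict_mono k" "\<And>t. t \<in> {0..T} \<Longrightarrow> convergent (\<lambda>n. x (k n) t)"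
proof -
  have V_mono: "V n s \<le> V n t" if "0 \<le> s" "s \<le> t" "t \<le> T" for n s t
    using order_trans[OF norm_ge_zero inc[OF that, of n]] by simp
  define Q where "Q = {0..T} \<inter> (\<rat> \<union> {0})"
  have "countable Q" by (auto simp: Q_def countable_rat intro: countable_subset)
  have Q_bound: "norm ((\<lambda>n q. (V n q, x n q)) n q) \<le> B + B" if "q \<in> Q" for n q
    using bound(1)[of q n] bound(2)[of q n] norm_Pair_le[of "V n q" "x n q"] that by (auto simp: Q_def)
  from function_convergent_subsequence[of Q "\<lambda>n q. (V n q, x n q)" "B + B"] \<open>countable Q\<close> Q_bound
  obtain k :: "nat \<Rightarrow> nat" where k: "strict_mono k" "\<And>q. q \<in> Q \<Longrightarrow> \<exists>l. (\<lambda>n. (V (k n) q, x (k n) q)) \<longlonglongrightarrow> l"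
    by blast
  define W where "W q = lim (\<lambda>n. V (k n) q)" for q
  have W: "(\<lambda>n. V (k n) q) \<longlonglongrightarrow> W q" "convergent (\<lambda>n. x (k n) q)" if "q \<in> Q" for q
    using k(2)[OF that] tendsto_fst tendsto_snd unfolding W_def
    by (fastforce simp: convergent_LIMSEQ_iff[symmetric] convergent_def)+
  have W_mono: "W p \<le> W q" if "p \<in> Q" "q \<in> Q" "p \<le> q" for p q
    using W(1)[OF that(1)] W(1)[OF that(2)] V_mono[of p q] that
    by (intro LIMSEQ_le) (auto simp: Q_def)
  have W_bound: "W q \<le> B" if "q \<in> Q" for q
  proof (rule LIMSEQ_le_const2[OF W(1)[OF that]])
    have "V (k n) q \<le> B" for n using bound(2)[of q "k n"] that by (auto simp: Q_def)
    then show "\<exists>N. \<forall>n\<ge>N. V (k n) q \<le> B" by blast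
  qed
  \<comment> \<open>A monotone extension of \<open>W\<close> from \<open>Q\<close> to the interval,
    introduced so that the bad times are the countably many discontinuities of a monotone
    function.\<close>
  define U where "U t = Sup (W ` (Q \<inter> {..t}))" for t
  have Q0: "0 \<in> Q \<inter> {..t}" if "t \<in> {0..T}" for t using that by (auto simp: Q_def)
  have bdd: "bdd_above (W ` (Q \<inter> {..t}))" for t using W_bound by (intro bdd_aboveI2[of _ _ B]) auto
  have U_mono: "mono_on {0..T} U"
  proof (rule mono_onI)
    show "U s \<le> U t" if "s \<in> {0..T}" "t \<in> {0..T}" "s \<le> t" for s t
      unfolding U_def using Q0[OF that(1)] that(3) by (intro cSup_subset_mono bdd) auto
  qed
  have U_Q: "U q = W q" if "q \<in> Q" for q
    unfolding U_def using that W_mono by (intro cSup_eq_maximum) auto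
  define J where "J = {t \<in> {0..T}. \<not> continuous (at t within {0..T}) U}"
  have "countable J" unfolding J_def by (rule mono_on_ctble_discont[OF U_mono])
  have conv: "convergent (\<lambda>n. x (k n) t)" if t: "t \<in> {0<..<T}" "t \<notin> J" for t
  proof (rule Cauchy_convergent, rule metric_CauchyI)
    fix e :: real assume "0 < e"
    have "at t within {0..T} = at t" using t by (intro at_within_Icc_at) auto
    then have "isCont U t" using t by (auto simp: J_def)
    then obtain d where d: "0 < d" "\<And>s. \<bar>s - t\<bar> < d \<Longrightarrow> \<bar>U s - U t\<bar> < e / 8"
      using \<open>0 < e\<close> unfolding continuous_at_eps_delta by (metis dist_real_def zero_less_divide_iff zero_less_numeral)
    obtain p where p: "p \<in> \<rat>" "max 0 (t - d) < p" "p < t"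
      using Rats_dense_in_real[of "max 0 (t - d)" t] t d(1) by auto
    obtain q where q: "q \<in> \<rat>" "t < q" "q < min T (t + d)"
      using Rats_dense_in_real[of t "min T (t + d)"] t d(1) by auto
    have pq: "p \<in> Q" "q \<in> Q" using p q t by (auto simp: Q_def)
    have "W q - W p < e / 4"
    proof -
      have "\<bar>W p - U t\<bar> < e / 8" "\<bar>W q - U t\<bar> < e / 8"
        using d(2)[of p] d(2)[of q] p q by (simp_all add: U_Q[OF pq(1)] U_Q[OF pq(2)])
      then show ?thesis by linarith
    qed
    moreover have "(\<lambda>n. V (k n) q - V (k n) p) \<longlonglongrightarrow> W q - W p"
      using W(1) pq by (intro tendsto_diff) auto
    ultimately have ev: "\<forall>\<^sub>F n in sequentially. V (k n) q - V (k n) p < e / 4"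
      by (rule order_tendstoD(2)[rotated])
    obtain N1 where N1: "\<And>n. n \<ge> N1 \<Longrightarrow> V (k n) q - V (k n) p < e / 4"
      using ev by (auto simp: eventually_sequentially)
    obtain N2 where N2: "\<And>m n. m \<ge> N2 \<Longrightarrow> n \<ge> N2 \<Longrightarrow> dist (x (k m) p) (x (k n) p) < e / 4"
      using convergent_Cauchy[OF W(2)[OF pq(1)]] \<open>0 < e\<close> unfolding Cauchy_def
      by (metis zero_less_divide_iff zero_less_numeral)
    have near: "dist (x (k n) t) (x (k n) p) < e / 4" if "n \<ge> N1" for n
      using inc[of p t "k n"] V_mono[of t q "k n"] N1[OF that] p q t by (auto simp: dist_norm)
    have "dist (x (k m) t) (x (k n) t) < e" if "m \<ge> max N1 N2" "n \<ge> max N1 N2" for m n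
      using near[of m] near[of n] N2[of m n] that \<open>0 < e\<close>
        dist_triangle[of "x (k m) t" "x (k n) t" "x (k m) p"] dist_triangle[of "x (k m) p" "x (k n) t" "x (k n) p"]
      by (simp add: dist_commute)
    then show "\<exists>N. \<forall>m\<ge>N. \<forall>n\<ge>N. dist (x (k m) t) (x (k n) t) < e" by blast
  qed
  \<comment> \<open>The end points are added because they do not have rational times of the interval
    on both sides.\<close>
  have cJ: "countable ((J \<union> {0, T}) \<inter> {0..T})" using \<open>countable J\<close> by simp
  have J_bound: "norm (x (k n) t) \<le> B" if "t \<in> (J \<union> {0, T}) \<inter> {0..T}" for n t
    using that bound(1) by auto
  obtain k' :: "nat \<Rightarrow> nat" where k': "strict_mono k'"
    "\<And>t. t \<in> (J \<union> {0, T}) \<inter> {0..T} \<Longrightarrow> \<exists>l. (\<lambda>n. x (k (k' n)) t) \<longlonglongrightarrow> l"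
    using function_convergent_subsequence[of _ "\<lambda>n. x (k n)" B, OF cJ J_bound] by blast
  show thesis
  proof (rule that)
    show "strict_mono (k \<circ> k')" using k(1) k'(1) by (rule strict_mono_o)
    fix t assume t: "t \<in> {0..T}"
    show "convergent (\<lambda>n. x ((k \<circ> k') n) t)"
    proof (cases "t \<in> J \<union> {0, T}")
      case True
      then show ?thesis using k'(2)[of t] t by (auto simp: convergent_def)
    next
      case False
      then have "convergent (\<lambda>n. x (k n) t)" using conv[of t] t by auto
      from convergent_subseq_convergent[OF this k'(1)] show ?thesis by (simp add: o_def)
    qed
  qed
qed

section \<open>Curves satisfying the upper energy inequality\<close>

context rate_independent
begin

definition power_integral :: "(real \<Rightarrow> 'a) \<Rightarrow> real \<Rightarrow> real \<Rightarrow> real" where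
  "power_integral x s t = integral {s..t} (\<lambda>r. dt T E r (x r))"

definition G :: "(real \<Rightarrow> 'a) \<Rightarrow> real \<Rightarrow> real \<Rightarrow> real" where
  "G x s t = E s (x s) - E t (x t) + power_integral x s t"

text \<open>Every clause survives pointwise convergence; the energy bound supplies the dominating
  constant for the power. Measurability is imposed on the truncated curve because values outside
  \<open>{0..T}\<close> are arbitrary.\<close>

definition admissible :: "'a \<Rightarrow> real \<Rightarrow> (real \<Rightarrow> 'a) \<Rightarrow> bool" where
  "admissible a M x \<longleftrightarrow> x 0 = a \<and> (\<forall>t\<in>{0..T}. E t (x t) \<le> M) \<and>
     (\<lambda>r. indicator {0..T} r *\<^sub>R x r) \<in> borel_measurable borel \<and>
     (\<forall>s t. 0 \<le> s \<and> s \<le> t \<and> t \<le> T \<longrightarrow> \<Psi> (x t - x s) \<le> G x s t)"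

text \<open>\<open>dt\<close> is continuous only on the strip, so it is extended by 0 before being
  composed with the curve.\<close>

lemma power_measurable:
  assumes "(\<lambda>r. indicator {0..T} r *\<^sub>R x r) \<in> borel_measurable borel"
  shows "(\<lambda>r. indicator {0..T} r *\<^sub>R dt T E r (x r)) \<in> borel_measurable borel"
proof -
  have 1: "(\<lambda>z. indicator strip z *\<^sub>R (case z of (t, x) \<Rightarrow> dt T E t x)) \<in> borel_measurable (borel :: (real \<times> 'a) measure)"
    by (intro borel_measurable_continuous_on_indicator dt_continuous) (auto intro: borel_closed closed_Times)
  have "(\<lambda>r. (r, indicator {0..T} r *\<^sub>R x r)) \<in> borel \<rightarrow>\<^sub>M borel"
    using assms by (intro borel_measurable_Pair) auto
  from measurable_compose[OF this 1]
  have "(\<lambda>r. indicator strip (r, indicator {0..T} r *\<^sub>R x r) *\<^sub>R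
      (case (r, indicator {0..T} r *\<^sub>R x r) of (t, x) \<Rightarrow> dt T E t x)) \<in> borel_measurable borel"
    .
  also have "(\<lambda>r. indicator strip (r, indicator {0..T} r *\<^sub>R x r) *\<^sub>R
      (case (r, indicator {0..T} r *\<^sub>R x r) of (t, x) \<Rightarrow> dt T E t x)) = (\<lambda>r. indicator {0..T} r *\<^sub>R dt T E r (x r))"
  proof
    show "indicator strip (r, indicator {0..T} r *\<^sub>R x r) *\<^sub>R
      (case (r, indicator {0..T} r *\<^sub>R x r) of (t, x) \<Rightarrow> dt T E t x) = indicator {0..T} r *\<^sub>R dt T E r (x r)" for r
      by (cases "r \<in> {0..T}") simp_all
  qed
  finally show ?thesis .
qed

context
  fixes x :: "real \<Rightarrow> 'a" and M :: real
  assumes meas: "(\<lambda>r. indicator {0..T} r *\<^sub>R x r) \<in> borel_measurable borel"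
    and energy: "\<And>t. t \<in> {0..T} \<Longrightarrow> E t (x t) \<le> M"
begin

lemma M_nonneg: "0 \<le> M"
  using energy[of 0] E_nonneg[of 0 "x 0"] T_pos by simp

lemma power_abs: "t \<in> {0..T} \<Longrightarrow> \<bar>dt T E t (x t)\<bar> \<le> \<bar>lam\<bar> * M"
  by (rule dt_abs_bound[OF _ energy])

lemma power_set_integrable:
  assumes "S \<in> sets borel" "S \<subseteq> {0..T}"
  shows "set_integrable lebesgue S (\<lambda>r. dt T E r (x r))"
proof -
  have eq: "indicator S r *\<^sub>R dt T E r (x r) = indicator S r *\<^sub>R (indicator {0..T} r *\<^sub>R dt T E r (x r))" for r
    using assms(2) by (auto simp: indicator_def)
  have m: "(\<lambda>r. indicator S r *\<^sub>R dt T E r (x r)) \<in> borel_measurable borel"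
    unfolding eq using assms(1) by (intro borel_measurable_scaleR power_measurable[OF meas]) auto
  have "integrable lborel (\<lambda>r. indicator S r *\<^sub>R dt T E r (x r))"
  proof (rule Bochner_Integration.integrable_bound)
    show "integrable lborel (\<lambda>r. indicator {0..T} r * (\<bar>lam\<bar> * M))"
      by (intro integrable_mult_left integrable_real_indicator) (auto simp: emeasure_lborel_Icc_eq)
    show "AE r in lborel. norm (indicator S r *\<^sub>R dt T E r (x r)) \<le> norm (indicator {0..T} r * (\<bar>lam\<bar> * M))"
      using power_abs assms(2) M_nonneg by (intro AE_I2) (auto simp: indicator_def)
  qed (use m in simp)
  then show ?thesis
    unfolding set_integrable_def using m by (subst integrable_completion) auto
qed

lemma power_integrable: "0 \<le> s \<Longrightarrow> t \<le> T \<Longrightarrow> (\<lambda>r. dt T E r (x r)) integrable_on {s..t}"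
  by (rule set_lebesgue_integral_eq_integral(1)[OF power_set_integrable]) auto

lemma power_integral_lebesgue:
  "0 \<le> s \<Longrightarrow> t \<le> T \<Longrightarrow> (LINT r:{s..t}|lebesgue. dt T E r (x r)) = power_integral x s t"
  unfolding power_integral_def by (rule set_lebesgue_integral_eq_integral(2)[OF power_set_integrable]) auto

lemma power_integral_abs:
  assumes "0 \<le> s" "s \<le> t" "t \<le> T"
  shows "\<bar>power_integral x s t\<bar> \<le> \<bar>lam\<bar> * M * (t - s)"
proof -
  have "norm (power_integral x s t) \<le> \<bar>lam\<bar> * M * measure lborel {s..t}"
  proof (rule has_integral_bound_real[where S = "{}"])
    show "((\<lambda>r. dt T E r (x r)) has_integral power_integral x s t) {s..t}"
      unfolding power_integral_def using power_integrable assms by (simp add: has_integral_integral[symmetric])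
    show "norm (dt T E r (x r)) \<le> \<bar>lam\<bar> * M" if "r \<in> {s..t} - {}" for r
      using power_abs[of r] that assms by simp
  qed (simp_all add: M_nonneg)
  then show ?thesis using assms by simp
qed

lemma G_add:
  assumes "0 \<le> s" "s \<le> r" "r \<le> t" "t \<le> T"
  shows "G x s r + G x r t = G x s t"
  using Henstock_Kurzweil_Integration.integral_combine[OF assms(2,3) power_integrable] assms by (simp add: G_def power_integral_def)

lemma G_le:
  assumes "0 \<le> s" "s \<le> t" "t \<le> T"
  shows "G x s t \<le> M + \<bar>lam\<bar> * M * T"
proof -
  have "\<bar>lam\<bar> * M * (t - s) \<le> \<bar>lam\<bar> * M * T"
    using assms M_nonneg by (intro mult_left_mono) auto
  then show ?thesis
    using power_integral_abs[OF assms] energy[of s] E_nonneg[of t "x t"] assms by (simp add: G_def)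
qed

end

lemma G_refl [simp]: "G x s s = 0"
  by (simp add: G_def power_integral_def)

lemma admissibleD:
  assumes "admissible a M x"
  shows "x 0 = a" "(\<lambda>r. indicator {0..T} r *\<^sub>R x r) \<in> borel_measurable borel"
    "\<And>t. t \<in> {0..T} \<Longrightarrow> E t (x t) \<le> M" "\<And>s t. \<lbrakk>0 \<le> s; s \<le> t; t \<le> T\<rbrakk> \<Longrightarrow> \<Psi> (x t - x s) \<le> G x s t"
  using assms unfolding admissible_def by blast+

lemma power_integral_tendsto:
  assumes x: "\<And>n. (\<lambda>r. indicator {0..T} r *\<^sub>R x n r) \<in> borel_measurable borel"
    "\<And>n t. t \<in> {0..T} \<Longrightarrow> E t (x n t) \<le> M"
    and lim: "\<And>t. t \<in> {0..T} \<Longrightarrow> (\<lambda>n. x n t) \<longlonglongrightarrow> u t"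
    and st: "0 \<le> s" "s \<le> t" "t \<le> T"
  shows "(\<lambda>n. power_integral (x n) s t) \<longlonglongrightarrow> power_integral u s t"
  unfolding power_integral_def
proof (rule dominated_convergence(2)[where h = "\<lambda>_. \<bar>lam\<bar> * M"])
  show "(\<lambda>r. dt T E r (x n r)) integrable_on {s..t}" for n
    using st by (intro power_integrable[OF x]) auto
  show "norm (dt T E r (x n r)) \<le> \<bar>lam\<bar> * M" if "r \<in> {s..t}" for n r
    using power_abs[OF x(1)[of n] x(2), of r] that st by auto
  show "(\<lambda>n. dt T E r (x n r)) \<longlonglongrightarrow> dt T E r (u r)" if "r \<in> {s..t}" for r
    using that st by (intro dt_tendsto lim tendsto_const) auto
qed auto

lemma admissible_limit:
  assumes x: "\<And>n. admissible a M (x n)" and lim: "\<And>t. t \<in> {0..T} \<Longrightarrow> (\<lambda>n. x n t) \<longlonglongrightarrow> u t"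
  shows "admissible a M u"
    and "\<lbrakk>0 \<le> s; s \<le> t; t \<le> T\<rbrakk> \<Longrightarrow> (\<lambda>n. G (x n) s t) \<longlonglongrightarrow> G u s t"
proof -
  have E_lim: "(\<lambda>n. E t (x n t)) \<longlonglongrightarrow> E t (u t)" if "t \<in> {0..T}" for t
    using that by (intro E_tendsto lim tendsto_const) auto
  show G_lim: "(\<lambda>n. G (x n) s t) \<longlonglongrightarrow> G u s t" if "0 \<le> s" "s \<le> t" "t \<le> T" for s t
    unfolding G_def using that
    by (intro tendsto_intros E_lim power_integral_tendsto[OF admissibleD(2,3)[OF x] lim]) auto
  show "admissible a M u"
    unfolding admissible_def
  proof (intro conjI ballI allI impI)
    show "u 0 = a"
      using LIMSEQ_unique[of "\<lambda>n. x n 0" "u 0" a] lim[of 0] T_pos by (simp add: admissibleD(1)[OF x])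
    show "E t (u t) \<le> M" if "t \<in> {0..T}" for t
      using LIMSEQ_le_const2[OF E_lim[OF that]] admissibleD(3)[OF x that] by blast
    show "(\<lambda>r. indicator {0..T} r *\<^sub>R u r) \<in> borel_measurable borel"
    proof (rule borel_measurable_LIMSEQ_metric)
      show "(\<lambda>r. indicator {0..T} r *\<^sub>R x n r) \<in> borel_measurable borel" for n
        by (rule admissibleD(2)[OF x])
      show "(\<lambda>n. indicator {0..T} r *\<^sub>R x n r) \<longlonglongrightarrow> indicator {0..T} r *\<^sub>R u r" for r
        by (cases "r \<in> {0..T}") (auto intro: lim)
    qed
    fix s t assume st: "0 \<le> s \<and> s \<le> t \<and> t \<le> T"
    have "(\<lambda>n. \<Psi> (x n t - x n s)) \<longlonglongrightarrow> \<Psi> (u t - u s)"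
      using st by (intro \<Psi>_tendsto tendsto_diff lim) auto
    then show "\<Psi> (u t - u s) \<le> G u s t"
      by (rule LIMSEQ_le[OF _ G_lim]) (use st admissibleD(4)[OF x] in auto)
  qed
qed

text \<open>Released energy divided by the coercivity constant of \<Psi> is the scalar
  \<open>V\<close> of \<open>dominated_increments\<close> and of Helly's theorem.\<close>

lemma admissible_dominated:
  assumes "admissible a M x" "0 < c" "\<And>v. c * norm v \<le> \<Psi> v" "0 \<le> s" "s \<le> t" "t \<le> T"
  shows "norm (x t - x s) \<le> G x 0 t / c - G x 0 s / c"
proof -
  note x = admissibleD[OF assms(1)]
  have "c * norm (x t - x s) \<le> G x s t"
    using assms(3)[of "x t - x s"] x(4)[OF assms(4-6)] by simp
  also have "\<dots> = G x 0 t - G x 0 s"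
    using G_add[OF x(2,3), of 0 s t] assms by simp
  finally show ?thesis using assms(2) by (simp add: field_simps)
qed

lemma admissible_bounded:
  obtains B where "\<And>x t. \<lbrakk>admissible a M x; t \<in> {0..T}\<rbrakk> \<Longrightarrow> norm (x t) \<le> B"
proof -
  obtain c where c: "0 < c" "\<And>v. c * norm v \<le> \<Psi> v" using \<Psi>_bounds by metis
  have "norm (x t) \<le> norm a + (M + \<bar>lam\<bar> * M * T) / c" if x: "admissible a M x" "t \<in> {0..T}" for x t
  proof -
    have "norm (x t - x 0) \<le> G x 0 t / c"
      using admissible_dominated[OF x(1) c, of 0 t] x(2) by simp
    also have "\<dots> \<le> (M + \<bar>lam\<bar> * M * T) / c"
      using G_le[OF admissibleD(2,3)[OF x(1)], of 0 t] x(2) c(1) by (intro divide_right_mono) auto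
    finally show ?thesis
      using norm_triangle_ineq[of "x 0" "x t - x 0"] admissibleD(1)[OF x(1)] by simp
  qed
  then show thesis using that by blast
qed

lemma admissible_selection:
  fixes x :: "nat \<Rightarrow> real \<Rightarrow> 'a"
  assumes x: "\<And>n. admissible a M (x n)"
  obtains k u where "strict_mono k" "\<And>t. t \<in> {0..T} \<Longrightarrow> (\<lambda>n. x (k n) t) \<longlonglongrightarrow> u t"
proof -
  obtain c where c: "0 < c" "\<And>v. c * norm v \<le> \<Psi> v" using \<Psi>_bounds by metis
  obtain B where B: "\<And>x t. \<lbrakk>admissible a M x; t \<in> {0..T}\<rbrakk> \<Longrightarrow> norm (x t) \<le> B"
    using admissible_bounded[of a M] by blast
  define B' where "B' = max B ((M + \<bar>lam\<bar> * M * T) / c)"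
  have "\<exists>k. strict_mono k \<and> (\<forall>t\<in>{0..T}. convergent (\<lambda>n. x (k n) t))"
  proof (rule Helly_selection[where x = x and V = "\<lambda>n t. G (x n) 0 t / c"])
    show "norm (x n t - x n s) \<le> G (x n) 0 t / c - G (x n) 0 s / c" if "0 \<le> s" "s \<le> t" "t \<le> T" for n s t
      using admissible_dominated[OF x c that] .
    show "norm (x n t) \<le> B'" if "t \<in> {0..T}" for n t
      using B[OF x[of n] that] by (simp add: B'_def)
    show "norm (G (x n) 0 t / c) \<le> B'" if "t \<in> {0..T}" for n t
    proof -
      note xn = admissibleD[OF x[of n]]
      have "0 \<le> G (x n) 0 t" using xn(4)[of 0 t] \<Psi>_nonneg[of "x n t - x n 0"] that by simp
      moreover have "G (x n) 0 t / c \<le> (M + \<bar>lam\<bar> * M * T) / c"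
        using G_le[OF xn(2,3), of 0 t] that c(1) by (intro divide_right_mono) auto
      ultimately show ?thesis using c(1) by (simp add: B'_def)
    qed
  qed blast
  then obtain k where k: "strict_mono k" "\<And>t. t \<in> {0..T} \<Longrightarrow> convergent (\<lambda>n. x (k n) t)" by blast
  show thesis
    using that[of k "\<lambda>t. lim (\<lambda>n. x (k n) t)"] k by (simp add: convergent_LIMSEQ_iff)
qed

lemma \<Psi>_finite_diss: "a \<le> b \<Longrightarrow> Diss \<Psi> u a b < \<infinity> \<Longrightarrow> finite_diss \<Psi> u a b"
  by unfold_locales (simp_all add: \<Psi>_nonneg \<Psi>_triangle)

lemma admissible_Diss:
  assumes "admissible a M x" "0 \<le> s" "s \<le> t" "t \<le> T"
  shows "Diss \<Psi> x s t \<le> ereal (G x s t)"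
proof -
  note x = admissibleD[OF assms(1)]
  have "Diss \<Psi> x s t \<le> ereal (G x 0 t - G x 0 s)"
  proof (rule Diss_le)
    show "\<Psi> (x q - x p) \<le> G x 0 q - G x 0 p" if "s \<le> p" "p < q" "q \<le> t" for p q
      using x(4)[of p q] G_add[OF x(2,3), of 0 p q] that assms by simp
  qed
  moreover have "G x 0 t - G x 0 s = G x s t" using G_add[OF x(2,3), of 0 s t] assms by simp
  ultimately show ?thesis by simp
qed

lemma admissible_BV:
  assumes "admissible a M x"
  shows "BV_on 0 T x"
proof -
  obtain c where c: "0 < c" "\<And>v. c * norm v \<le> \<Psi> v" using \<Psi>_bounds by metis
  have "Diss norm x 0 T \<le> ereal (G x 0 T / c - G x 0 0 / c)"
    by (rule Diss_le) (use admissible_dominated[OF assms c] in auto)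
  then show ?thesis unfolding BV_on_def by (rule le_less_trans) simp
qed

end

section \<open>The discretized scheme\<close>

context rate_independent
begin

text \<open>Steps are numbered from 0: step \<open>i\<close> leaves \<open>y i\<close> and uses the
  energy at the new time \<open>real (Suc i) * \<tau>\<close>.\<close>

definition scheme :: "real \<Rightarrow> real \<Rightarrow> nat \<Rightarrow> (nat \<Rightarrow> 'a) \<Rightarrow> bool" where
  "scheme \<epsilon> \<tau> N y \<longleftrightarrow> (\<forall>i<N. nrm (y (Suc i) - y i) \<le> \<epsilon> \<and>
     (\<forall>z. nrm (z - y i) \<le> \<epsilon> \<longrightarrow>
        E (real (Suc i) * \<tau>) (y (Suc i)) + \<Psi> (y (Suc i) - y i) \<le> E (real (Suc i) * \<tau>) z + \<Psi> (z - y i)))"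

definition grid_index :: "real \<Rightarrow> real \<Rightarrow> nat" where
  "grid_index \<tau> t = nat \<lfloor>t / \<tau>\<rfloor>"

lemma grid_index_bounds:
  assumes "0 < \<tau>" "0 \<le> t"
  shows "real (grid_index \<tau> t) * \<tau> \<le> t" "t < real (Suc (grid_index \<tau> t)) * \<tau>"
proof -
  have "real (grid_index \<tau> t) = of_int \<lfloor>t / \<tau>\<rfloor>"
    using assms by (simp add: grid_index_def)
  then have "real (grid_index \<tau> t) \<le> t / \<tau>" "t / \<tau> < real (Suc (grid_index \<tau> t))"
    by linarith+
  then show "real (grid_index \<tau> t) * \<tau> \<le> t" "t < real (Suc (grid_index \<tau> t)) * \<tau>"
    using assms(1) by (simp_all add: field_simps)
qed

lemma grid_index_eq:
  assumes "0 < \<tau>" "real k * \<tau> \<le> t" "t < real (Suc k) * \<tau>"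
  shows "grid_index \<tau> t = k"
proof -
  have "\<lfloor>t / \<tau>\<rfloor> = int k"
    using assms by (intro floor_unique) (simp_all add: field_simps)
  then show ?thesis by (simp add: grid_index_def)
qed

lemma grid_index_mono: "0 < \<tau> \<Longrightarrow> s \<le> t \<Longrightarrow> grid_index \<tau> s \<le> grid_index \<tau> t"
  unfolding grid_index_def by (intro nat_mono floor_mono divide_right_mono) auto

text \<open>Replaces the piecewise description by evaluation at the floor of
  \<open>t / \<tau>\<close>, which also handles the last, possibly incomplete, interval.\<close>

lemma discretized_solution_iff:
  assumes "0 < \<tau>"
  shows "discretized_solution nrm T E \<Psi> x0 \<epsilon> \<tau> x \<longleftrightarrow>
    (\<exists>y. y 0 = x0 \<and> scheme \<epsilon> \<tau> (grid_index \<tau> T) y \<and> (\<forall>t\<in>{0..T}. x t = y (grid_index \<tau> t)))"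
    (is "_ \<longleftrightarrow> ?R")
proof
  have shift: "(\<forall>i\<in>{1..N}. P i) \<longleftrightarrow> (\<forall>i<N. P (Suc i))" for N and P :: "nat \<Rightarrow> bool"
    by (metis One_nat_def Suc_le_eq Suc_le_mono atLeastAtMost_iff le_add1 not0_implies_Suc not_less_eq_eq plus_1_eq_Suc le_zero_eq)
  assume "discretized_solution nrm T E \<Psi> x0 \<epsilon> \<tau> x"
  then obtain N and y :: "nat \<Rightarrow> 'a" where N: "\<tau> * real N \<le> T" "T < \<tau> * (real N + 1)" and y0: "y 0 = x0"
    and min: "\<forall>i<N. is_arg_min (\<lambda>z. E (real (Suc i) * \<tau>) z + \<Psi> (z - y (Suc i - 1)))
                               (\<lambda>z. nrm (z - y (Suc i - 1)) \<le> \<epsilon>) (y (Suc i))"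
    and x1: "\<forall>i<N. \<forall>t\<in>{real (Suc i - 1) * \<tau>..<real (Suc i) * \<tau>}. x t = y (Suc i - 1)"
    and x2: "\<forall>t\<in>{real N * \<tau>..T}. x t = y N"
    unfolding discretized_solution_def shift by blast
  have NT: "N = grid_index \<tau> T"
    using N assms by (intro grid_index_eq[symmetric]) (auto simp: algebra_simps)
  have "scheme \<epsilon> \<tau> N y"
    using min unfolding scheme_def is_arg_min_def by (auto simp: not_less)
  moreover have "x t = y (grid_index \<tau> t)" if t: "t \<in> {0..T}" for t
  proof (cases "grid_index \<tau> t < N")
    case True
    then show ?thesis using x1 grid_index_bounds[OF assms, of t] t by auto
  next
    case False
    moreover have "grid_index \<tau> t \<le> N" using grid_index_mono[OF assms, of t T] t NT by simp
    ultimately have "grid_index \<tau> t = N" by simp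
    then show ?thesis using x2 grid_index_bounds[OF assms, of t] t by auto
  qed
  ultimately show ?R using y0 NT by blast
next
  assume ?R
  then obtain y where y: "y 0 = x0" "scheme \<epsilon> \<tau> (grid_index \<tau> T) y" "\<And>t. t \<in> {0..T} \<Longrightarrow> x t = y (grid_index \<tau> t)"
    by blast
  let ?N = "grid_index \<tau> T"
  note N = grid_index_bounds[OF assms, of T]
  show "discretized_solution nrm T E \<Psi> x0 \<epsilon> \<tau> x"
    unfolding discretized_solution_def
  proof (intro exI[of _ ?N] exI[of _ y] conjI ballI)
    show "\<tau> * real ?N \<le> T" "T < \<tau> * (real ?N + 1)"
      using N T_pos by (auto simp: algebra_simps)
    show "y 0 = x0" by fact
  next
    fix i assume i: "i \<in> {1..?N}"
    then obtain j where j: "i = Suc j" "j < ?N" by (cases i) auto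
    show "is_arg_min (\<lambda>z. E (real i * \<tau>) z + \<Psi> (z - y (i - 1))) (\<lambda>z. nrm (z - y (i - 1)) \<le> \<epsilon>) (y i)"
      using y(2) j unfolding scheme_def is_arg_min_def by (auto simp: not_less)
    fix t assume t: "t \<in> {real (i - 1) * \<tau>..<real i * \<tau>}"
    have "real i * \<tau> \<le> real ?N * \<tau>" using i assms by (intro mult_right_mono) auto
    moreover have "0 \<le> real (i - 1) * \<tau>" using assms by simp
    ultimately have "t \<in> {0..T}" using t N T_pos by auto
    moreover have "grid_index \<tau> t = j" using t j by (intro grid_index_eq[OF assms]) auto
    ultimately show "x t = y (i - 1)" using y(3) j by simp
  next
    fix t assume t: "t \<in> {real ?N * \<tau>..T}"
    moreover have "0 \<le> real ?N * \<tau>" using assms by simp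
    moreover have "grid_index \<tau> t = ?N" using t N T_pos by (intro grid_index_eq[OF assms]) auto
    ultimately show "x t = y ?N" using y(3) by auto
  qed
qed

lemma minimizer_exists:
  assumes "t \<in> {0..T}" "0 < \<epsilon>"
  obtains z where "nrm (z - p) \<le> \<epsilon>" "\<And>w. nrm (w - p) \<le> \<epsilon> \<Longrightarrow> E t z + \<Psi> (z - p) \<le> E t w + \<Psi> (w - p)"
proof -
  obtain c where c: "0 < c" "\<And>v. c * norm v \<le> nrm v" using nrm_bounds by metis
  let ?B = "{z. nrm (z - p) \<le> \<epsilon>}"
  have cont: "continuous_on UNIV (\<lambda>z. f (z - p))" if "continuous_on UNIV f" for f :: "'a \<Rightarrow> real"
    using that by (rule continuous_on_compose2) (auto intro!: continuous_intros)
  have "closed ?B" by (rule closed_Collect_le[OF cont[OF nrm_continuous] continuous_on_const])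
  moreover have "?B \<subseteq> cball p (\<epsilon> / c)"
  proof
    fix z assume "z \<in> ?B"
    then have "c * norm (z - p) \<le> \<epsilon>" using c(2)[of "z - p"] by simp
    then show "z \<in> cball p (\<epsilon> / c)" using c(1) by (simp add: dist_norm norm_minus_commute field_simps)
  qed
  ultimately have "compact ?B"
    using compact_Int_closed[OF compact_cball[of p "\<epsilon> / c"], of ?B] by (simp add: Int_absorb1)
  moreover have "p \<in> ?B" using assms by simp
  moreover have "continuous_on ?B (\<lambda>z. E t z + \<Psi> (z - p))"
    by (intro continuous_on_add continuous_on_subset[OF E_x_continuous[OF assms(1)]]
        continuous_on_subset[OF cont[OF \<Psi>_continuous]]) auto
  ultimately obtain z where "z \<in> ?B" "\<forall>w\<in>?B. E t z + \<Psi> (z - p) \<le> E t w + \<Psi> (w - p)"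
    using continuous_attains_inf[of ?B] by blast
  then show thesis using that by blast
qed

lemma discretized_solution_exists:
  assumes "0 < \<epsilon>" "0 < \<tau>"
  shows "\<exists>x. discretized_solution nrm T E \<Psi> x0 \<epsilon> \<tau> x"
proof -
  define step where "step i p = (SOME z. nrm (z - p) \<le> \<epsilon> \<and>
      (\<forall>w. nrm (w - p) \<le> \<epsilon> \<longrightarrow> E (real (Suc i) * \<tau>) z + \<Psi> (z - p) \<le> E (real (Suc i) * \<tau>) w + \<Psi> (w - p)))" for i p
  define y where "y = rec_nat x0 step"
  have y: "y 0 = x0" "\<And>i. y (Suc i) = step i (y i)" by (simp_all add: y_def)
  have "scheme \<epsilon> \<tau> (grid_index \<tau> T) y"
    unfolding scheme_def y
  proof (intro allI impI)
    fix i assume i: "i < grid_index \<tau> T"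
    have "real (Suc i) * \<tau> \<le> real (grid_index \<tau> T) * \<tau>"
      using i assms by (intro mult_right_mono) auto
    then have "real (Suc i) * \<tau> \<le> T"
      by (rule order_trans) (use grid_index_bounds(1)[OF assms(2), of T] T_pos in simp)
    then have "real (Suc i) * \<tau> \<in> {0..T}" using assms by simp
    from minimizer_exists[OF this assms(1), of "y i"]
    have "\<exists>z. nrm (z - y i) \<le> \<epsilon> \<and>
      (\<forall>w. nrm (w - y i) \<le> \<epsilon> \<longrightarrow> E (real (Suc i) * \<tau>) z + \<Psi> (z - y i) \<le> E (real (Suc i) * \<tau>) w + \<Psi> (w - y i))"
      by metis
    from someI_ex[OF this] show "nrm (step i (y i) - y i) \<le> \<epsilon> \<and> (\<forall>z. nrm (z - y i) \<le> \<epsilon> \<longrightarrow>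
        E (real (Suc i) * \<tau>) (step i (y i)) + \<Psi> (step i (y i) - y i) \<le> E (real (Suc i) * \<tau>) z + \<Psi> (z - y i))"
      unfolding step_def .
  qed
  then have "discretized_solution nrm T E \<Psi> x0 \<epsilon> \<tau> (\<lambda>t. y (grid_index \<tau> t))"
    unfolding discretized_solution_iff[OF assms(2)] using y(1) by blast
  then show ?thesis by blast
qed

lemma \<Psi>_telescope: "a \<le> b \<Longrightarrow> \<Psi> (y b - y a) \<le> (\<Sum>i\<in>{a..<b}. \<Psi> (y (Suc i) - y i))"
proof (induction rule: dec_induct)
  case (step n)
  then show ?case using \<Psi>_triangle[of "y (Suc n) - y n" "y n - y a"] by simp
qed simp

text \<open>The Gronwall bound along the scheme; it does not involve \<epsilon> or \<tau>.\<close>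

definition energy_bound :: "'a \<Rightarrow> real" where
  "energy_bound a = exp (\<bar>lam\<bar> * T) * E 0 a"

context
  fixes \<epsilon> \<tau> :: real and y :: "nat \<Rightarrow> 'a" and x :: "real \<Rightarrow> 'a" and N :: nat
  assumes pos: "0 < \<epsilon>" "0 < \<tau>" and N_def: "N = grid_index \<tau> T" and y: "scheme \<epsilon> \<tau> N y"
    and x: "\<And>t. t \<in> {0..T} \<Longrightarrow> x t = y (grid_index \<tau> t)"
begin

lemma grid_le: "i \<le> N \<Longrightarrow> real i * \<tau> \<in> {0..T}"
proof -
  assume "i \<le> N"
  then have "real i * \<tau> \<le> real N * \<tau>" using pos by (intro mult_right_mono) auto
  then have "real i * \<tau> \<le> T"
    by (rule order_trans) (use grid_index_bounds(1)[OF pos(2), of T] T_pos N_def in simp)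
  then show ?thesis using pos by simp
qed

lemma index_le_N: "t \<in> {0..T} \<Longrightarrow> grid_index \<tau> t \<le> N"
  using grid_index_mono[OF pos(2), of t T] N_def by simp

lemma index_grid: "grid_index \<tau> (real i * \<tau>) = i"
  using pos by (intro grid_index_eq) auto

lemma x_grid: "i \<le> N \<Longrightarrow> x (real i * \<tau>) = y i"
  using x[OF grid_le] index_grid by simp

text \<open>The old point \<open>y i\<close> is an admissible competitor.\<close>

lemma step_energy: "i < N \<Longrightarrow> \<Psi> (y (Suc i) - y i) \<le> E (real (Suc i) * \<tau>) (y i) - E (real (Suc i) * \<tau>) (y (Suc i))"
  using y[unfolded scheme_def, rule_format, of i] pos by (auto dest!: spec[of _ "y i"])

lemma grid_energy: "i \<le> N \<Longrightarrow> E (real i * \<tau>) (y i) \<le> exp (\<bar>lam\<bar> * (real i * \<tau>)) * E 0 (y 0)"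
proof (induction i)
  case (Suc i)
  have "E (real (Suc i) * \<tau>) (y (Suc i)) \<le> E (real (Suc i) * \<tau>) (y i)"
    using step_energy[of i] \<Psi>_nonneg[of "y (Suc i) - y i"] Suc by simp
  also have "\<dots> \<le> exp (\<bar>lam\<bar> * (real (Suc i) * \<tau> - real i * \<tau>)) * E (real i * \<tau>) (y i)"
    using grid_le[of "Suc i"] grid_le[of i] Suc.prems pos by (intro E_growth) auto
  also have "\<dots> \<le> exp (\<bar>lam\<bar> * (real (Suc i) * \<tau> - real i * \<tau>)) * (exp (\<bar>lam\<bar> * (real i * \<tau>)) * E 0 (y 0))"
    using Suc by (intro mult_left_mono) auto
  also have "\<dots> = exp (\<bar>lam\<bar> * (real (Suc i) * \<tau> - real i * \<tau>) + \<bar>lam\<bar> * (real i * \<tau>)) * E 0 (y 0)"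
    by (simp only: exp_add mult.assoc)
  also have "\<bar>lam\<bar> * (real (Suc i) * \<tau> - real i * \<tau>) + \<bar>lam\<bar> * (real i * \<tau>) = \<bar>lam\<bar> * (real (Suc i) * \<tau>)"
    by (simp add: right_diff_distrib)
  finally show ?case .
qed simp

lemma x_energy:
  assumes "t \<in> {0..T}"
  shows "E t (x t) \<le> energy_bound (y 0)"
proof -
  define k where "k = grid_index \<tau> t"
  have k: "k \<le> N" "real k * \<tau> \<le> t"
    using index_le_N[OF assms] grid_index_bounds(1)[OF pos(2), of t] assms by (auto simp: k_def)
  have "E t (y k) \<le> exp (\<bar>lam\<bar> * (t - real k * \<tau>)) * E (real k * \<tau>) (y k)"
    using k grid_le[of k] assms by (intro E_growth) auto
  also have "\<dots> \<le> exp (\<bar>lam\<bar> * (t - real k * \<tau>)) * (exp (\<bar>lam\<bar> * (real k * \<tau>)) * E 0 (y 0))"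
    using grid_energy[OF k(1)] by (intro mult_left_mono) auto
  also have "\<dots> = exp (\<bar>lam\<bar> * (t - real k * \<tau>) + \<bar>lam\<bar> * (real k * \<tau>)) * E 0 (y 0)"
    by (simp only: exp_add mult.assoc)
  also have "\<bar>lam\<bar> * (t - real k * \<tau>) + \<bar>lam\<bar> * (real k * \<tau>) = \<bar>lam\<bar> * t"
    by (simp add: right_diff_distrib)
  also have "exp (\<bar>lam\<bar> * t) * E 0 (y 0) \<le> energy_bound (y 0)"
  proof -
    have "\<bar>lam\<bar> * t \<le> \<bar>lam\<bar> * T" using assms by (intro mult_left_mono) auto
    then show ?thesis
      unfolding energy_bound_def using E_nonneg[of 0 "y 0"] T_pos by (intro mult_right_mono) simp_all
  qed
  finally show ?thesis using x[OF assms] by (simp add: k_def)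
qed

lemma x_measurable: "(\<lambda>r. indicator {0..T} r *\<^sub>R x r) \<in> borel_measurable borel"
proof -
  have "(\<lambda>r. y (grid_index \<tau> r)) \<in> borel_measurable borel"
    unfolding grid_index_def by measurable
  then have "(\<lambda>r. indicator {0..T} r *\<^sub>R y (grid_index \<tau> r)) \<in> borel_measurable borel"
    by (intro borel_measurable_scaleR) auto
  moreover have "indicator {0..T} r *\<^sub>R y (grid_index \<tau> r) = indicator {0..T} r *\<^sub>R x r" for r
    using x[of r] by (cases "r \<in> {0..T}") auto
  ultimately show ?thesis by simp
qed

lemma power_piece:
  assumes "k \<le> N" "real k * \<tau> \<le> s" "s \<le> t" "t \<le> real (Suc k) * \<tau>" "t \<le> T"
  shows "power_integral x s t = E t (y k) - E s (y k)"
proof -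
  have s: "0 \<le> s" using assms(2) grid_le[OF assms(1)] by simp
  have "power_integral x s t = integral {s..t} (\<lambda>r. dt T E r (y k))"
    unfolding power_integral_def
  \<comment> \<open>The right end point may be a grid point at which the curve has already
    jumped.\<close>
  proof (rule integral_spike[of "{t}"])
    show "dt T E r (y k) = dt T E r (x r)" if "r \<in> {s..t} - {t}" for r
      using that x[of r] grid_index_eq[OF pos(2), of k r] assms s by auto
  qed simp
  then show ?thesis using integral_unique[OF E_dt_integral[OF s assms(3,5)]] by simp
qed

lemma G_grid: "k \<le> N \<Longrightarrow> G x 0 (real k * \<tau>) =
    (\<Sum>i<k. E (real (Suc i) * \<tau>) (y i) - E (real (Suc i) * \<tau>) (y (Suc i)))"
proof (induction k)
  case (Suc k)
  have "G x (real k * \<tau>) (real (Suc k) * \<tau>) = E (real (Suc k) * \<tau>) (y k) - E (real (Suc k) * \<tau>) (y (Suc k))"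
    unfolding G_def using power_piece[of k "real k * \<tau>" "real (Suc k) * \<tau>"] Suc.prems grid_le[of "Suc k"] pos
      x_grid[of k] x_grid[of "Suc k"] by simp
  moreover have "G x 0 (real k * \<tau>) + G x (real k * \<tau>) (real (Suc k) * \<tau>) = G x 0 (real (Suc k) * \<tau>)"
    using Suc.prems grid_le[of "Suc k"] grid_le[of k] pos
    by (intro G_add[OF x_measurable x_energy]) auto
  ultimately show ?case using Suc by simp
qed simp

text \<open>Between grid points the state is frozen and the power integral equals the change of
  energy, so energy is released only by the steps. The identity has no error term, also for times
  off the grid.\<close>

lemma G_discrete:
  assumes "0 \<le> s" "s \<le> t" "t \<le> T"
  shows "G x s t = (\<Sum>i\<in>{grid_index \<tau> s..<grid_index \<tau> t}.
    E (real (Suc i) * \<tau>) (y i) - E (real (Suc i) * \<tau>) (y (Suc i)))"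
proof -
  let ?e = "\<lambda>i. E (real (Suc i) * \<tau>) (y i) - E (real (Suc i) * \<tau>) (y (Suc i))"
  have *: "G x 0 t = (\<Sum>i<grid_index \<tau> t. ?e i)" if t: "0 \<le> t" "t \<le> T" for t
  proof -
    let ?k = "grid_index \<tau> t"
    have k: "?k \<le> N" "real ?k * \<tau> \<le> t" "t < real (Suc ?k) * \<tau>"
      using index_le_N[of t] grid_index_bounds[OF pos(2) t(1)] t by auto
    have "G x (real ?k * \<tau>) t = 0"
      unfolding G_def using power_piece[OF k(1) order_refl k(2) less_imp_le[OF k(3)] t(2)] x_grid[OF k(1)] x[of t] t by simp
    moreover have "G x 0 (real ?k * \<tau>) + G x (real ?k * \<tau>) t = G x 0 t"
      using k grid_le[of ?k] t by (intro G_add[OF x_measurable x_energy]) auto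
    ultimately show ?thesis using G_grid[OF k(1)] by simp
  qed
  have "G x s t = G x 0 t - G x 0 s"
    using G_add[OF x_measurable x_energy, of 0 s t] assms by simp
  also have "\<dots> = (\<Sum>i\<in>{0..<grid_index \<tau> t}. ?e i) - (\<Sum>i\<in>{0..<grid_index \<tau> s}. ?e i)"
    using *[of t] *[of s] assms by (simp add: lessThan_atLeast0)
  also have "\<dots> = (\<Sum>i\<in>{grid_index \<tau> s..<grid_index \<tau> t}. ?e i)"
    using grid_index_mono[OF pos(2) assms(2)] by (intro sum_diff_nat_ivl) auto
  finally show ?thesis .
qed

lemma x_admissible: "admissible (y 0) (energy_bound (y 0)) x"
  unfolding admissible_def
proof (intro conjI ballI allI impI)
  show "x 0 = y 0" using x_grid[of 0] by simp
  fix s t assume st: "0 \<le> s \<and> s \<le> t \<and> t \<le> T"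
  have "\<Psi> (x t - x s) \<le> (\<Sum>i\<in>{grid_index \<tau> s..<grid_index \<tau> t}. \<Psi> (y (Suc i) - y i))"
    using \<Psi>_telescope[OF grid_index_mono[OF pos(2)], of s t y] st x by simp
  also have "\<dots> \<le> G x s t"
    using st step_energy index_le_N[of t] by (subst G_discrete) (auto intro!: sum_mono)
  finally show "\<Psi> (x t - x s) \<le> G x s t" .
qed (use x_energy x_measurable in auto)

end

lemma discretized_admissible:
  assumes "0 < \<epsilon>" "0 < \<tau>" "discretized_solution nrm T E \<Psi> x0 \<epsilon> \<tau> x"
  shows "admissible x0 (energy_bound x0) x"
  using assms x_admissible unfolding discretized_solution_iff[OF assms(2)] by blast

lemma eps_solution_exists:
  assumes "0 < \<epsilon>" "\<And>\<tau>. 0 < \<tau> \<Longrightarrow> discretized_solution nrm T E \<Psi> x0 \<epsilon> \<tau> (Y \<tau>)"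
  shows "\<exists>x. eps_neighborhood_solution T Y x"
proof -
  let ?\<tau> = "\<lambda>n::nat. inverse (real (Suc n))"
  have "admissible x0 (energy_bound x0) (Y (?\<tau> n))" for n
    by (rule discretized_admissible[OF assms(1) _ assms(2)]) simp_all
  then obtain k u where k: "strict_mono k" "\<And>t. t \<in> {0..T} \<Longrightarrow> (\<lambda>n. Y (?\<tau> (k n)) t) \<longlonglongrightarrow> u t"
    using admissible_selection[of x0 "energy_bound x0" "\<lambda>n. Y (?\<tau> n)"] by auto
  have "(\<lambda>n. ?\<tau> (k n)) \<longlonglongrightarrow> 0"
    using LIMSEQ_subseq_LIMSEQ[OF LIMSEQ_inverse_real_of_nat k(1)] by (simp add: o_def)
  then show ?thesis
    unfolding eps_neighborhood_solution_def using k(2)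
    by (intro exI[of _ u] exI[of _ "\<lambda>n. ?\<tau> (k n)"]) auto
qed

lemma eps_solution_admissible:
  assumes "0 < \<epsilon>" "\<And>\<tau>. 0 < \<tau> \<Longrightarrow> discretized_solution nrm T E \<Psi> x0 \<epsilon> \<tau> (Y \<tau>)"
    and "eps_neighborhood_solution T Y x"
  shows "admissible x0 (energy_bound x0) x"
proof -
  obtain \<tau> :: "nat \<Rightarrow> real" where "\<And>n. 0 < \<tau> n" "\<And>t. t \<in> {0..T} \<Longrightarrow> (\<lambda>n. Y (\<tau> n) t) \<longlonglongrightarrow> x t"
    using assms(3) unfolding eps_neighborhood_solution_def by blast
  then show ?thesis
    using admissible_limit(1)[of x0 "energy_bound x0" "\<lambda>n. Y (\<tau> n)" x] discretized_admissible[OF assms(1) _ assms(2)] by blast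
qed

end

section \<open>Stability of the limits\<close>

context rate_independent
begin

lemma G_mono_right:
  assumes "admissible a M x" "0 \<le> s" "s \<le> r" "r \<le> t" "t \<le> T"
  shows "G x s r \<le> G x s t"
proof -
  have "G x s r + G x r t = G x s t"
    using assms by (intro G_add[OF admissibleD(2,3)[OF assms(1)]]) auto
  moreover have "\<Psi> (x t - x r) \<le> G x r t"
    using assms by (intro admissibleD(4)[OF assms(1)]) auto
  ultimately show ?thesis using \<Psi>_nonneg[of "x t - x r"] by linarith
qed

lemma G_right_limit:
  assumes "admissible a M x" "0 \<le> t" "t < T" "(x \<longlongrightarrow> l) (at_right t)"
  shows "((\<lambda>s. G x t s) \<longlongrightarrow> E t (x t) - E t l) (at_right t)"
proof -
  have ev: "\<forall>\<^sub>F s in at_right t. s \<in> {t<..<T}"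
    using assms(3) by (rule eventually_at_right_real)
  have id: "((\<lambda>s. s) \<longlongrightarrow> t) (at_right t)" by (rule tendsto_ident_at)
  have "((\<lambda>s. E s (x s)) \<longlongrightarrow> E t l) (at_right t)"
    using ev assms by (intro E_tendsto id) (auto elim!: eventually_mono)
  moreover have "((\<lambda>s. power_integral x t s) \<longlongrightarrow> 0) (at_right t)"
  proof (rule Lim_null_comparison)
    show "\<forall>\<^sub>F s in at_right t. norm (power_integral x t s) \<le> \<bar>lam\<bar> * M * (s - t)"
      using ev by eventually_elim (use power_integral_abs[OF admissibleD(2,3)[OF assms(1)], of t] assms in auto)
    have "((\<lambda>s. \<bar>lam\<bar> * M * (s - t)) \<longlongrightarrow> \<bar>lam\<bar> * M * (t - t)) (at_right t)"
      by (intro tendsto_intros id)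
    then show "((\<lambda>s. \<bar>lam\<bar> * M * (s - t)) \<longlongrightarrow> 0) (at_right t)" by simp
  qed
  ultimately have "((\<lambda>s. E t (x t) - E s (x s) + power_integral x t s) \<longlongrightarrow> E t (x t) - E t l + 0) (at_right t)"
    by (intro tendsto_intros)
  then show ?thesis unfolding G_def by simp
qed

lemma G_left_limit:
  assumes "admissible a M x" "0 < t" "t \<le> T" "(x \<longlongrightarrow> l) (at_left t)"
  shows "((\<lambda>s. G x s t) \<longlongrightarrow> E t l - E t (x t)) (at_left t)"
proof -
  have ev: "\<forall>\<^sub>F s in at_left t. s \<in> {0<..<t}"
    using assms(2) by (rule eventually_at_left_real)
  have id: "((\<lambda>s. s) \<longlongrightarrow> t) (at_left t)" by (rule tendsto_ident_at)
  have "((\<lambda>s. E s (x s)) \<longlongrightarrow> E t l) (at_left t)"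
    using ev assms by (intro E_tendsto id) (auto elim!: eventually_mono)
  moreover have "((\<lambda>s. power_integral x s t) \<longlongrightarrow> 0) (at_left t)"
  proof (rule Lim_null_comparison)
    show "\<forall>\<^sub>F s in at_left t. norm (power_integral x s t) \<le> \<bar>lam\<bar> * M * (t - s)"
      using ev by eventually_elim (use power_integral_abs[OF admissibleD(2,3)[OF assms(1)], of _ t] assms in auto)
    have "((\<lambda>s. \<bar>lam\<bar> * M * (t - s)) \<longlongrightarrow> \<bar>lam\<bar> * M * (t - t)) (at_left t)"
      by (intro tendsto_intros id)
    then show "((\<lambda>s. \<bar>lam\<bar> * M * (t - s)) \<longlongrightarrow> 0) (at_left t)" by simp
  qed
  ultimately have "((\<lambda>s. E s (x s) - E t (x t) + power_integral x s t) \<longlongrightarrow> E t l - E t (x t) + 0) (at_left t)"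
    by (intro tendsto_intros)
  then show ?thesis unfolding G_def by simp
qed

lemma \<Psi>_tendsto_0:
  fixes v :: "nat \<Rightarrow> 'a"
  assumes "(\<lambda>n. \<Psi> (v n)) \<longlonglongrightarrow> 0"
  shows "v \<longlonglongrightarrow> 0"
proof -
  obtain c where c: "0 < c" "\<And>v. c * norm v \<le> \<Psi> v" using \<Psi>_bounds by metis
  show ?thesis
  proof (rule Lim_null_comparison)
    show "\<forall>\<^sub>F n in sequentially. norm (v n) \<le> \<Psi> (v n) / c"
      using c by (intro always_eventually) (simp add: field_simps)
    show "(\<lambda>n. \<Psi> (v n) / c) \<longlonglongrightarrow> 0"
      using tendsto_divide[OF assms tendsto_const[of c]] c(1) by simp
  qed
qed

text \<open>The scheme is stable at the new point \<open>q n\<close>, whereas the limit is known at the old point \<open>p n\<close>;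
  right-continuity makes the energy available for the jump from \<open>p n\<close> to \<open>q n\<close> vanish.\<close>

lemma eps_solution_stable:
  assumes pos: "0 < \<epsilon>" and Y: "\<And>\<tau>. 0 < \<tau> \<Longrightarrow> discretized_solution nrm T E \<Psi> x0 \<epsilon> \<tau> (Y \<tau>)"
    and sol: "eps_neighborhood_solution T Y x"
    and t: "0 \<le> t" "t < T" and cont: "(x \<longlongrightarrow> x t) (at_right t)"
    and w: "nrm (w - x t) \<le> \<epsilon>"
  shows "E t (x t) \<le> E t w + \<Psi> (w - x t)"
proof -
  obtain \<tau> :: "nat \<Rightarrow> real" where \<tau>: "\<And>n. 0 < \<tau> n" "\<tau> \<longlonglongrightarrow> 0" "\<And>t. t \<in> {0..T} \<Longrightarrow> (\<lambda>n. Y (\<tau> n) t) \<longlonglongrightarrow> x t"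
    using sol unfolding eps_neighborhood_solution_def by blast
  define z where "z n = Y (\<tau> n)" for n
  have z_adm: "admissible x0 (energy_bound x0) (z n)" for n
    unfolding z_def by (rule discretized_admissible[OF pos \<tau>(1) Y[OF \<tau>(1)]])
  have z_lim: "(\<lambda>n. z n t) \<longlonglongrightarrow> x t" if "t \<in> {0..T}" for t
    using \<tau>(3)[OF that] by (simp add: z_def)
  note x_adm = eps_solution_admissible[OF pos Y sol]
  have "\<exists>y. scheme \<epsilon> (\<tau> n) (grid_index (\<tau> n) T) y \<and> (\<forall>t\<in>{0..T}. z n t = y (grid_index (\<tau> n) t))" for n
    using Y[OF \<tau>(1)[of n]] unfolding discretized_solution_iff[OF \<tau>(1)] z_def by blast
  then obtain y where y: "\<And>n. scheme \<epsilon> (\<tau> n) (grid_index (\<tau> n) T) (y n)"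
    "\<And>n t. t \<in> {0..T} \<Longrightarrow> z n t = y n (grid_index (\<tau> n) t)" by metis
  define k where "k n = grid_index (\<tau> n) t" for n
  \<comment> \<open>The first grid time after \<open>t\<close>, where the minimality of the step is
    available.\<close>
  define m where "m n = real (Suc (k n)) * \<tau> n" for n
  have m: "t < m n" "m n \<le> t + \<tau> n" for n
    using grid_index_bounds[OF \<tau>(1) t(1), of n] by (auto simp: m_def k_def algebra_simps)
  have m_lim: "m \<longlonglongrightarrow> t"
  proof (rule real_tendsto_sandwich[where f = "\<lambda>_. t" and h = "\<lambda>n. t + \<tau> n"])
    show "(\<lambda>n. t + \<tau> n) \<longlonglongrightarrow> t" using tendsto_add[OF tendsto_const[of t] \<tau>(2)] by simp
  qed (use m in \<open>auto intro!: always_eventually less_imp_le\<close>)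
  have ev_m: "\<forall>\<^sub>F n in sequentially. m n < r" if "t < r" for r
    using order_tendstoD(2)[OF m_lim that] .
  have m_index: "grid_index (\<tau> n) (m n) = Suc (k n)" for n
    unfolding m_def using \<tau>(1)[of n] by (intro grid_index_eq) auto
  define p where "p n = z n t" for n
  define q where "q n = z n (m n)" for n
  have p_lim: "p \<longlonglongrightarrow> x t" using z_lim[of t] t by (simp add: p_def[abs_def])
  have step: "E (m n) (q n) + \<Psi> (q n - p n) \<le> E (m n) v + \<Psi> (v - p n)" if "m n < T" "nrm (v - p n) \<le> \<epsilon>" for n v
  proof -
    have mT: "m n \<in> {0..T}" "m n \<le> T" using that(1) m(1)[of n] t by simp_all
    have "Suc (k n) \<le> grid_index (\<tau> n) T"
      using grid_index_mono[OF \<tau>(1)[of n] mT(2)] unfolding m_index .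
    then have kn: "k n < grid_index (\<tau> n) T" by simp
    have pn: "p n = y n (k n)"
      unfolding p_def k_def using t by (intro y(2)) simp
    have qn: "q n = y n (Suc (k n))"
      unfolding q_def y(2)[OF mT(1)] m_index ..
    have "\<forall>z. nrm (z - y n (k n)) \<le> \<epsilon> \<longrightarrow> E (m n) (y n (Suc (k n))) + \<Psi> (y n (Suc (k n)) - y n (k n))
        \<le> E (m n) z + \<Psi> (z - y n (k n))"
      using y(1)[of n] kn unfolding scheme_def m_def by blast
    then show ?thesis using that(2) unfolding pn qn by blast
  qed
  have "(\<lambda>n. \<Psi> (q n - p n)) \<longlonglongrightarrow> 0"
  proof (rule order_tendstoI)
    fix e :: real assume "0 < e"
    have "((\<lambda>s. G x t s) \<longlongrightarrow> 0) (at_right t)"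
      using G_right_limit[OF x_adm t cont] by simp
    then have "\<forall>\<^sub>F s in at_right t. G x t s < e" using \<open>0 < e\<close> by (rule order_tendstoD(2))
    moreover have "\<forall>\<^sub>F s in at_right t. s \<in> {t<..<T}" using t(2) by (rule eventually_at_right_real)
    ultimately have "\<forall>\<^sub>F s in at_right t. G x t s < e \<and> s \<in> {t<..<T}" by (rule eventually_conj)
    from eventually_happens'[OF trivial_limit_at_right_real this]
    obtain r where r: "G x t r < e" "t < r" "r < T" by auto
    \<comment> \<open>The time \<open>r\<close> is fixed before \<open>n\<close> grows; eventually
      \<open>m n < r\<close>, and monotonicity of \<open>G\<close> moves the estimate from
      \<open>m n\<close> to \<open>r\<close>.\<close>
    have "(\<lambda>n. G (z n) t r) \<longlonglongrightarrow> G x t r"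
      using r t by (intro admissible_limit(2)[OF z_adm z_lim]) auto
    then have "\<forall>\<^sub>F n in sequentially. G (z n) t r < e" using r(1) by (rule order_tendstoD(2))
    then show "\<forall>\<^sub>F n in sequentially. \<Psi> (q n - p n) < e"
      using ev_m[OF r(2)]
    proof eventually_elim
      case (elim n)
      have "\<Psi> (q n - p n) \<le> G (z n) t (m n)"
        unfolding p_def q_def using m(1)[of n] t r elim by (intro admissibleD(4)[OF z_adm]) auto
      also have "\<dots> \<le> G (z n) t r"
        using m(1)[of n] t r elim by (intro G_mono_right[OF z_adm]) auto
      finally show ?case using elim by simp
    qed
  qed (auto intro!: always_eventually intro: less_le_trans[OF _ \<Psi>_nonneg])
  note qp = this
  have "(\<lambda>n. (q n - p n) + p n) \<longlonglongrightarrow> 0 + x t"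
    by (intro tendsto_add \<Psi>_tendsto_0 qp p_lim)
  then have q_lim: "q \<longlonglongrightarrow> x t" by simp
  have ev_m0: "\<forall>\<^sub>F n in sequentially. m n \<in> {0..T}"
    using ev_m[OF t(2)]
  proof eventually_elim
    case (elim n)
    then show ?case using m(1)[of n] t by simp
  qed
  \<comment> \<open>Translating \<open>w\<close> together with \<open>p n\<close> keeps its
    displacement equal to \<open>w - x t\<close>, so the competitor satisfies the constraint with
    the same \<epsilon>.\<close>
  define v where "v n = p n + (w - x t)" for n
  have v_lim: "v \<longlonglongrightarrow> w" using tendsto_add[OF p_lim tendsto_const[of "w - x t"]] by (simp add: v_def[abs_def])
  have lim1: "(\<lambda>n. E (m n) (q n) + \<Psi> (q n - p n)) \<longlonglongrightarrow> E t (x t) + 0"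
    by (rule tendsto_add[OF E_tendsto[OF m_lim q_lim _ ev_m0] qp]) (use t in auto)
  have lim2: "(\<lambda>n. E (m n) (v n) + \<Psi> (w - x t)) \<longlonglongrightarrow> E t w + \<Psi> (w - x t)"
    by (rule tendsto_add[OF E_tendsto[OF m_lim v_lim _ ev_m0] tendsto_const]) (use t in auto)
  have "E t (x t) + 0 \<le> E t w + \<Psi> (w - x t)"
  proof (rule tendsto_le[OF sequentially_bot lim2 lim1])
    show "\<forall>\<^sub>F n in sequentially. E (m n) (q n) + \<Psi> (q n - p n) \<le> E (m n) (v n) + \<Psi> (w - x t)"
      using ev_m[OF t(2)]
    proof eventually_elim
      case (elim n)
      have vp: "v n - p n = w - x t" by (simp add: v_def)
      show ?case using step[OF elim, of "v n"] w unfolding vp by blast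
    qed
  qed
  then show ?thesis by simp
qed

lemma admissible_dominated_increments:
  assumes "admissible a M x"
  obtains V where "dominated_increments x V T"
proof -
  obtain c where c: "0 < c" "\<And>v. c * norm v \<le> \<Psi> v" using \<Psi>_bounds by metis
  have "dominated_increments x (\<lambda>t. G x 0 t / c) T"
    by unfold_locales (rule admissible_dominated[OF assms c])
  then show thesis using that by blast
qed

lemma admissible_regulated:
  assumes "admissible a M x"
  shows "0 \<le> t \<Longrightarrow> t < T \<Longrightarrow> (x \<longlongrightarrow> right_lim x t) (at_right t)"
    and "0 < t \<Longrightarrow> t \<le> T \<Longrightarrow> (x \<longlongrightarrow> left_lim x t) (at_left t)"
    and "countable (jump_set T x)"
    and "0 < t \<Longrightarrow> t < T \<Longrightarrow> t \<notin> jump_set T x \<Longrightarrow> left_lim x t = x t"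
    and "0 < t \<Longrightarrow> t < T \<Longrightarrow> t \<notin> jump_set T x \<Longrightarrow> right_lim x t = x t"
proof -
  obtain V where V: "dominated_increments x V T" using admissible_dominated_increments[OF assms] by blast
  show "0 \<le> t \<Longrightarrow> t < T \<Longrightarrow> (x \<longlongrightarrow> right_lim x t) (at_right t)"
    using dominated_increments.right_limit[OF V] .
  show "0 < t \<Longrightarrow> t \<le> T \<Longrightarrow> (x \<longlongrightarrow> left_lim x t) (at_left t)"
    using dominated_increments.left_limit[OF V] .
  show "countable (jump_set T x)" using dominated_increments.countable_jumps[OF V] .
  show "0 < t \<Longrightarrow> t < T \<Longrightarrow> t \<notin> jump_set T x \<Longrightarrow> left_lim x t = x t"
    using dominated_increments.not_jump(1)[OF V] .
  show "0 < t \<Longrightarrow> t < T \<Longrightarrow> t \<notin> jump_set T x \<Longrightarrow> right_lim x t = x t"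
    using dominated_increments.not_jump(2)[OF V] .
qed

section \<open>Stable points and one-sided limits\<close>

definition stable :: "real \<Rightarrow> 'a \<Rightarrow> bool" where
  "stable t p \<longleftrightarrow> - dx E t p \<in> subdiff0 \<Psi>"

text \<open>The condition is a family of weak inequalities, continuous in time and state. Frequent
  stability is enough, which permits a countable exceptional set accumulating at the limit
  time.\<close>

lemma stable_limit:
  assumes "(f \<longlongrightarrow> t) F" "(p \<longlongrightarrow> q) F" "F \<noteq> bot" "t \<in> {0..T}" "\<forall>\<^sub>F i in F. f i \<in> {0..T}"
    and "\<exists>\<^sub>F i in F. stable (f i) (p i)"
  shows "stable t q"
  unfolding stable_def stable_iff_slope
proof
  fix v
  have lim: "((\<lambda>i. \<Psi> v + blinfun_apply (dx E (f i) (p i)) v) \<longlongrightarrow> \<Psi> v + blinfun_apply (dx E t q) v) F"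
    using assms by (intro tendsto_intros dx_tendsto) auto
  have freq: "\<exists>\<^sub>F i in F. \<not> \<Psi> v + blinfun_apply (dx E (f i) (p i)) v < 0"
    using assms(6) by (rule frequently_elim1) (auto simp: stable_def stable_iff_slope dest!: spec[of _ v])
  have "\<not> \<Psi> v + blinfun_apply (dx E t q) v < 0"
  proof
    assume "\<Psi> v + blinfun_apply (dx E t q) v < 0"
    from order_tendstoD(2)[OF lim this] show False
      using freq by (simp add: frequently_def)
  qed
  then show "- blinfun_apply (dx E t q) v \<le> \<Psi> v" by simp
qed

lemma frequently_outside_countable:
  assumes "countable C"
  shows "\<exists>\<^sub>F s in at_right (t::real). s \<notin> C" "\<exists>\<^sub>F s in at_left (t::real). s \<notin> C"
proof -
  show "\<exists>\<^sub>F s in at_right t. s \<notin> C"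
    unfolding frequently_def eventually_at_right_field not_not
  proof
    assume "\<exists>b>t. \<forall>s>t. s < b \<longrightarrow> s \<in> C"
    then obtain b where "t < b" and b: "\<forall>s>t. s < b \<longrightarrow> s \<in> C" by blast
    then have "{t<..<b} \<subseteq> C" by auto
    then show False
      using assms uncountable_open_interval[of t b] countable_subset \<open>t < b\<close> by blast
  qed
  show "\<exists>\<^sub>F s in at_left t. s \<notin> C"
    unfolding frequently_def eventually_at_left_field not_not
  proof
    assume "\<exists>b<t. \<forall>s>b. s < t \<longrightarrow> s \<in> C"
    then obtain b where "b < t" and b: "\<forall>s>b. s < t \<longrightarrow> s \<in> C" by blast
    then have "{b<..<t} \<subseteq> C" by auto
    then show False
      using assms uncountable_open_interval[of b t] countable_subset \<open>b < t\<close> by blast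
  qed
qed

text \<open>Any one-sided neighborhood is uncountable and hence contains stable times, so the
  one-sided limits are stable even at a jump whose own value is not.\<close>

lemma stable_one_sided:
  assumes "countable C" "\<And>s. s \<in> {0<..<T} - C \<Longrightarrow> stable s (x s)"
  shows "0 \<le> t \<Longrightarrow> t < T \<Longrightarrow> (x \<longlongrightarrow> l) (at_right t) \<Longrightarrow> stable t l"
    and "0 < t \<Longrightarrow> t \<le> T \<Longrightarrow> (x \<longlongrightarrow> l) (at_left t) \<Longrightarrow> stable t l"
proof -
  assume t: "0 \<le> t" "t < T" "(x \<longlongrightarrow> l) (at_right t)"
  have ev: "\<forall>\<^sub>F s in at_right t. s \<in> {t<..<T}" using t(2) by (rule eventually_at_right_real)
  have ev': "\<forall>\<^sub>F s in at_right t. s \<in> {0..T}" using ev by eventually_elim (use t in auto)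
  have "\<exists>\<^sub>F s in at_right t. s \<notin> C \<and> s \<in> {t<..<T}"
    using frequently_outside_countable(1)[OF assms(1)] ev by (rule frequently_eventually_frequently)
  then have fr: "\<exists>\<^sub>F s in at_right t. stable s (x s)"
    by (rule frequently_elim1) (use assms(2) t in auto)
  show "stable t l"
    by (rule stable_limit[OF tendsto_ident_at t(3) _ _ ev' fr]) (use t in auto)
next
  assume t: "0 < t" "t \<le> T" "(x \<longlongrightarrow> l) (at_left t)"
  have ev: "\<forall>\<^sub>F s in at_left t. s \<in> {0<..<t}" using t(1) by (rule eventually_at_left_real)
  have ev': "\<forall>\<^sub>F s in at_left t. s \<in> {0..T}" using ev by eventually_elim (use t in auto)
  have "\<exists>\<^sub>F s in at_left t. s \<notin> C \<and> s \<in> {0<..<t}"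
    using frequently_outside_countable(2)[OF assms(1)] ev by (rule frequently_eventually_frequently)
  then have fr: "\<exists>\<^sub>F s in at_left t. stable s (x s)"
    by (rule frequently_elim1) (use assms(2) t in auto)
  show "stable t l"
    by (rule stable_limit[OF tendsto_ident_at t(3) _ _ ev' fr]) (use t in auto)
qed

lemma stable_continuity_point:
  assumes "countable C" "\<And>s. s \<in> {0<..<T} - C \<Longrightarrow> stable s (x s)"
    and "t \<in> {0..T}" "continuous (at t within {0..T}) x"
  shows "stable t (x t)"
proof (cases "t < T")
  case True
  have "(x \<longlongrightarrow> x t) (at t within {0..T})"
    using assms(4) by (simp add: continuous_within)
  then have "(x \<longlongrightarrow> x t) (at t within {t..T})"
    by (rule tendsto_within_subset) (use assms(3) in auto)
  then have "(x \<longlongrightarrow> x t) (at_right t)"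
    using True by (simp add: at_within_Icc_at_right)
  then show ?thesis using stable_one_sided(1)[OF assms(1,2), of t "x t"] True assms(3) by simp
next
  case False
  then have t: "t = T" using assms(3) by simp
  then have "(x \<longlongrightarrow> x t) (at_left t)"
    using assms(4) T_pos unfolding continuous_within by (simp add: at_within_Icc_at_left)
  then show ?thesis using stable_one_sided(2)[OF assms(1,2), of t "x t"] T_pos t by simp
qed

end

section \<open>Transition costs\<close>

lemma AC_on_identity: "AC_on 0 1 (\<lambda>s::real. s)"
  unfolding AC_on_def
proof (intro allI impI)
  fix e :: real assume "0 < e"
  have "(\<Sum>i<n. norm (r i - l i)) < e" if "(\<forall>i<n. 0 \<le> l i \<and> l i \<le> r i \<and> r i \<le> 1) \<and>
      disjoint_family_on (\<lambda>i. {l i<..<r i}) {..<n} \<and> (\<Sum>i<n. r i - l i) < e" for n :: nat and l r :: "nat \<Rightarrow> real"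
  proof -
    have "(\<Sum>i<n. norm (r i - l i)) = (\<Sum>i<n. r i - l i)"
      using that by (intro sum.cong) auto
    then show ?thesis using that by simp
  qed
  then show "\<exists>\<delta>>0. \<forall>(n::nat) l r. (\<forall>i<n. 0 \<le> l i \<and> l i \<le> r i \<and> r i \<le> 1) \<and>
      disjoint_family_on (\<lambda>i. {l i<..<r i}) {..<n} \<and> (\<Sum>i<n. r i - l i) < \<delta> \<longrightarrow>
      (\<Sum>i<n. norm (r i - l i :: real)) < e"
    using \<open>0 < e\<close> by (intro exI[of _ e]) auto
qed

text \<open>A sum of clamped ramps: affine on \<open>{i/n..(i+1)/n}\<close> and visibly Lipschitz.\<close>

definition polygon :: "(nat \<Rightarrow> 'a::real_vector) \<Rightarrow> nat \<Rightarrow> real \<Rightarrow> 'a" where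
  "polygon p n s = p 0 + (\<Sum>i<n. max 0 (min 1 (real n * s - real i)) *\<^sub>R (p (Suc i) - p i))"

lemma polygon_0: "polygon p n 0 = p 0"
  by (simp add: polygon_def)

lemma polygon_1: "polygon p n 1 = p n"
proof -
  have "(\<Sum>i<n. max 0 (min 1 (real n * 1 - real i)) *\<^sub>R (p (Suc i) - p i)) = (\<Sum>i<n. p (Suc i) - p i)"
  proof (rule sum.cong[OF refl])
    fix i assume "i \<in> {..<n}"
    then have "real i + 1 \<le> real n" by simp
    then show "max 0 (min 1 (real n * 1 - real i)) *\<^sub>R (p (Suc i) - p i) = p (Suc i) - p i" by simp
  qed
  then show ?thesis by (simp add: polygon_def sum_lessThan_telescope)
qed

text \<open>Ramps before \<open>i\<close> are saturated at 1 and telescope; those after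
  \<open>i\<close> are still 0.\<close>

lemma polygon_segment:
  assumes "i < n" "real i \<le> real n * s" "real n * s \<le> real i + 1"
  shows "polygon p n s = p i + (real n * s - real i) *\<^sub>R (p (Suc i) - p i)"
proof -
  define f where "f j = max 0 (min 1 (real n * s - real j)) *\<^sub>R (p (Suc j) - p j)" for j
  have "(\<Sum>j<n. f j) = (\<Sum>j<Suc i. f j)"
  proof (rule sum.mono_neutral_right)
    show "\<forall>j\<in>{..<n} - {..<Suc i}. f j = 0"
    proof
      fix j assume "j \<in> {..<n} - {..<Suc i}"
      then have "real i + 1 \<le> real j" by simp
      then show "f j = 0" using assms(3) by (simp add: f_def)
    qed
  qed (use assms(1) in auto)
  also have "\<dots> = (\<Sum>j<i. p (Suc j) - p j) + f i"
  proof -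
    have "f j = p (Suc j) - p j" if "j < i" for j
    proof -
      have "real j + 1 \<le> real i" using that by simp
      then have "min 1 (real n * s - real j) = 1" using assms(2) by (intro min_absorb1) linarith
      then show ?thesis by (simp add: f_def)
    qed
    then show ?thesis by simp
  qed
  also have "\<dots> = p i - p 0 + (real n * s - real i) *\<^sub>R (p (Suc i) - p i)"
    using assms(2,3) by (simp add: f_def sum_lessThan_telescope min_absorb2)
  finally show ?thesis by (simp add: polygon_def f_def)
qed

lemma polygon_AC:
  fixes p :: "nat \<Rightarrow> 'a::real_normed_vector"
  shows "AC_on 0 1 (polygon p n)"
proof (rule AC_on_dominated[OF AC_on_identity])
  let ?L = "real n * (\<Sum>i<n. norm (p (Suc i) - p i))"
  show "0 \<le> ?L" by (intro mult_nonneg_nonneg sum_nonneg) auto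
  fix s t :: real assume "0 \<le> s" "s \<le> t" "t \<le> 1"
  have "norm (polygon p n t - polygon p n s) =
      norm (\<Sum>i<n. (max 0 (min 1 (real n * t - real i)) - max 0 (min 1 (real n * s - real i))) *\<^sub>R (p (Suc i) - p i))"
    by (simp add: polygon_def sum_subtractf scaleR_diff_left)
  also have "\<dots> \<le> (\<Sum>i<n. (real n * (t - s)) * norm (p (Suc i) - p i))"
  proof (rule sum_norm_le)
    fix i
    have "real n * s \<le> real n * t" using \<open>s \<le> t\<close> by (intro mult_left_mono) auto
    then have "\<bar>max 0 (min 1 (real n * t - real i)) - max 0 (min 1 (real n * s - real i))\<bar> \<le> real n * t - real n * s"
      by (auto simp: max_def min_def)
    then show "norm ((max 0 (min 1 (real n * t - real i)) - max 0 (min 1 (real n * s - real i))) *\<^sub>R (p (Suc i) - p i))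
        \<le> (real n * (t - s)) * norm (p (Suc i) - p i)"
      by (simp add: mult_right_mono right_diff_distrib)
  qed
  also have "\<dots> = ?L * norm (t - s)"
    using \<open>s \<le> t\<close> by (simp add: sum_distrib_left[symmetric] mult_ac)
  finally show "norm (polygon p n t - polygon p n s) \<le> ?L * norm (t - s)" .
qed

context rate_independent
begin

abbreviation "Delta \<equiv> Delta_new nrm E \<Psi>"

definition cost :: "real \<Rightarrow> (real \<Rightarrow> 'a) \<Rightarrow> real \<Rightarrow> real" where
  "cost t \<gamma> s = \<Psi> (vector_derivative \<gamma> (at s)) + nrm (vector_derivative \<gamma> (at s)) * slope (dx E t (\<gamma> s))"

lemma Delta_eq: "Delta t a b = enn2ereal (INF \<gamma>\<in>{\<gamma>. AC_on 0 1 \<gamma> \<and> \<gamma> 0 = a \<and> \<gamma> 1 = b}.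
    \<integral>\<^sup>+s\<in>{0..1}. ennreal (cost t \<gamma> s) \<partial>lebesgue)"
  by (simp add: Delta_new_def cost_def slope_def)

lemma Delta_nonneg: "0 \<le> Delta t a b"
  by (simp add: Delta_eq)

lemma Delta_geI:
  assumes "\<And>\<gamma>. \<lbrakk>AC_on 0 1 \<gamma>; \<gamma> 0 = a; \<gamma> 1 = b\<rbrakk> \<Longrightarrow> ennreal c \<le> (\<integral>\<^sup>+s\<in>{0..1}. ennreal (cost t \<gamma> s) \<partial>lebesgue)"
  shows "ereal c \<le> Delta t a b"
proof -
  have "ennreal c \<le> (INF \<gamma>\<in>{\<gamma>. AC_on 0 1 \<gamma> \<and> \<gamma> 0 = a \<and> \<gamma> 1 = b}.
      \<integral>\<^sup>+s\<in>{0..1}. ennreal (cost t \<gamma> s) \<partial>lebesgue)"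
    by (rule INF_greatest) (use assms in auto)
  then have "enn2ereal (ennreal c) \<le> Delta t a b"
    unfolding Delta_eq by (simp add: less_eq_ennreal.rep_eq)
  \<comment> \<open>The constant may be negative, in which case \<open>ennreal\<close> truncates it
    to 0.\<close>
  moreover have "ereal c \<le> enn2ereal (ennreal c)"
    by (cases "0 \<le> c") (auto simp: enn2ereal_ennreal intro: order_trans[OF _ enn2ereal_nonneg])
  ultimately show ?thesis by (rule order_trans[rotated])
qed

text \<open>Combines the chain rule with \<open>slope_pairing\<close>: no transition is cheaper than
  the energy it loses.\<close>

lemma Delta_ge_energy:
  assumes "t \<in> {0..T}"
  shows "ereal (E t a - E t b) \<le> Delta t a b"
proof (rule Delta_geI)
  fix \<gamma> assume \<gamma>: "AC_on 0 1 \<gamma>" "\<gamma> 0 = a" "\<gamma> 1 = b"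
  have "continuous_on UNIV (\<lambda>x::'a. (t, x))"
    by (intro continuous_intros)
  then have "continuous_on UNIV (dx E t)"
    using continuous_on_compose2[OF dx_continuous, of UNIV "\<lambda>x. (t, x)"] assms by (auto simp: image_subset_iff)
  then have "ennreal (E t (\<gamma> 0) - E t (\<gamma> 1)) \<le> (\<integral>\<^sup>+s\<in>{0..1}. ennreal (cost t \<gamma> s) \<partial>lebesgue)"
    by (rule AC_on_chain_bound[OF \<gamma>(1) E_dx[OF assms]]) (unfold cost_def, rule slope_pairing)
  then show "ennreal (E t a - E t b) \<le> (\<integral>\<^sup>+s\<in>{0..1}. ennreal (cost t \<gamma> s) \<partial>lebesgue)"
    by (simp add: \<gamma>)
qed

text \<open>A supporting functional at \<open>w\<close>. The sandwich is applied with
  \<open>n v = \<Psi> (w - v) - \<Psi> w\<close>: subadditivity is exactly its hypothesis, and its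
  lower bound at \<open>v = w\<close> gives equality there.\<close>

lemma \<Psi>_support:
  obtains \<eta> :: "'a \<Rightarrow>\<^sub>L real" where "\<And>v. blinfun_apply \<eta> v \<le> \<Psi> v" "blinfun_apply \<eta> w = \<Psi> w"
proof -
  define n where "n v = \<Psi> (w - v) - \<Psi> w" for v
  have "convex_on UNIV n"
  proof (rule convex_onI)
    fix t and x y :: 'a assume t: "0 < t" "t < (1::real)"
    have "w - ((1 - t) *\<^sub>R x + t *\<^sub>R y) = (1 - t) *\<^sub>R (w - x) + t *\<^sub>R (w - y)"
      by (simp add: algebra_simps)
    then show "n ((1 - t) *\<^sub>R x + t *\<^sub>R y) \<le> (1 - t) * n x + t * n y"
      using convex_onD[OF \<Psi>_convex, of t "w - x" "w - y"] t by (simp add: n_def algebra_simps)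
  qed simp
  moreover have "- n v \<le> \<Psi> v" for v
    using \<Psi>_triangle[of "w - v" v] by (simp add: n_def)
  ultimately obtain \<eta> :: "'a \<Rightarrow>\<^sub>L real" where \<eta>: "\<And>v. - n v \<le> blinfun_apply \<eta> v" "\<And>v. blinfun_apply \<eta> v \<le> \<Psi> v"
    using convex_sandwich[OF \<Psi>_convex, of n] by (auto simp: n_def)
  have "\<Psi> w \<le> blinfun_apply \<eta> w" using \<eta>(1)[of w] by (simp add: n_def)
  with \<eta>(2) show thesis using that order_antisym by metis
qed

lemma Delta_ge_\<Psi>: "ereal (\<Psi> (b - a)) \<le> Delta t a b"
proof (rule Delta_geI)
  fix \<gamma> assume \<gamma>: "AC_on 0 1 \<gamma>" "\<gamma> 0 = a" "\<gamma> 1 = b"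
  obtain \<eta> :: "'a \<Rightarrow>\<^sub>L real" where \<eta>: "\<And>v. blinfun_apply \<eta> v \<le> \<Psi> v" "blinfun_apply \<eta> (b - a) = \<Psi> (b - a)"
    using \<Psi>_support by blast
  have "ennreal (blinfun_apply (- \<eta>) (\<gamma> 0) - blinfun_apply (- \<eta>) (\<gamma> 1))
      \<le> (\<integral>\<^sup>+s\<in>{0..1}. ennreal (cost t \<gamma> s) \<partial>lebesgue)"
  proof (rule AC_on_chain_bound[OF \<gamma>(1), where f' = "\<lambda>_. - \<eta>"])
    show "(blinfun_apply (- \<eta>) has_derivative blinfun_apply (- \<eta>)) (at x)" for x
      by (rule bounded_linear.has_derivative[OF blinfun.bounded_linear_right has_derivative_ident])
    show "- blinfun_apply (- \<eta>) (vector_derivative \<gamma> (at s)) \<le> cost t \<gamma> s" for s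
      using \<eta>(1)[of "vector_derivative \<gamma> (at s)"] slope_nonneg[of "dx E t (\<gamma> s)"]
      by (simp add: cost_def blinfun.minus_left add_increasing2)
  qed simp
  then show "ennreal (\<Psi> (b - a)) \<le> (\<integral>\<^sup>+s\<in>{0..1}. ennreal (cost t \<gamma> s) \<partial>lebesgue)"
    using \<eta>(2) by (simp add: \<gamma> blinfun.minus_left blinfun.diff_right)
qed

text \<open>Each edge is traversed in time \<open>1 / n\<close> at \<open>n\<close> times its
  length, so time cancels and only the edge and the slope bound \<open>b i\<close> remain. Edges
  carry separate bounds because slopes are controlled step by step in the scheme.\<close>

lemma Delta_polygon:
  assumes "0 < n" and b: "\<And>i. i < n \<Longrightarrow> 0 \<le> b i"
    and slope_b: "\<And>i y. \<lbrakk>i < n; y \<in> closed_segment (p i) (p (Suc i))\<rbrakk> \<Longrightarrow> slope (dx E t y) \<le> b i"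
  shows "Delta t (p 0) (p n) \<le> ereal (\<Sum>i<n. \<Psi> (p (Suc i) - p i) + nrm (p (Suc i) - p i) * b i)"
proof -
  let ?\<gamma> = "polygon p n"
  define c where "c i = \<Psi> (p (Suc i) - p i) + nrm (p (Suc i) - p i) * b i" for i
  have c: "0 \<le> c i" if "i < n" for i
    using b[OF that] by (simp add: c_def \<Psi>_nonneg)
  define S where "S i = {real i / real n..(real i + 1) / real n}" for i
  have der: "vector_derivative ?\<gamma> (at s) = real n *\<^sub>R (p (Suc i) - p i)"
    if "i < n" "real i / real n < s" "s < (real i + 1) / real n" for i s
  proof (rule vector_derivative_at, rule has_vector_derivative_transform_within_open)
    show "((\<lambda>s. p i + (real n * s - real i) *\<^sub>R (p (Suc i) - p i)) has_vector_derivative real n *\<^sub>R (p (Suc i) - p i)) (at s)"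
      by (auto intro!: derivative_eq_intros)
    show "p i + (real n * s' - real i) *\<^sub>R (p (Suc i) - p i) = ?\<gamma> s'"
      if "s' \<in> {real i / real n<..<(real i + 1) / real n}" for s'
      using that \<open>i < n\<close> by (intro polygon_segment[symmetric]) (auto simp: field_simps)
  qed (use that in auto)
  have cost_le: "cost t ?\<gamma> s \<le> real n * c i"
    if "i < n" "real i / real n < s" "s < (real i + 1) / real n" for i s
  proof -
    have s: "real i \<le> real n * s" "real n * s \<le> real i + 1"
      using that \<open>0 < n\<close> by (auto simp: field_simps)
    have "?\<gamma> s = (1 - (real n * s - real i)) *\<^sub>R p i + (real n * s - real i) *\<^sub>R p (Suc i)"
      using polygon_segment[OF that(1) s, of p] by (simp add: algebra_simps)
    then have "?\<gamma> s \<in> closed_segment (p i) (p (Suc i))"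
      using s unfolding in_segment by (intro exI[of _ "real n * s - real i"]) auto
    from slope_b[OF that(1) this]
    have "nrm (p (Suc i) - p i) * slope (dx E t (?\<gamma> s)) \<le> nrm (p (Suc i) - p i) * b i"
      by (intro mult_left_mono) auto
    then show ?thesis
      unfolding cost_def der[OF that] using \<open>0 < n\<close> by (simp add: c_def nrm_scale \<Psi>_scale distrib_left)
  qed
  have "(\<integral>\<^sup>+s\<in>{0..1}. ennreal (cost t ?\<gamma> s) \<partial>lebesgue) \<le> (\<integral>\<^sup>+s. (\<Sum>i<n. ennreal (real n * c i) * indicator (S i) s) \<partial>lebesgue)"
  proof (rule nn_integral_mono_AE, rule AE_I')
    \<comment> \<open>The corner times, where the polygon need not be differentiable.\<close>
    define P where "P = (\<lambda>i. real i / real n) ` {..n}"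
    show "P \<in> null_sets lebesgue"
      by (simp add: P_def negligible_iff_null_sets[symmetric] negligible_finite)
    show "{s \<in> space lebesgue. \<not> ennreal (cost t ?\<gamma> s) * indicator {0..1} s
        \<le> (\<Sum>i<n. ennreal (real n * c i) * indicator (S i) s)} \<subseteq> P"
    proof (rule subsetI, rule ccontr)
      fix s assume s: "s \<in> {s \<in> space lebesgue. \<not> ennreal (cost t ?\<gamma> s) * indicator {0..1} s
        \<le> (\<Sum>i<n. ennreal (real n * c i) * indicator (S i) s)}" "s \<notin> P"
      then have s01: "s \<in> {0..1}" by (cases "s \<in> {0..1}") auto
      define i where "i = nat \<lfloor>real n * s\<rfloor>"
      have i: "real i \<le> real n * s" "real n * s < real i + 1"
        using s01 \<open>0 < n\<close> by (auto simp: i_def)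
      have "real n * s \<le> real n * 1" using s01 by (intro mult_left_mono) auto
      then have "i \<le> n" using i by linarith
      have ne: "real k / real n \<noteq> s" if "k \<le> n" for k using s(2) that by (auto simp: P_def)
      have "i \<noteq> n"
      proof
        assume "i = n"
        then have "s = 1" using i \<open>real n * s \<le> real n * 1\<close> \<open>0 < n\<close> by auto
        then show False using ne[of n] \<open>0 < n\<close> by simp
      qed
      with \<open>i \<le> n\<close> have "i < n" by simp
      have "real i / real n \<le> s" "s < (real i + 1) / real n"
        using i \<open>0 < n\<close> by (simp_all add: divide_le_eq less_divide_eq mult.commute)
      with ne[OF \<open>i \<le> n\<close>] have i': "real i / real n < s" "s < (real i + 1) / real n"
        by simp_all
      have "ennreal (cost t ?\<gamma> s) * indicator {0..1} s \<le> ennreal (real n * c i) * indicator (S i) s"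
      proof -
        have "s \<in> S i" using i' by (simp add: S_def)
        then show ?thesis using ennreal_leI[OF cost_le[OF \<open>i < n\<close> i']] s01 by simp
      qed
      also have "\<dots> \<le> (\<Sum>i<n. ennreal (real n * c i) * indicator (S i) s)"
        by (rule member_le_sum) (use \<open>i < n\<close> in simp_all)
      finally show False using s(1) by simp
    qed
  qed
  also have "\<dots> = (\<integral>\<^sup>+s. (\<Sum>i<n. ennreal (real n * c i) * indicator (S i) s) \<partial>lborel)"
    by (rule nn_integral_completion)
  also have "\<dots> = (\<Sum>i<n. ennreal (real n * c i) * emeasure lborel (S i))"
    by (subst nn_integral_sum) (auto simp: S_def nn_integral_cmult_indicator)
  also have "\<dots> = (\<Sum>i<n. ennreal (c i))"
  proof (rule sum.cong[OF refl])
    fix i assume "i \<in> {..<n}"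
    then have "0 \<le> real n * c i" using c by simp
    have "emeasure lborel (S i) = ennreal (1 / real n)"
      using \<open>0 < n\<close> by (simp add: S_def divide_right_mono diff_divide_distrib[symmetric])
    then show "ennreal (real n * c i) * emeasure lborel (S i) = ennreal (c i)"
      using \<open>0 < n\<close> \<open>0 \<le> real n * c i\<close> by (simp add: ennreal_mult[symmetric])
  qed
  also have "\<dots> = ennreal (\<Sum>i<n. c i)"
    using c by (intro sum_ennreal) auto
  finally have int: "(\<integral>\<^sup>+s\<in>{0..1}. ennreal (cost t ?\<gamma> s) \<partial>lebesgue) \<le> ennreal (\<Sum>i<n. c i)" .
  have "(INF \<gamma>\<in>{\<gamma>. AC_on 0 1 \<gamma> \<and> \<gamma> 0 = p 0 \<and> \<gamma> 1 = p n}. \<integral>\<^sup>+s\<in>{0..1}. ennreal (cost t \<gamma> s) \<partial>lebesgue)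
      \<le> ennreal (\<Sum>i<n. c i)"
    using int by (intro INF_lower2[where i = ?\<gamma>]) (simp_all add: polygon_AC polygon_0 polygon_1)
  then have "Delta t (p 0) (p n) \<le> enn2ereal (ennreal (\<Sum>i<n. c i))"
    unfolding Delta_eq by (simp add: less_eq_ennreal.rep_eq)
  also have "\<dots> = ereal (\<Sum>i<n. c i)"
    using c by (intro enn2ereal_ennreal sum_nonneg) auto
  finally show ?thesis by (simp add: c_def)
qed

lemma Delta_segment:
  assumes "0 \<le> b" "\<And>y. y \<in> closed_segment p q \<Longrightarrow> slope (dx E t y) \<le> b"
  shows "Delta t p q \<le> ereal (\<Psi> (q - p) + nrm (q - p) * b)"
  using Delta_polygon[of 1 "\<lambda>_. b" "\<lambda>i. if i = 0 then p else q" t] assms by simp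

lemma Delta_refl [simp]: "Delta t p p = 0"
  using Delta_segment[of "slope (dx E t p)" p p t] slope_nonneg Delta_nonneg[of t p p]
  by (simp add: zero_ereal_def[symmetric])

lemma slope_bounded:
  obtains K where "0 \<le> K" "\<And>t y. \<lbrakk>t \<in> {0..T}; norm y \<le> B\<rbrakk> \<Longrightarrow> slope (dx E t y) \<le> K"
proof -
  obtain k where k: "0 < k" "\<And>\<eta>. dual_norm nrm \<eta> \<le> k * norm \<eta>" using dual_norm_le_norm by metis
  have "compact ((\<lambda>(t, x). dx E t x) ` ({0..T} \<times> cball 0 B))"
    by (intro compact_continuous_image compact_Times compact_cball compact_Icc
        continuous_on_subset[OF dx_continuous]) auto
  then obtain D where D: "\<And>z. z \<in> (\<lambda>(t, x). dx E t x) ` ({0..T} \<times> cball 0 B) \<Longrightarrow> norm z \<le> D"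
    using compact_imp_bounded bounded_iff by metis
  have "slope (dx E t y) \<le> max 0 (k * D)" if "t \<in> {0..T}" "norm y \<le> B" for t y
  proof -
    have "slope (dx E t y) \<le> dual_norm nrm (dx E t y + 0)"
      by (rule slope_le[OF zero_in_subdiff0])
    also have "\<dots> \<le> k * norm (dx E t y)" using k(2) by simp
    also have "\<dots> \<le> k * D"
      using D[of "dx E t y"] that k(1) by (intro mult_left_mono) force+
    finally show ?thesis by simp
  qed
  then show thesis using that[of "max 0 (k * D)"] by simp
qed

lemma closed_segment_ball: "y \<in> closed_segment p q \<Longrightarrow> norm p \<le> B \<Longrightarrow> norm q \<le> B \<Longrightarrow> norm y \<le> B"
  using closed_segment_subset[of p "cball 0 B" q] by (auto simp: subset_iff)

text \<open>The straight segment is a competitor; the slope is bounded on bounded sets and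
  \<open>nrm\<close> is dominated by \<Psi>.\<close>

lemma Delta_Lipschitz:
  obtains K where "0 \<le> K" "\<And>t p q. \<lbrakk>t \<in> {0..T}; norm p \<le> B; norm q \<le> B\<rbrakk> \<Longrightarrow> Delta t p q \<le> ereal (K * \<Psi> (q - p))"
proof -
  obtain K where K: "0 \<le> K" "\<And>t y. \<lbrakk>t \<in> {0..T}; norm y \<le> B\<rbrakk> \<Longrightarrow> slope (dx E t y) \<le> K"
    using slope_bounded by metis
  obtain C where C: "0 < C" "\<And>v. nrm v \<le> C * norm v" using nrm_bounds by metis
  obtain c where c: "0 < c" "\<And>v. c * norm v \<le> \<Psi> v" using \<Psi>_bounds by metis
  have "Delta t p q \<le> ereal ((1 + C / c * K) * \<Psi> (q - p))" if "t \<in> {0..T}" "norm p \<le> B" "norm q \<le> B" for t p q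
  proof -
    have "Delta t p q \<le> ereal (\<Psi> (q - p) + nrm (q - p) * K)"
      using K that closed_segment_ball by (intro Delta_segment) blast+
    also have "nrm (q - p) \<le> C / c * \<Psi> (q - p)"
    proof -
      have "nrm (q - p) \<le> C * norm (q - p)" by (rule C(2))
      also have "\<dots> \<le> C * (\<Psi> (q - p) / c)"
        using c C(1) by (intro mult_left_mono) (auto simp: field_simps)
      finally show ?thesis by simp
    qed
    then have "\<Psi> (q - p) + nrm (q - p) * K \<le> (1 + C / c * K) * \<Psi> (q - p)"
      using mult_right_mono[of "nrm (q - p)" "C / c * \<Psi> (q - p)" K] K(1) by (simp add: algebra_simps)
    finally show ?thesis by simp
  qed
  moreover have "0 \<le> 1 + C / c * K" using C(1) c(1) K(1) by simp
  ultimately show thesis using that by blast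
qed

end

section \<open>Energy balance along jumps\<close>

lemma infsum_ereal_of_real:
  fixes f :: "'b \<Rightarrow> real"
  assumes "f summable_on A"
  shows "(\<Sum>\<^sub>\<infinity>t\<in>A. ereal (f t)) = ereal (infsum f A)"
proof -
  have "((ereal \<circ> f) has_sum ereal (infsum f A)) A"
  proof (rule has_sum_comm_additive_general)
    show "ereal \<midarrow>infsum f A\<rightarrow> ereal (infsum f A)"
      by (intro tendsto_ereal tendsto_ident_at)
  qed (use assms in \<open>auto simp: has_sum_infsum\<close>)
  then show ?thesis by (intro infsumI) (simp add: o_def)
qed

text \<open>Induction splits the interval at the largest point of \<open>F\<close>, whose left and
  right parts become end terms of the two pieces. Applied to \<open>D\<close> it gives summability
  of the jumps, applied to \<open>G - D\<close> it gives the lower energy estimate.\<close>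

lemma jump_sum_le:
  fixes W :: "real \<Rightarrow> real \<Rightarrow> real"
  assumes super: "\<And>s r t. \<lbrakk>0 \<le> s; s < r; r < t; t \<le> T\<rbrakk> \<Longrightarrow> W s r + W r t \<le> W s t"
    and jump: "\<And>s t. \<lbrakk>0 \<le> s; s < t; t \<le> T\<rbrakk> \<Longrightarrow> fr s + fl t \<le> W s t"
    and "finite F" "F \<subseteq> {s<..<t}" "0 \<le> s" "s < t" "t \<le> T"
  shows "fr s + fl t + (\<Sum>r\<in>F. fl r + fr r) \<le> W s t"
  using assms(3,4,6,7)
proof (induction F arbitrary: t rule: finite_linorder_max_induct)
  case (insert b F)
  then have b: "s < b" "b < t" and F: "F \<subseteq> {s<..<b}" "b \<notin> F" by auto
  have "fr s + fl b + (\<Sum>r\<in>F. fl r + fr r) \<le> W s b"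
    using insert b F by (intro insert.IH) auto
  moreover have "fr b + fl t \<le> W b t" using b insert \<open>0 \<le> s\<close> by (intro jump) auto
  moreover have "W s b + W b t \<le> W s t" using b insert \<open>0 \<le> s\<close> by (intro super) auto
  moreover have "(\<Sum>r\<in>insert b F. fl r + fr r) = fl b + fr b + (\<Sum>r\<in>F. fl r + fr r)"
    using insert.hyps F(2) by simp
  ultimately show ?case by linarith
qed (use jump \<open>0 \<le> s\<close> in simp)

locale admissible_curve = rate_independent T lam nrm E \<Psi>
  for T lam :: real and nrm :: "'a::euclidean_space \<Rightarrow> real" and E :: "real \<Rightarrow> 'a \<Rightarrow> real" and \<Psi> :: "'a \<Rightarrow> real" +
  fixes a :: 'a and M :: real and x :: "real \<Rightarrow> 'a"
  assumes adm: "admissible a M x"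
begin

sublocale diss: finite_diss \<Psi> x 0 T
  using T_pos le_less_trans[OF admissible_Diss[OF adm, of 0 T], of \<infinity>] by (intro \<Psi>_finite_diss) simp_all

abbreviation "D \<equiv> diss.D"
abbreviation "L t \<equiv> left_lim x t"
abbreviation "R t \<equiv> right_lim x t"
abbreviation "J \<equiv> jump_set T x"

lemmas left_limit = admissible_regulated(2)[OF adm]
  and right_limit = admissible_regulated(1)[OF adm]

lemma not_jump: "0 < t \<Longrightarrow> t < T \<Longrightarrow> t \<notin> J \<Longrightarrow> L t = x t \<and> R t = x t"
  using admissible_regulated(4,5)[OF adm] by simp

lemma D_left:
  assumes "0 \<le> s" "s < t" "t \<le> T"
  shows "\<Psi> (L t - x s) + \<Psi> (x t - L t) \<le> D s t"
proof (rule tendsto_upperbound)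
  show "((\<lambda>q. \<Psi> (x q - x s) + \<Psi> (x t - x q)) \<longlongrightarrow> \<Psi> (L t - x s) + \<Psi> (x t - L t)) (at_left t)"
    using assms by (intro tendsto_add \<Psi>_tendsto tendsto_diff tendsto_const left_limit) auto
  show "\<forall>\<^sub>F q in at_left t. \<Psi> (x q - x s) + \<Psi> (x t - x q) \<le> D s t"
    using eventually_at_left_real[OF assms(2)]
  proof eventually_elim
    case (elim q)
    then show ?case using diss.D_ge[of s q] diss.D_ge[of q t] diss.D_add[of s q t] assms by simp
  qed
qed simp

lemma D_right:
  assumes "0 \<le> s" "s < t" "t \<le> T"
  shows "\<Psi> (R s - x s) + \<Psi> (x t - R s) \<le> D s t"
proof (rule tendsto_upperbound)
  show "((\<lambda>q. \<Psi> (x q - x s) + \<Psi> (x t - x q)) \<longlongrightarrow> \<Psi> (R s - x s) + \<Psi> (x t - R s)) (at_right s)"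
    using assms by (intro tendsto_add \<Psi>_tendsto tendsto_diff tendsto_const right_limit) auto
  show "\<forall>\<^sub>F q in at_right s. \<Psi> (x q - x s) + \<Psi> (x t - x q) \<le> D s t"
    using eventually_at_right_real[OF assms(2)]
  proof eventually_elim
    case (elim q)
    then show ?case using diss.D_ge[of s q] diss.D_ge[of q t] diss.D_add[of s q t] assms by simp
  qed
qed simp

text \<open>The midpoint separates the right jump at \<open>s\<close> from the left jump at
  \<open>t\<close>, so both count in full.\<close>

lemma D_jumps:
  assumes "0 \<le> s" "s < t" "t \<le> T"
  shows "\<Psi> (R s - x s) + \<Psi> (x t - L t) \<le> D s t"
proof -
  have r: "0 \<le> (s + t) / 2" "s < (s + t) / 2" "(s + t) / 2 < t" using assms by auto
  show ?thesis
    using D_right[of s "(s + t) / 2"] D_left[of "(s + t) / 2" t] diss.D_add[of s "(s + t) / 2" t] r assms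
      \<Psi>_nonneg[of "x ((s + t) / 2) - R s"] \<Psi>_nonneg[of "L t - x ((s + t) / 2)"] by linarith
qed

lemma bounded_limits:
  obtains B where "\<And>t. t \<in> {0..T} \<Longrightarrow> norm (x t) \<le> B"
    "\<And>t. \<lbrakk>0 < t; t \<le> T\<rbrakk> \<Longrightarrow> norm (L t) \<le> B" "\<And>t. \<lbrakk>0 \<le> t; t < T\<rbrakk> \<Longrightarrow> norm (R t) \<le> B"
proof -
  obtain B where B: "\<And>x t. \<lbrakk>admissible a M x; t \<in> {0..T}\<rbrakk> \<Longrightarrow> norm (x t) \<le> B"
    using admissible_bounded[of a M] by blast
  show thesis
  proof (rule that)
    show "norm (x t) \<le> B" if "t \<in> {0..T}" for t by (rule B[OF adm that])
    show "norm (L t) \<le> B" if t: "0 < t" "t \<le> T" for t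
    proof (rule Lim_norm_ubound[OF _ left_limit[OF t]])
      show "\<forall>\<^sub>F s in at_left t. norm (x s) \<le> B"
        using eventually_at_left_real[OF t(1)] by eventually_elim (use B[OF adm] t in auto)
    qed simp
    show "norm (R t) \<le> B" if t: "0 \<le> t" "t < T" for t
    proof (rule Lim_norm_ubound[OF _ right_limit[OF t]])
      show "\<forall>\<^sub>F s in at_right t. norm (x s) \<le> B"
        using eventually_at_right_real[OF t(2)] by eventually_elim (use B[OF adm] t in auto)
    qed simp
  qed
qed

definition dl where "dl t = real_of_ereal (Delta t (L t) (x t))"
definition dr where "dr t = real_of_ereal (Delta t (x t) (R t))"
text \<open>The excess of the transition cost over \<open>\<Psi>\<close> on either side of a jump; meaningless for \<open>jl 0\<close> and
  \<open>jr T\<close>, where the one-sided limit depends on values outside the time interval.\<close>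

definition jl where "jl t = dl t - \<Psi> (x t - L t)"
definition jr where "jr t = dr t - \<Psi> (R t - x t)"

lemma Delta_real: assumes "t \<in> {0..T}" shows "Delta t p q = ereal (real_of_ereal (Delta t p q))"
proof -
  obtain K where "\<And>t p' q'. \<lbrakk>t \<in> {0..T}; norm p' \<le> max (norm p) (norm q); norm q' \<le> max (norm p) (norm q)\<rbrakk>
      \<Longrightarrow> Delta t p' q' \<le> ereal (K * \<Psi> (q' - p'))"
    using Delta_Lipschitz[of "max (norm p) (norm q)"] by metis
  from this[OF assms, of p q] have "Delta t p q \<le> ereal (K * \<Psi> (q - p))" by simp
  then show ?thesis using Delta_nonneg[of t p q] by (cases "Delta t p q") auto
qed

lemma Delta_dl: "t \<in> {0..T} \<Longrightarrow> Delta t (L t) (x t) = ereal (dl t)"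
  and Delta_dr: "t \<in> {0..T} \<Longrightarrow> Delta t (x t) (R t) = ereal (dr t)"
  unfolding dl_def dr_def by (rule Delta_real; simp)+

lemma jl_nonneg: "t \<in> {0..T} \<Longrightarrow> 0 \<le> jl t"
  using Delta_ge_\<Psi>[of "x t" "L t" t] by (simp add: jl_def Delta_dl)

lemma jr_nonneg: "t \<in> {0..T} \<Longrightarrow> 0 \<le> jr t"
  using Delta_ge_\<Psi>[of "R t" "x t" t] by (simp add: jr_def Delta_dr)

lemma dl_ge_energy: "t \<in> {0..T} \<Longrightarrow> E t (L t) - E t (x t) \<le> dl t"
  using Delta_ge_energy[of t "L t" "x t"] by (simp add: Delta_dl)

lemma dr_ge_energy: "t \<in> {0..T} \<Longrightarrow> E t (x t) - E t (R t) \<le> dr t"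
  using Delta_ge_energy[of t "x t" "R t"] by (simp add: Delta_dr)

lemma jl_jr_zero: "0 < t \<Longrightarrow> t < T \<Longrightarrow> t \<notin> J \<Longrightarrow> jl t = 0 \<and> jr t = 0"
  using not_jump[of t] by (simp add: jl_def jr_def dl_def dr_def)

text \<open>The \<Psi>-sizes of the jumps are bounded by the dissipation through
  \<open>jump_sum_le\<close>; transition costs are comparable to them because the curve and its
  limits stay in a fixed ball.\<close>

lemma jumps_summable:
  assumes "0 \<le> s" "s < t" "t \<le> T" "A \<subseteq> {s<..<t}"
  shows "(\<lambda>r. \<Psi> (x r - L r) + \<Psi> (R r - x r)) summable_on A" "(\<lambda>r. dl r + dr r) summable_on A"
    "(\<lambda>r. jl r + jr r) summable_on A"
proof -
  let ?p = "\<lambda>r. \<Psi> (x r - L r) + \<Psi> (R r - x r)"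
  obtain B where B: "\<And>t. t \<in> {0..T} \<Longrightarrow> norm (x t) \<le> B"
    "\<And>t. \<lbrakk>0 < t; t \<le> T\<rbrakk> \<Longrightarrow> norm (L t) \<le> B" "\<And>t. \<lbrakk>0 \<le> t; t < T\<rbrakk> \<Longrightarrow> norm (R t) \<le> B"
    using bounded_limits by blast
  obtain K where K: "0 \<le> K" "\<And>t p q. \<lbrakk>t \<in> {0..T}; norm p \<le> B; norm q \<le> B\<rbrakk> \<Longrightarrow> Delta t p q \<le> ereal (K * \<Psi> (q - p))"
    using Delta_Lipschitz by blast
  have fin: "sum ?p F \<le> D s t" if "finite F" "F \<subseteq> A" for F
  proof -
    have "\<Psi> (R s - x s) + \<Psi> (x t - L t) + sum ?p F \<le> D s t"
    proof (rule jump_sum_le[where W = D and fr = "\<lambda>s. \<Psi> (R s - x s)" and fl = "\<lambda>t. \<Psi> (x t - L t)" and T = T])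
      show "D s r + D r t \<le> D s t" if "0 \<le> s" "s < r" "r < t" "t \<le> T" for s r t
        using diss.D_add[of s r t] that by simp
      show "\<Psi> (R s - x s) + \<Psi> (x t - L t) \<le> D s t" if "0 \<le> s" "s < t" "t \<le> T" for s t
        by (rule D_jumps[OF that])
    qed (use assms that in auto)
    then show ?thesis using \<Psi>_nonneg[of "R s - x s"] \<Psi>_nonneg[of "x t - L t"] by linarith
  qed
  show p: "?p summable_on A"
    by (rule nonneg_bdd_above_summable_on) (auto intro!: add_nonneg_nonneg \<Psi>_nonneg bdd_aboveI2[of _ _ "D s t"] fin)
  have d: "0 \<le> dl r + dr r" "dl r + dr r \<le> K * ?p r" if "r \<in> A" for r
  proof -
    have r: "0 < r" "r < T" "r \<in> {0..T}" using that assms by auto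
    show "0 \<le> dl r + dr r"
      unfolding dl_def dr_def by (intro add_nonneg_nonneg real_of_ereal_pos Delta_nonneg)
    have "dl r \<le> K * \<Psi> (x r - L r)"
      using K(2)[of r "L r" "x r"] B r by (simp add: Delta_dl)
    moreover have "dr r \<le> K * \<Psi> (R r - x r)"
      using K(2)[of r "x r" "R r"] B r by (simp add: Delta_dr)
    ultimately show "dl r + dr r \<le> K * ?p r" by (simp add: distrib_left)
  qed
  show d_sum: "(\<lambda>r. dl r + dr r) summable_on A"
  proof (rule summable_on_comparison_test)
    show "(\<lambda>r. K * ?p r) summable_on A" by (intro summable_on_cmult_right p)
  qed (use d in auto)
  have "(\<lambda>r. (dl r + dr r) + (-1) * ?p r) summable_on A"
    by (intro summable_on_add[OF d_sum] summable_on_cmult_right p)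
  moreover have "(dl r + dr r) + (-1) * ?p r = jl r + jr r" for r
    by (simp add: jl_def jr_def)
  ultimately show "(\<lambda>r. jl r + jr r) summable_on A" by simp
qed

text \<open>The excess of \<open>Diss_new\<close> over \<open>Diss\<close>. An end point contributes
  only from the side facing the interval, and the degenerate interval contributes nothing.\<close>

definition S where
  "S s t = (if s < t then (\<Sum>\<^sub>\<infinity>r\<in>J \<inter> {s<..<t}. jl r + jr r) + jr s + jl t else 0)"

lemma S_refl [simp]: "S s s = 0" by (simp add: S_def)

lemma Diss_new_eq:
  assumes "0 \<le> s" "s \<le> t" "t \<le> T"
  shows "Diss_new nrm T E \<Psi> x s t = ereal (D s t + S s t)"
proof (cases "s = t")
  case False
  then have st: "s < t" "s \<in> {0..T}" "t \<in> {0..T}" using assms by auto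
  let ?A = "J \<inter> {s<..<t}"
  note summ = jumps_summable[OF assms(1) st(1) assms(3), of ?A]
  have "(\<Sum>\<^sub>\<infinity>t\<in>?A. Delta t (L t) (x t) + Delta t (x t) (R t)) = (\<Sum>\<^sub>\<infinity>t\<in>?A. ereal (dl t + dr t))"
    using assms by (intro infsum_cong) (simp add: Delta_dl Delta_dr)
  also have "\<dots> = ereal (\<Sum>\<^sub>\<infinity>t\<in>?A. dl t + dr t)"
    using summ by (intro infsum_ereal_of_real) auto
  finally have 1: "(\<Sum>\<^sub>\<infinity>t\<in>?A. Delta t (L t) (x t) + Delta t (x t) (R t)) = ereal (\<Sum>\<^sub>\<infinity>t\<in>?A. dl t + dr t)" .
  have 2: "(\<Sum>\<^sub>\<infinity>t\<in>?A. ereal (\<Psi> (x t - L t) + \<Psi> (R t - x t))) = ereal (\<Sum>\<^sub>\<infinity>t\<in>?A. \<Psi> (x t - L t) + \<Psi> (R t - x t))"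
    using summ by (intro infsum_ereal_of_real) auto
  have "(\<Sum>\<^sub>\<infinity>r\<in>?A. jl r + jr r) + (\<Sum>\<^sub>\<infinity>r\<in>?A. \<Psi> (x r - L r) + \<Psi> (R r - x r)) =
      (\<Sum>\<^sub>\<infinity>r\<in>?A. (jl r + jr r) + (\<Psi> (x r - L r) + \<Psi> (R r - x r)))"
    using summ by (intro infsum_add[symmetric]) auto
  also have "\<dots> = (\<Sum>\<^sub>\<infinity>r\<in>?A. dl r + dr r)"
    by (simp add: jl_def jr_def)
  finally have 3: "(\<Sum>\<^sub>\<infinity>r\<in>?A. dl r + dr r) =
      (\<Sum>\<^sub>\<infinity>r\<in>?A. jl r + jr r) + (\<Sum>\<^sub>\<infinity>r\<in>?A. \<Psi> (x r - L r) + \<Psi> (R r - x r))" by simp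
  show ?thesis
    unfolding Diss_new_def 1 2 3 Delta_dl[OF st(3)] Delta_dr[OF st(2)] diss.Diss_eq[OF assms]
    using st False by (simp add: S_def jl_def jr_def)
qed (simp add: Diss_new_def)

text \<open>The end terms \<open>jl r\<close> and \<open>jr r\<close> of the two parts form the
  interior term at \<open>r\<close>; if \<open>r\<close> is not a jump time they vanish.\<close>

lemma S_superadditive:
  assumes "0 \<le> s" "s < r" "r < t" "t \<le> T"
  shows "S s r + S r t \<le> S s t"
proof -
  let ?j = "\<lambda>r. jl r + jr r"
  have summ: "?j summable_on A" if "A \<subseteq> {s<..<t}" for A
    using assms jumps_summable(3)[of s t A] that by simp
  have "infsum ?j (J \<inter> {r}) = jl r + jr r"
    using jl_jr_zero[of r] assms by (cases "r \<in> J") auto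
  moreover have "infsum ?j (J \<inter> {s<..<t}) = infsum ?j ((J \<inter> {s<..<r}) \<union> (J \<inter> {r<..<t} \<union> J \<inter> {r}))"
    using assms by (intro arg_cong[of _ _ "infsum ?j"]) auto
  moreover have "\<dots> = infsum ?j (J \<inter> {s<..<r}) + infsum ?j (J \<inter> {r<..<t} \<union> J \<inter> {r})"
    using assms by (intro infsum_Un_disjoint summ) auto
  moreover have "infsum ?j (J \<inter> {r<..<t} \<union> J \<inter> {r}) = infsum ?j (J \<inter> {r<..<t}) + infsum ?j (J \<inter> {r})"
    using assms by (intro infsum_Un_disjoint summ) auto
  ultimately show ?thesis using assms by (simp add: S_def)
qed

lemma infsum_jumps_nonneg: "0 \<le> s \<Longrightarrow> t \<le> T \<Longrightarrow> 0 \<le> (\<Sum>\<^sub>\<infinity>r\<in>J \<inter> {s<..<t}. jl r + jr r)"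
  by (intro infsum_nonneg add_nonneg_nonneg jl_nonneg jr_nonneg) auto

section \<open>The released energy is at most \<open>Diss_new\<close>\<close>

text \<open>The base point is the one-sided limit \<open>p\<close>, not the value
  \<open>x r\<close>: only \<open>p\<close> is approached by the curve and known to be
  stable.\<close>

lemma energy_expansion:
  assumes r: "r \<in> {0..T}" and F: "((\<lambda>u. u) \<longlongrightarrow> r) F" "(x \<longlongrightarrow> p) F" "\<forall>\<^sub>F u in F. u \<in> {0..T}" and "0 < e"
  shows "\<forall>\<^sub>F u in F. \<bar>E u (x u) - E r p - (dt T E r p * (u - r) + blinfun_apply (dx E r p) (x u - p))\<bar>
    \<le> e * (\<bar>u - r\<bar> + norm (x u - p))"
proof -
  obtain d where d: "0 < d" "\<And>z. z \<in> strip \<Longrightarrow> norm (z - (r, p)) < d \<Longrightarrow>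
      norm ((case z of (s, y) \<Rightarrow> E s y) - E r p - (case z - (r, p) of (h, k) \<Rightarrow> dt T E r p * h + blinfun_apply (dx E r p) k))
      \<le> e * norm (z - (r, p))"
    using E_has_derivative[OF r, of p, unfolded has_derivative_within_alt] \<open>0 < e\<close> by force
  have "((\<lambda>u. (u, x u)) \<longlongrightarrow> (r, p)) F" using F by (intro tendsto_Pair)
  then have "\<forall>\<^sub>F u in F. dist (u, x u) (r, p) < d" using d(1) by (rule tendstoD)
  then show ?thesis using F(3)
  proof eventually_elim
    case (elim u)
    have "\<bar>E u (x u) - E r p - (dt T E r p * (u - r) + blinfun_apply (dx E r p) (x u - p))\<bar> \<le> e * norm ((u, x u) - (r, p))"
      using d(2)[of "(u, x u)"] elim by (simp add: dist_norm)
    also have "norm ((u, x u) - (r, p)) \<le> \<bar>u - r\<bar> + norm (x u - p)"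
      using norm_Pair_le[of "u - r" "x u - p"] by simp
    finally show ?case using \<open>0 < e\<close> by simp
  qed
qed

text \<open>The finite set \<open>N\<close> removes the end point at which the curve takes its own
  value instead of the limit.\<close>

lemma power_expansion:
  assumes "0 \<le> u" "u \<le> v" "v \<le> T" "finite N" "\<And>q. q \<in> {u..v} - N \<Longrightarrow> \<bar>dt T E q (x q) - k\<bar> \<le> e" "0 \<le> e"
  shows "\<bar>power_integral x u v - k * (v - u)\<bar> \<le> e * (v - u)"
proof -
  have "((\<lambda>q. dt T E q (x q)) has_integral power_integral x u v) {u..v}"
    unfolding power_integral_def
    using power_integrable[OF admissibleD(2,3)[OF adm] assms(1,3)] by (rule integrable_integral)
  moreover have "((\<lambda>q. k) has_integral k * (v - u)) {u..v}"
    using has_integral_const_real[of k u v] assms(2) by (simp add: mult.commute)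
  ultimately have "((\<lambda>q. dt T E q (x q) - k) has_integral (power_integral x u v - k * (v - u))) {u..v}"
    by (rule has_integral_diff)
  from has_integral_bound_real[OF assms(6,4) this] assms(2,5) show ?thesis by simp
qed

context
  fixes C :: "real set"
  assumes C: "countable C" and stab: "\<And>s. s \<in> {0<..<T} - C \<Longrightarrow> stable s (x s)"
begin

text \<open>The released energy is split at the state \<open>L r\<close>. Before the jump, the time
  derivative cancels against the power and stability at \<open>L r\<close> bounds the spatial term
  by \<Psi>; the jump from \<open>L r\<close> to \<open>x r\<close> releases at most its transition
  cost.\<close>

lemma G_left_local:
  assumes r: "0 < r" "r \<le> T" and "0 < \<eta>"
  shows "\<forall>\<^sub>F u in at_left r. G x u r \<le> (1 + \<eta>) * \<Psi> (L r - x u) + \<eta> * (r - u) + dl r"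
proof -
  obtain c where c: "0 < c" "\<And>v. c * norm v \<le> \<Psi> v" using \<Psi>_bounds by metis
  \<comment> \<open>\<open>\<eta> / 2\<close> serves the two time errors, from the energy and from
    the power; \<open>\<eta> * c\<close> turns the spatial error into a multiple of \<Psi>.\<close>
  define e where "e = min (\<eta> / 2) (\<eta> * c)"
  have e: "0 < e" "2 * e \<le> \<eta>" "e \<le> \<eta> * c" using \<open>0 < \<eta>\<close> c by (auto simp: e_def)
  let ?p = "L r"
  have rT: "r \<in> {0..T}" using r by simp
  have ev: "\<forall>\<^sub>F u in at_left r. u \<in> {0<..<r}" by (rule eventually_at_left_real[OF r(1)])
  have evT: "\<forall>\<^sub>F u in at_left r. u \<in> {0..T}" using ev by eventually_elim (use r in auto)
  have stable_p: "- blinfun_apply (dx E r ?p) v \<le> \<Psi> v" for v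
    using stable_one_sided(2)[OF C stab r left_limit[OF r]] unfolding stable_def stable_iff_slope by blast
  note exp = energy_expansion[OF rT tendsto_ident_at left_limit[OF r] evT e(1)]
  have "((\<lambda>u. dt T E u (x u)) \<longlongrightarrow> dt T E r ?p) (at_left r)"
    by (rule dt_tendsto[OF tendsto_ident_at left_limit[OF r] rT evT])
  then have "\<forall>\<^sub>F u in at_left r. dist (dt T E u (x u)) (dt T E r ?p) < e" using e(1) by (rule tendstoD)
  then obtain b where b: "b < r" "\<And>q. b < q \<Longrightarrow> q < r \<Longrightarrow> \<bar>dt T E q (x q) - dt T E r ?p\<bar> < e"
    unfolding eventually_at_left_field dist_real_def by blast
  show ?thesis
    using exp ev eventually_at_left_real[OF b(1)]
  proof eventually_elim
    case (elim u)
    have "\<bar>power_integral x u r - dt T E r ?p * (r - u)\<bar> \<le> e * (r - u)"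
      using elim b(2) r e by (intro power_expansion[of _ _ "{r}"]) (auto intro!: less_imp_le)
    then have P: "power_integral x u r \<le> dt T E r ?p * (r - u) + e * (r - u)" by linarith
    have "E u (x u) - E r ?p - (dt T E r ?p * (u - r) + blinfun_apply (dx E r ?p) (x u - ?p)) \<le> e * (\<bar>u - r\<bar> + norm (x u - ?p))"
      using elim(1) by linarith
    then have A: "E u (x u) - E r ?p \<le> - (dt T E r ?p * (r - u)) - blinfun_apply (dx E r ?p) (?p - x u) + e * (r - u) + e * norm (?p - x u)"
      using elim(2) by (simp add: blinfun.diff_right norm_minus_commute algebra_simps)
    have "e * norm (?p - x u) \<le> \<eta> * c * norm (?p - x u)" using e by (intro mult_right_mono) auto
    also have "\<dots> \<le> \<eta> * \<Psi> (?p - x u)" using c(2)[of "?p - x u"] \<open>0 < \<eta>\<close> by simp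
    finally have N: "e * norm (?p - x u) \<le> \<eta> * \<Psi> (?p - x u)" .
    have "2 * e * (r - u) \<le> \<eta> * (r - u)" using e elim(2) by (intro mult_right_mono) auto
    then show ?case
      using P A N stable_p[of "?p - x u"] dl_ge_energy[OF rT] by (simp add: G_def distrib_right)
  qed
qed

lemma G_right_local:
  assumes r: "0 \<le> r" "r < T" and "0 < \<eta>"
  shows "\<forall>\<^sub>F v in at_right r. G x r v \<le> (1 + \<eta>) * \<Psi> (x v - R r) + \<eta> * (v - r) + dr r"
proof -
  obtain c where c: "0 < c" "\<And>v. c * norm v \<le> \<Psi> v" using \<Psi>_bounds by metis
  define e where "e = min (\<eta> / 2) (\<eta> * c)"
  have e: "0 < e" "2 * e \<le> \<eta>" "e \<le> \<eta> * c" using \<open>0 < \<eta>\<close> c by (auto simp: e_def)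
  let ?p = "R r"
  have rT: "r \<in> {0..T}" using r by simp
  have ev: "\<forall>\<^sub>F u in at_right r. u \<in> {r<..<T}" by (rule eventually_at_right_real[OF r(2)])
  have evT: "\<forall>\<^sub>F u in at_right r. u \<in> {0..T}" using ev by eventually_elim (use r in auto)
  have stable_p: "- blinfun_apply (dx E r ?p) v \<le> \<Psi> v" for v
    using stable_one_sided(1)[OF C stab r right_limit[OF r]] unfolding stable_def stable_iff_slope by blast
  note exp = energy_expansion[OF rT tendsto_ident_at right_limit[OF r] evT e(1)]
  have "((\<lambda>u. dt T E u (x u)) \<longlongrightarrow> dt T E r ?p) (at_right r)"
    by (rule dt_tendsto[OF tendsto_ident_at right_limit[OF r] rT evT])
  then have "\<forall>\<^sub>F u in at_right r. dist (dt T E u (x u)) (dt T E r ?p) < e" using e(1) by (rule tendstoD)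
  then obtain b where b: "r < b" "\<And>q. r < q \<Longrightarrow> q < b \<Longrightarrow> \<bar>dt T E q (x q) - dt T E r ?p\<bar> < e"
    unfolding eventually_at_right_field dist_real_def by blast
  show ?thesis
    using exp ev eventually_at_right_real[OF b(1)]
  proof eventually_elim
    case (elim v)
    have "\<bar>power_integral x r v - dt T E r ?p * (v - r)\<bar> \<le> e * (v - r)"
      using elim b(2) r e by (intro power_expansion[of _ _ "{r}"]) (auto intro!: less_imp_le)
    then have P: "power_integral x r v \<le> dt T E r ?p * (v - r) + e * (v - r)" by linarith
    have "- (E v (x v) - E r ?p - (dt T E r ?p * (v - r) + blinfun_apply (dx E r ?p) (x v - ?p))) \<le> e * (\<bar>v - r\<bar> + norm (x v - ?p))"
      using elim(1) by linarith
    then have A: "E r ?p - E v (x v) \<le> - (dt T E r ?p * (v - r)) - blinfun_apply (dx E r ?p) (x v - ?p) + e * (v - r) + e * norm (x v - ?p)"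
      using elim(2) by (simp add: algebra_simps)
    have "e * norm (x v - ?p) \<le> \<eta> * c * norm (x v - ?p)" using e by (intro mult_right_mono) auto
    also have "\<dots> \<le> \<eta> * \<Psi> (x v - ?p)" using c(2)[of "x v - ?p"] \<open>0 < \<eta>\<close> by simp
    finally have N: "e * norm (x v - ?p) \<le> \<eta> * \<Psi> (x v - ?p)" .
    have "2 * e * (v - r) \<le> \<eta> * (v - r)" using e elim(2) by (intro mult_right_mono) auto
    then show ?case
      using P A N stable_p[of "x v - ?p"] dr_ge_energy[OF rT] by (simp add: G_def distrib_right)
  qed
qed

text \<open>\<open>G\<close> is additive and the right-hand side superadditive, so the estimate
  passes to unions of adjacent intervals. Bisection then requires it only near each time, on both
  sides separately; the errors proportional to \<eta> remain additive.\<close>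

lemma G_le_Diss_new_approx:
  assumes st: "0 \<le> s" "s \<le> t" "t \<le> T" and "0 < \<eta>"
  shows "G x s t \<le> (1 + \<eta>) * D s t + \<eta> * (t - s) + S s t"
proof -
  \<comment> \<open>The guard makes the property vacuous outside \<open>{s..t}\<close>, since
    bisection asks for full neighborhoods of each point.\<close>
  define P where "P u v \<longleftrightarrow> (s \<le> u \<and> u \<le> v \<and> v \<le> t \<longrightarrow> G x u v \<le> (1 + \<eta>) * D u v + \<eta> * (v - u) + S u v)" for u v
  have P_refl: "P u u" for u by (simp add: P_def)
  have P_trans: "P u w" if "P u v" "P v w" "u \<le> v" "v \<le> w" for u v w
    unfolding P_def
  proof
    assume uw: "s \<le> u \<and> u \<le> w \<and> w \<le> t"
    then have G: "G x u v \<le> (1 + \<eta>) * D u v + \<eta> * (v - u) + S u v" "G x v w \<le> (1 + \<eta>) * D v w + \<eta> * (w - v) + S v w"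
      using that by (auto simp: P_def)
    have "S u v + S v w \<le> S u w"
      using S_superadditive[of u v w] uw that st by (cases "u = v"; cases "v = w") auto
    moreover have "G x u v + G x v w = G x u w"
      using uw that st by (intro G_add[OF admissibleD(2,3)[OF adm]]) auto
    moreover have "(1 + \<eta>) * D u v + (1 + \<eta>) * D v w = (1 + \<eta>) * D u w"
      using diss.D_add[of u v w] uw that st by (simp add: distrib_left[symmetric])
    moreover have "\<eta> * (v - u) + \<eta> * (w - v) = \<eta> * (w - u)" by (simp add: algebra_simps)
    ultimately show "G x u w \<le> (1 + \<eta>) * D u w + \<eta> * (w - u) + S u w" using G by linarith
  qed
  have "P s t"
    using st(2)
  proof (rule Bolzano)
    show "P u w" if "P u v" "P v w" "u \<le> v" "v \<le> w" for u v w by (rule P_trans[OF that])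
    fix r assume r: "s \<le> r" "r \<le> t"
    have "\<exists>d>0. \<forall>u. u \<le> r \<and> r - u < d \<longrightarrow> P u r"
    proof (cases "s < r")
      case True
      then have r': "0 < r" "r \<le> T" using st r by auto
      from G_left_local[OF r' \<open>0 < \<eta>\<close>] obtain b where b: "b < r"
        "\<And>u. b < u \<Longrightarrow> u < r \<Longrightarrow> G x u r \<le> (1 + \<eta>) * \<Psi> (L r - x u) + \<eta> * (r - u) + dl r"
        unfolding eventually_at_left_field by blast
      have "P u r" if u: "u \<le> r" "r - u < r - b" for u
      proof (cases "u = r")
        case False
        show ?thesis
          unfolding P_def
        proof
          assume su: "s \<le> u \<and> u \<le> r \<and> r \<le> t"
          have ur: "0 \<le> u" "u < r" "r \<le> T" using su st False u by auto
          have "(1 + \<eta>) * (\<Psi> (L r - x u) + \<Psi> (x r - L r)) \<le> (1 + \<eta>) * D u r"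
            using D_left[OF ur] \<open>0 < \<eta>\<close> by (intro mult_left_mono) auto
          moreover have "0 \<le> \<eta> * \<Psi> (x r - L r)" using \<open>0 < \<eta>\<close> \<Psi>_nonneg by simp
          moreover have "jl r \<le> S u r"
            using infsum_jumps_nonneg[of u r] jr_nonneg[of u] ur by (simp add: S_def)
          moreover have "G x u r \<le> (1 + \<eta>) * \<Psi> (L r - x u) + \<eta> * (r - u) + dl r"
            using b(2)[of u] u ur by simp
          ultimately show "G x u r \<le> (1 + \<eta>) * D u r + \<eta> * (r - u) + S u r"
            by (simp add: jl_def distrib_right distrib_left)
        qed
      qed (simp add: P_refl)
      then show ?thesis using b(1) by (intro exI[of _ "r - b"]) auto
    next
      case False
      have "P u r" if "u \<le> r" for u
        using that False r P_refl[of r] by (cases "u = r") (auto simp: P_def)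
      then show ?thesis by (intro exI[of _ 1]) auto
    qed
    then obtain d1 where d1: "0 < d1" "\<And>u. u \<le> r \<Longrightarrow> r - u < d1 \<Longrightarrow> P u r" by blast
    have "\<exists>d>0. \<forall>v. r \<le> v \<and> v - r < d \<longrightarrow> P r v"
    proof (cases "r < t")
      case True
      then have r': "0 \<le> r" "r < T" using st r by auto
      from G_right_local[OF r' \<open>0 < \<eta>\<close>] obtain b where b: "r < b"
        "\<And>v. r < v \<Longrightarrow> v < b \<Longrightarrow> G x r v \<le> (1 + \<eta>) * \<Psi> (x v - R r) + \<eta> * (v - r) + dr r"
        unfolding eventually_at_right_field by blast
      have "P r v" if v: "r \<le> v" "v - r < b - r" for v
      proof (cases "v = r")
        case False
        show ?thesis
          unfolding P_def
        proof
          assume su: "s \<le> r \<and> r \<le> v \<and> v \<le> t"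
          have rv: "0 \<le> r" "r < v" "v \<le> T" using su st False v by auto
          have "(1 + \<eta>) * (\<Psi> (R r - x r) + \<Psi> (x v - R r)) \<le> (1 + \<eta>) * D r v"
            using D_right[OF rv] \<open>0 < \<eta>\<close> by (intro mult_left_mono) auto
          moreover have "0 \<le> \<eta> * \<Psi> (R r - x r)" using \<open>0 < \<eta>\<close> \<Psi>_nonneg by simp
          moreover have "jr r \<le> S r v"
            using infsum_jumps_nonneg[of r v] jl_nonneg[of v] rv by (simp add: S_def)
          moreover have "G x r v \<le> (1 + \<eta>) * \<Psi> (x v - R r) + \<eta> * (v - r) + dr r"
            using b(2)[of v] v rv by simp
          ultimately show "G x r v \<le> (1 + \<eta>) * D r v + \<eta> * (v - r) + S r v"
            by (simp add: jr_def distrib_right distrib_left)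
        qed
      qed (simp add: P_refl)
      then show ?thesis using b(1) by (intro exI[of _ "b - r"]) auto
    next
      case False
      have "P r v" if "r \<le> v" for v
        using that False r P_refl[of r] by (cases "v = r") (auto simp: P_def)
      then show ?thesis by (intro exI[of _ 1]) auto
    qed
    then obtain d2 where d2: "0 < d2" "\<And>v. r \<le> v \<Longrightarrow> v - r < d2 \<Longrightarrow> P r v" by blast
    have "P u v" if "u \<le> r" "r \<le> v" "v - u < min d1 d2" for u v
      using d1(2)[of u] d2(2)[of v] P_trans[of u r v] that by simp
    then show "\<exists>d>0. \<forall>u v. u \<le> r \<and> r \<le> v \<and> v - u < d \<longrightarrow> P u v"
      using d1(1) d2(1) by (intro exI[of _ "min d1 d2"]) auto
  qed
  then show ?thesis using st by (simp add: P_def)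
qed

lemma G_le_Diss_new:
  assumes st: "0 \<le> s" "s \<le> t" "t \<le> T"
  shows "G x s t \<le> D s t + S s t"
proof (rule field_le_epsilon)
  fix e :: real assume "0 < e"
  define k where "k = D s t + (t - s)"
  have "0 \<le> k" using diss.D_nonneg[OF st(2)] st by (simp add: k_def)
  define \<eta> where "\<eta> = e / (k + 1)"
  have "0 < \<eta>" using \<open>0 < e\<close> \<open>0 \<le> k\<close> by (simp add: \<eta>_def)
  have "\<eta> * k \<le> e"
    using \<open>0 < e\<close> \<open>0 \<le> k\<close> by (simp add: \<eta>_def field_simps)
  moreover have "G x s t \<le> D s t + S s t + \<eta> * k"
    using G_le_Diss_new_approx[OF st \<open>0 < \<eta>\<close>] by (simp add: k_def algebra_simps)
  ultimately show "G x s t \<le> D s t + S s t + e" by linarith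
qed

end

end

section \<open>Transition costs of discretized solutions\<close>

context rate_independent
begin

text \<open>Optimality is known only at the new point \<open>q\<close> and the step time
  \<open>t\<close>. Uniform continuity of \<open>dx\<close> on a bounded set extends it to the whole
  edge and to a nearby frozen time \<open>t'\<close>, with an error proportional to the edge length
  so that errors can be summed along the path.\<close>

lemma step_cost:
  assumes "0 < \<eta>"
  obtains \<delta> where "0 < \<delta>"
    "\<And>t t' p q. \<lbrakk>t \<in> {0..T}; t' \<in> {0..T}; \<bar>t - t'\<bar> < \<delta>; norm p \<le> B; norm q \<le> B; norm (q - p) < \<delta>;
       \<Psi> (q - p) + nrm (q - p) * slope (dx E t q) \<le> - blinfun_apply (dx E t q) (q - p)\<rbrakk>
     \<Longrightarrow> \<exists>b\<ge>0. (\<forall>y\<in>closed_segment p q. slope (dx E t' y) \<le> b) \<and>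
           \<Psi> (q - p) + nrm (q - p) * b \<le> E t p - E t q + \<eta> * norm (q - p)"
proof -
  obtain k where k: "0 < k" "\<And>\<xi>. dual_norm nrm \<xi> \<le> k * norm \<xi>" using dual_norm_le_norm by metis
  obtain C where C: "0 < C" "\<And>v. nrm v \<le> C * norm v" using nrm_bounds by metis
  \<comment> \<open>Half of \<eta> pays for linearizing the energy on the edge, half for enlarging
    the slope; \<open>C\<close> and \<open>k\<close> convert between \<open>norm\<close>,
    \<open>nrm\<close> and the dual norm.\<close>
  define e where "e = min (\<eta> / 2) (\<eta> / (2 * C) / k)"
  have e: "0 < e" "e \<le> \<eta> / 2" "k * e \<le> \<eta> / (2 * C)"
    using assms k(1) C(1) by (auto simp: e_def min_def field_simps)
  have "compact ({0..T} \<times> cball (0::'a) B)" by (intro compact_Times compact_cball compact_Icc)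
  then have "uniformly_continuous_on ({0..T} \<times> cball 0 B) (\<lambda>(t, x). dx E t x)"
    by (intro compact_uniformly_continuous continuous_on_subset[OF dx_continuous]) auto
  then obtain d where d: "0 < d" "\<And>z z'. z \<in> {0..T} \<times> cball 0 B \<Longrightarrow> z' \<in> {0..T} \<times> cball 0 B \<Longrightarrow> dist z' z < d
      \<Longrightarrow> dist (case z' of (t, x) \<Rightarrow> dx E t x) (case z of (t, x) \<Rightarrow> dx E t x) < e"
    using e(1) unfolding uniformly_continuous_on_def by metis
  have uc: "norm (dx E t' y - dx E t q) \<le> e"
    if "t \<in> {0..T}" "t' \<in> {0..T}" "\<bar>t' - t\<bar> < d / 2" "norm y \<le> B" "norm q \<le> B" "norm (y - q) < d / 2" for t t' y q
  proof -
    have "dist (t', y) (t, q) \<le> \<bar>t' - t\<bar> + norm (y - q)"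
      using norm_Pair_le[of "t' - t" "y - q"] by (simp add: dist_norm)
    then have "dist (t', y) (t, q) < d" using that by simp
    then show ?thesis using d(2)[of "(t, q)" "(t', y)"] that by (simp add: dist_norm less_imp_le)
  qed
  show thesis
  proof (rule that[of "d / 2"])
    show "0 < d / 2" using d(1) by simp
    fix t t' p q
    assume t: "t \<in> {0..T}" "t' \<in> {0..T}" "\<bar>t - t'\<bar> < d / 2" and pq: "norm p \<le> B" "norm q \<le> B" "norm (q - p) < d / 2"
      and opt: "\<Psi> (q - p) + nrm (q - p) * slope (dx E t q) \<le> - blinfun_apply (dx E t q) (q - p)"
    have seg: "norm y \<le> B" "norm (y - q) < d / 2" if "y \<in> closed_segment p q" for y
    proof -
      show "norm y \<le> B" using closed_segment_ball[OF that pq(1,2)] .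
      have "norm (y - q) \<le> norm (p - q)" using segment_bound(2)[OF that] by (simp add: norm_minus_commute)
      then show "norm (y - q) < d / 2" using pq(3) by (simp add: norm_minus_commute)
    qed
    define b where "b = slope (dx E t q) + \<eta> / (2 * C)"
    have "0 \<le> b" using slope_nonneg assms C(1) by (simp add: b_def)
    moreover have "slope (dx E t' y) \<le> b" if "y \<in> closed_segment p q" for y
    proof -
      have "slope (dx E t' y) \<le> slope (dx E t q) + dual_norm nrm (dx E t' y - dx E t q)" by (rule slope_diff)
      also have "dual_norm nrm (dx E t' y - dx E t q) \<le> k * norm (dx E t' y - dx E t q)" by (rule k(2))
      also have "\<dots> \<le> k * e"
        using uc[of t t' y q] t pq seg[OF that] k(1) by (intro mult_left_mono) (auto simp: abs_minus_commute)
      finally show ?thesis using e(3) by (simp add: b_def)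
    qed
    moreover have "\<Psi> (q - p) + nrm (q - p) * b \<le> E t p - E t q + \<eta> * norm (q - p)"
    proof -
      \<comment> \<open>The energy minus its linearization at \<open>q\<close>: its gradient is at
        most \<open>e\<close> along the edge.\<close>
      define f where "f y = E t y - blinfun_apply (dx E t q) y" for y
      have "norm (f q - f p) \<le> e * norm (q - p)"
      proof (rule differentiable_bound[where f' = "\<lambda>y. blinfun_apply (dx E t y - dx E t q)"])
        show "convex (closed_segment p q)" by simp
        show "(f has_derivative blinfun_apply (dx E t y - dx E t q)) (at y within closed_segment p q)" for y
          unfolding f_def blinfun.diff_left
          by (intro has_derivative_diff has_derivative_at_withinI[OF E_dx[OF t(1)]]
              bounded_linear.has_derivative[OF blinfun.bounded_linear_right has_derivative_ident])
        show "onorm (blinfun_apply (dx E t y - dx E t q)) \<le> e" if "y \<in> closed_segment p q" for y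
          using uc[of t t y q] t(1) pq seg[OF that] d(1) by (simp add: norm_blinfun.rep_eq[symmetric])
      qed simp_all
      then have "f q - f p \<le> e * norm (q - p)" by simp
      then have "- blinfun_apply (dx E t q) (q - p) \<le> E t p - E t q + e * norm (q - p)"
        by (simp add: f_def blinfun.diff_right)
      moreover have "nrm (q - p) * (\<eta> / (2 * C)) \<le> \<eta> / 2 * norm (q - p)"
      proof -
        have "nrm (q - p) * (\<eta> / (2 * C)) \<le> (C * norm (q - p)) * (\<eta> / (2 * C))"
          using C assms by (intro mult_right_mono) auto
        then show ?thesis using C(1) by (simp add: field_simps)
      qed
      moreover have "e * norm (q - p) \<le> \<eta> / 2 * norm (q - p)" using e(2) by (intro mult_right_mono) auto
      moreover have "nrm (q - p) * b = nrm (q - p) * slope (dx E t q) + nrm (q - p) * (\<eta> / (2 * C))"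
        unfolding b_def by (rule distrib_left)
      moreover have "\<eta> * norm (q - p) = \<eta> / 2 * norm (q - p) + \<eta> / 2 * norm (q - p)" by simp
      ultimately show ?thesis using opt by linarith
    qed
    ultimately show "\<exists>b\<ge>0. (\<forall>y\<in>closed_segment p q. slope (dx E t' y) \<le> b) \<and>
           \<Psi> (q - p) + nrm (q - p) * b \<le> E t p - E t q + \<eta> * norm (q - p)" by blast
  qed
qed

text \<open>The points \<open>p\<close> and \<open>q\<close> do not depend on the curve, and neither
  does the left-hand side. Only \<open>\<Psi>\<close> and \<open>G\<close> have to converge when the
  curve varies, which makes the estimate closed under pointwise limits.\<close>

definition Delta_bound :: "real \<Rightarrow> real \<Rightarrow> real \<Rightarrow> real \<Rightarrow> (real \<Rightarrow> 'a) \<Rightarrow> bool" where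
  "Delta_bound K B \<eta> \<delta> x \<longleftrightarrow> (\<forall>s r t p q. 0 \<le> s \<and> s \<le> r \<and> r \<le> t \<and> t \<le> T \<and> t - s < \<delta> \<and> norm p \<le> B \<and> norm q \<le> B \<longrightarrow>
     Delta r p q \<le> ereal (K * \<Psi> (x s - p) + G x s t + \<eta> + K * \<Psi> (q - x t)))"

text \<open>Order of the quantifiers: \<open>K\<close> serves all \<eta>, and \<delta> depends on
  neither \<epsilon> nor \<tau>. The step size \<tau> need not be small, as only steps taken inside
  the time window enter.\<close>

lemma discretized_Delta_bound:
  assumes B: "\<And>x t. \<lbrakk>admissible a (energy_bound a) x; t \<in> {0..T}\<rbrakk> \<Longrightarrow> norm (x t) \<le> B"
  obtains K where "\<And>\<eta>. 0 < \<eta> \<Longrightarrow> \<exists>\<delta>>0. \<forall>\<epsilon> \<tau> x. 0 < \<epsilon> \<and> \<epsilon> < \<delta> \<and> 0 < \<tau> \<and> discretized_solution nrm T E \<Psi> a \<epsilon> \<tau> x \<longrightarrow>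
      Delta_bound K B \<eta> \<delta> x"
proof -
  let ?M = "energy_bound a"
  obtain K0 where K0: "0 \<le> K0" "\<And>t y. \<lbrakk>t \<in> {0..T}; norm y \<le> B\<rbrakk> \<Longrightarrow> slope (dx E t y) \<le> K0"
    using slope_bounded by metis
  obtain C where C: "0 < C" "\<And>v. nrm v \<le> C * norm v" using nrm_bounds by metis
  obtain c' where c': "0 < c'" "\<And>v. c' * norm v \<le> nrm v" using nrm_bounds by metis
  obtain c where c: "0 < c" "\<And>v. c * norm v \<le> \<Psi> v" using \<Psi>_bounds by metis
  define K where "K = 1 + C / c * K0"
  have K: "\<Psi> v + nrm v * K0 \<le> K * \<Psi> v" for v
  proof -
    have "nrm v \<le> C * norm v" by (rule C(2))
    also have "\<dots> \<le> C * (\<Psi> v / c)"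
      using c C(1) by (intro mult_left_mono) (auto simp: field_simps)
    finally have "nrm v * K0 \<le> C * (\<Psi> v / c) * K0" using K0(1) by (intro mult_right_mono)
    then show ?thesis by (simp add: K_def algebra_simps)
  qed
  have "\<exists>\<delta>>0. \<forall>\<epsilon> \<tau> x. 0 < \<epsilon> \<and> \<epsilon> < \<delta> \<and> 0 < \<tau> \<and> discretized_solution nrm T E \<Psi> a \<epsilon> \<tau> x \<longrightarrow> Delta_bound K B \<eta> \<delta> x"
    if "0 < \<eta>" for \<eta>
  proof -
    \<comment> \<open>Bounds the length of every discrete path through its total released energy;
      the error per unit length is therefore \<open>\<eta> / (A + 1)\<close>.\<close>
    define A where "A = (?M + \<bar>lam\<bar> * ?M * T) / c"
    have "0 \<le> ?M" using E_nonneg[of 0 a] T_pos by (simp add: energy_bound_def)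
    then have "0 \<le> A" using c(1) T_pos by (simp add: A_def)
    define \<eta>' where "\<eta>' = \<eta> / (A + 1)"
    have \<eta>': "0 < \<eta>'" "\<eta>' * A \<le> \<eta>" using \<open>0 < \<eta>\<close> \<open>0 \<le> A\<close> by (auto simp: \<eta>'_def field_simps)
    obtain d where d: "0 < d"
      "\<And>t t' p q. \<lbrakk>t \<in> {0..T}; t' \<in> {0..T}; \<bar>t - t'\<bar> < d; norm p \<le> B; norm q \<le> B; norm (q - p) < d;
         \<Psi> (q - p) + nrm (q - p) * slope (dx E t q) \<le> - blinfun_apply (dx E t q) (q - p)\<rbrakk>
       \<Longrightarrow> \<exists>b\<ge>0. (\<forall>y\<in>closed_segment p q. slope (dx E t' y) \<le> b) \<and>
             \<Psi> (q - p) + nrm (q - p) * b \<le> E t p - E t q + \<eta>' * norm (q - p)"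
      using step_cost[OF \<eta>'(1), of B] by blast
    \<comment> \<open>The first entry limits the time window; the second makes steps with
      \<open>nrm\<close> at most \<epsilon> shorter than \<open>d\<close> in the Euclidean
      norm.\<close>
    define \<delta> where "\<delta> = min d (c' * d)"
    have "0 < \<delta>" using d(1) c'(1) by (simp add: \<delta>_def)
    have "Delta_bound K B \<eta> \<delta> x"
      if h: "0 < \<epsilon>" "\<epsilon> < \<delta>" "0 < \<tau>" "discretized_solution nrm T E \<Psi> a \<epsilon> \<tau> x" for \<epsilon> \<tau> x
      unfolding Delta_bound_def
    proof (intro allI impI)
      fix s r t :: real and p q :: 'a
      assume "0 \<le> s \<and> s \<le> r \<and> r \<le> t \<and> t \<le> T \<and> t - s < \<delta> \<and> norm p \<le> B \<and> norm q \<le> B"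
      then have st: "0 \<le> s" "s \<le> r" "r \<le> t" "t \<le> T" "t - s < d" and pq: "norm p \<le> B" "norm q \<le> B"
        by (auto simp: \<delta>_def)
      have adm: "admissible a ?M x" by (rule discretized_admissible[OF h(1,3,4)])
      obtain y where y: "y 0 = a" "scheme \<epsilon> \<tau> (grid_index \<tau> T) y" "\<And>t. t \<in> {0..T} \<Longrightarrow> x t = y (grid_index \<tau> t)"
        using h(4) unfolding discretized_solution_iff[OF h(3)] by blast
      let ?N = "grid_index \<tau> T" and ?k = "grid_index \<tau> s" and ?l = "grid_index \<tau> t"
      have kl: "?k \<le> ?l" "?l \<le> ?N" using st by (auto intro!: grid_index_mono[OF h(3)])
      have yB: "norm (y i) \<le> B" if "i \<le> ?N" for i
      proof -
        have "real i * \<tau> \<in> {0..T}" by (rule grid_le[OF h(1,3) refl y(2,3) that])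
        moreover have "x (real i * \<tau>) = y i" by (rule x_grid[OF h(1,3) refl y(2,3) that])
        ultimately show ?thesis using B[OF adm, of "real i * \<tau>"] by simp
      qed
      let ?e = "\<lambda>i. E (real (Suc i) * \<tau>) (y i) - E (real (Suc i) * \<tau>) (y (Suc i))"
      have "\<exists>b\<ge>0. (\<forall>z\<in>closed_segment (y i) (y (Suc i)). slope (dx E r z) \<le> b) \<and>
          \<Psi> (y (Suc i) - y i) + nrm (y (Suc i) - y i) * b \<le> ?e i + \<eta>' * norm (y (Suc i) - y i)"
        if i: "?k \<le> i" "i < ?l" for i
      proof (rule d(2))
        have iN: "i < ?N" "Suc i \<le> ?N" using i kl by auto
        show T: "real (Suc i) * \<tau> \<in> {0..T}" by (rule grid_le[OF h(1,3) refl y(2,3) iN(2)])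
        show "r \<in> {0..T}" using st by auto
        have "real (Suc ?k) * \<tau> \<le> real (Suc i) * \<tau>" "real (Suc i) * \<tau> \<le> real ?l * \<tau>"
          using i h(3) by (intro mult_right_mono; simp)+
        then have "s < real (Suc i) * \<tau>" "real (Suc i) * \<tau> \<le> t"
          using grid_index_bounds(2)[OF h(3) st(1)] grid_index_bounds(1)[OF h(3), of t] st by linarith+
        then show "\<bar>real (Suc i) * \<tau> - r\<bar> < d" using st by linarith
        show "norm (y i) \<le> B" "norm (y (Suc i)) \<le> B" using yB iN by auto
        have step: "nrm (y (Suc i) - y i) \<le> \<epsilon>" and min: "\<And>z. nrm (z - y i) \<le> \<epsilon> \<Longrightarrow>
            E (real (Suc i) * \<tau>) (y (Suc i)) + \<Psi> (y (Suc i) - y i) \<le> E (real (Suc i) * \<tau>) z + \<Psi> (z - y i)"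
          using y(2)[unfolded scheme_def, rule_format, OF iN(1)] by auto
        have "c' * norm (y (Suc i) - y i) < c' * d"
          using c'(2)[of "y (Suc i) - y i"] step h(2) by (simp add: \<delta>_def)
        then show "norm (y (Suc i) - y i) < d" using c'(1) by simp
        show "\<Psi> (y (Suc i) - y i) + nrm (y (Suc i) - y i) * slope (dx E (real (Suc i) * \<tau>) (y (Suc i)))
            \<le> - blinfun_apply (dx E (real (Suc i) * \<tau>) (y (Suc i))) (y (Suc i) - y i)"
          by (rule incremental_slope[OF T h(1) step min])
      qed
      then obtain bb where bb: "\<And>i. ?k \<le> i \<Longrightarrow> i < ?l \<Longrightarrow> 0 \<le> bb i"
        "\<And>i z. ?k \<le> i \<Longrightarrow> i < ?l \<Longrightarrow> z \<in> closed_segment (y i) (y (Suc i)) \<Longrightarrow> slope (dx E r z) \<le> bb i"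
        "\<And>i. ?k \<le> i \<Longrightarrow> i < ?l \<Longrightarrow> \<Psi> (y (Suc i) - y i) + nrm (y (Suc i) - y i) * bb i \<le> ?e i + \<eta>' * norm (y (Suc i) - y i)"
        by metis
      define m where "m = ?l - ?k"
      have km: "?k + m = ?l" using kl by (simp add: m_def)
      \<comment> \<open>The polygon runs from \<open>p\<close> through the discrete states in the
        window to \<open>q\<close>. Only its first and last edges are not steps of the scheme; there
        the crude bound \<open>K0\<close> is used.\<close>
      define P where "P i = (case i of 0 \<Rightarrow> p | Suc j \<Rightarrow> if j \<le> m then y (?k + j) else q)" for i
      define b where "b i = (case i of 0 \<Rightarrow> K0 | Suc j \<Rightarrow> if j < m then bb (?k + j) else K0)" for i
      have shift: "(\<Sum>j<m. f (?k + j)) = (\<Sum>i\<in>{?k..<?l}. f i)" for f :: "nat \<Rightarrow> real"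
        using sum.shift_bounds_nat_ivl[of f 0 ?k m] km by (simp add: add.commute lessThan_atLeast0)
      have xs: "x s = y ?k" "x t = y ?l" using y(3) st by auto
      have P: "P 0 = p" "P (Suc 0) = x s" "P (Suc m) = x t" "P (Suc (Suc m)) = q"
        "\<And>j. j < m \<Longrightarrow> P (Suc j) = y (?k + j)" "\<And>j. j < m \<Longrightarrow> P (Suc (Suc j)) = y (Suc (?k + j))"
        using xs km by (auto simp: P_def)
      have b: "b 0 = K0" "b (Suc m) = K0" "\<And>j. j < m \<Longrightarrow> b (Suc j) = bb (?k + j)"
        by (auto simp: b_def)
      have xB: "norm (x s) \<le> B" "norm (x t) \<le> B" using B[OF adm] st by auto
      have rT: "r \<in> {0..T}" using st by auto
      have "Delta r (P 0) (P (Suc (Suc m))) \<le> ereal (\<Sum>i<Suc (Suc m). \<Psi> (P (Suc i) - P i) + nrm (P (Suc i) - P i) * b i)"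
      proof (rule Delta_polygon)
        fix i assume i: "i < Suc (Suc m)"
        consider "i = 0" | j where "i = Suc j" "j < m" | "i = Suc m"
          using i by (cases i) force+
        note cases = this
        from cases show "0 \<le> b i"
          using K0(1) bb(1) km by cases (auto simp: b)
        fix z assume z: "z \<in> closed_segment (P i) (P (Suc i))"
        from cases show "slope (dx E r z) \<le> b i"
        proof cases
          case 1 then show ?thesis using z closed_segment_ball[of z p "x s" B] pq xB K0(2)[OF rT] by (simp add: P b)
        next
          case (2 j) then show ?thesis using z bb(2)[of "?k + j" z] km by (simp add: P b)
        next
          case 3 then show ?thesis using z closed_segment_ball[of z "x t" q B] pq xB K0(2)[OF rT] by (simp add: P b)
        qed
      qed simp
      also have "(\<Sum>i<Suc (Suc m). \<Psi> (P (Suc i) - P i) + nrm (P (Suc i) - P i) * b i) =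
          (\<Psi> (x s - p) + nrm (x s - p) * K0) +
          (\<Sum>j<m. \<Psi> (P (Suc (Suc j)) - P (Suc j)) + nrm (P (Suc (Suc j)) - P (Suc j)) * b (Suc j)) +
          (\<Psi> (q - x t) + nrm (q - x t) * K0)"
        by (subst sum.lessThan_Suc_shift, subst sum.lessThan_Suc) (simp add: P b)
      also have "(\<Sum>j<m. \<Psi> (P (Suc (Suc j)) - P (Suc j)) + nrm (P (Suc (Suc j)) - P (Suc j)) * b (Suc j))
          \<le> (\<Sum>j<m. ?e (?k + j) + \<eta>' * norm (y (Suc (?k + j)) - y (?k + j)))"
      proof (rule sum_mono)
        fix j assume "j \<in> {..<m}"
        then have j: "j < m" by simp
        show "\<Psi> (P (Suc (Suc j)) - P (Suc j)) + nrm (P (Suc (Suc j)) - P (Suc j)) * b (Suc j)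
            \<le> ?e (?k + j) + \<eta>' * norm (y (Suc (?k + j)) - y (?k + j))"
          unfolding P(5)[OF j] P(6)[OF j] b(3)[OF j] by (rule bb(3)) (use km j in linarith)+
      qed
      also have "\<dots> = (\<Sum>i\<in>{?k..<?l}. ?e i + \<eta>' * norm (y (Suc i) - y i))"
        by (rule shift)
      also have "\<dots> = G x s t + \<eta>' * (\<Sum>i\<in>{?k..<?l}. norm (y (Suc i) - y i))"
        using G_discrete[OF h(1,3) refl y(2,3) st(1) _ st(4)] st by (simp add: sum.distrib sum_distrib_left)
      also have "\<dots> \<le> G x s t + \<eta>"
      proof -
        have "c * (\<Sum>i\<in>{?k..<?l}. norm (y (Suc i) - y i)) \<le> (\<Sum>i\<in>{?k..<?l}. ?e i)"
          unfolding sum_distrib_left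
        proof (rule sum_mono)
          fix i assume "i \<in> {?k..<?l}"
          then have "i < ?N" using kl by auto
          from step_energy[OF h(1,3) refl y(2,3) this] c(2)[of "y (Suc i) - y i"]
          show "c * norm (y (Suc i) - y i) \<le> ?e i" by simp
        qed
        also have "\<dots> = G x s t" using G_discrete[OF h(1,3) refl y(2,3) st(1) _ st(4)] st by simp
        also have "\<dots> \<le> ?M + \<bar>lam\<bar> * ?M * T"
          using G_le[OF admissibleD(2,3)[OF adm], of s t] st by simp
        finally have "(\<Sum>i\<in>{?k..<?l}. norm (y (Suc i) - y i)) \<le> A"
          using c(1) by (simp add: A_def field_simps)
        then have "\<eta>' * (\<Sum>i\<in>{?k..<?l}. norm (y (Suc i) - y i)) \<le> \<eta>' * A" using \<eta>'(1) by (intro mult_left_mono) auto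
        then show ?thesis using \<eta>'(2) by simp
      qed
      finally have "Delta r p q \<le> ereal (\<Psi> (x s - p) + nrm (x s - p) * K0 + (G x s t + \<eta>) + (\<Psi> (q - x t) + nrm (q - x t) * K0))"
        by (simp add: P)
      also have "\<dots> \<le> ereal (K * \<Psi> (x s - p) + G x s t + \<eta> + K * \<Psi> (q - x t))"
        using K[of "x s - p"] K[of "q - x t"] by simp
      finally show "Delta r p q \<le> ereal (K * \<Psi> (x s - p) + G x s t + \<eta> + K * \<Psi> (q - x t))" .
    qed
    then show ?thesis using \<open>0 < \<delta>\<close> by blast
  qed
  then show thesis using that by blast
qed

text \<open>Used for both passages, \<tau> to 0 at fixed \<epsilon> and then \<epsilon> to
  0.\<close>

lemma Delta_bound_limit:
  assumes adm: "\<And>n. admissible a M (z n)" and lim: "\<And>t. t \<in> {0..T} \<Longrightarrow> (\<lambda>n. z n t) \<longlonglongrightarrow> u t"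
    and ev: "\<forall>\<^sub>F n in sequentially. Delta_bound K B \<eta> \<delta> (z n)"
  shows "Delta_bound K B \<eta> \<delta> u"
  unfolding Delta_bound_def
proof (intro allI impI)
  fix s r t :: real and p q :: 'a
  assume h: "0 \<le> s \<and> s \<le> r \<and> r \<le> t \<and> t \<le> T \<and> t - s < \<delta> \<and> norm p \<le> B \<and> norm q \<le> B"
  have "(\<lambda>n. K * \<Psi> (z n s - p) + G (z n) s t + \<eta> + K * \<Psi> (q - z n t))
      \<longlonglongrightarrow> K * \<Psi> (u s - p) + G u s t + \<eta> + K * \<Psi> (q - u t)"
    using h by (intro tendsto_add tendsto_mult tendsto_const \<Psi>_tendsto tendsto_diff lim admissible_limit(2)[OF adm lim]) auto
  then have "(\<lambda>n. ereal (K * \<Psi> (z n s - p) + G (z n) s t + \<eta> + K * \<Psi> (q - z n t)))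
      \<longlonglongrightarrow> ereal (K * \<Psi> (u s - p) + G u s t + \<eta> + K * \<Psi> (q - u t))"
    by (rule tendsto_ereal)
  then show "Delta r p q \<le> ereal (K * \<Psi> (u s - p) + G u s t + \<eta> + K * \<Psi> (q - u t))"
  proof (rule tendsto_lowerbound)
    show "\<forall>\<^sub>F n in sequentially. Delta r p q \<le> ereal (K * \<Psi> (z n s - p) + G (z n) s t + \<eta> + K * \<Psi> (q - z n t))"
      using ev by eventually_elim (use h in \<open>auto simp: Delta_bound_def\<close>)
  qed simp
qed

end

context admissible_curve
begin

text \<open>The window shrinks to \<open>r\<close> from the left with \<open>p = L r\<close> and
  \<open>q = x r\<close>: the mismatch term tends to 0 and the released energy to the energy drop of
  the jump.\<close>

lemma jump_energy_left:
  assumes bound: "\<And>\<eta>. 0 < \<eta> \<Longrightarrow> \<exists>\<delta>>0. Delta_bound K B \<eta> \<delta> x"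
    and r: "0 < r" "r \<le> T" and B: "norm (L r) \<le> B" "norm (x r) \<le> B"
  shows "dl r \<le> E r (L r) - E r (x r)"
proof (rule field_le_epsilon)
  fix \<eta> :: real assume "0 < \<eta>"
  then obtain \<delta> where \<delta>: "0 < \<delta>" "Delta_bound K B \<eta> \<delta> x" using bound by blast
  have "((\<lambda>s. K * \<Psi> (x s - L r) + G x s r + \<eta>) \<longlongrightarrow> K * \<Psi> (L r - L r) + (E r (L r) - E r (x r)) + \<eta>) (at_left r)"
    by (intro tendsto_add tendsto_mult tendsto_const \<Psi>_tendsto tendsto_diff left_limit[OF r]
        G_left_limit[OF adm r left_limit[OF r]])
  then have "dl r \<le> K * \<Psi> (L r - L r) + (E r (L r) - E r (x r)) + \<eta>"
  proof (rule tendsto_lowerbound)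
    have "max 0 (r - \<delta>) < r" using r(1) \<delta>(1) by simp
    from eventually_at_left_real[OF this]
    show "\<forall>\<^sub>F s in at_left r. dl r \<le> K * \<Psi> (x s - L r) + G x s r + \<eta>"
    proof eventually_elim
      case (elim s)
      then have "Delta r (L r) (x r) \<le> ereal (K * \<Psi> (x s - L r) + G x s r + \<eta> + K * \<Psi> (x r - x r))"
        using \<delta>(2)[unfolded Delta_bound_def, rule_format, of s r r "L r" "x r"] r B by auto
      then show ?case using r by (simp add: Delta_dl)
    qed
  qed simp
  then show "dl r \<le> E r (L r) - E r (x r) + \<eta>" by simp
qed

lemma jump_energy_right:
  assumes bound: "\<And>\<eta>. 0 < \<eta> \<Longrightarrow> \<exists>\<delta>>0. Delta_bound K B \<eta> \<delta> x"
    and r: "0 \<le> r" "r < T" and B: "norm (R r) \<le> B" "norm (x r) \<le> B"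
  shows "dr r \<le> E r (x r) - E r (R r)"
proof (rule field_le_epsilon)
  fix \<eta> :: real assume "0 < \<eta>"
  then obtain \<delta> where \<delta>: "0 < \<delta>" "Delta_bound K B \<eta> \<delta> x" using bound by blast
  have "((\<lambda>s. G x r s + \<eta> + K * \<Psi> (R r - x s)) \<longlongrightarrow> (E r (x r) - E r (R r)) + \<eta> + K * \<Psi> (R r - R r)) (at_right r)"
    by (intro tendsto_add tendsto_mult tendsto_const \<Psi>_tendsto tendsto_diff right_limit[OF r]
        G_right_limit[OF adm r right_limit[OF r]])
  then have "dr r \<le> (E r (x r) - E r (R r)) + \<eta> + K * \<Psi> (R r - R r)"
  proof (rule tendsto_lowerbound)
    have "r < min T (r + \<delta>)" using r(2) \<delta>(1) by simp
    from eventually_at_right_real[OF this]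
    show "\<forall>\<^sub>F s in at_right r. dr r \<le> G x r s + \<eta> + K * \<Psi> (R r - x s)"
    proof eventually_elim
      case (elim s)
      then have "Delta r (x r) (R r) \<le> ereal (K * \<Psi> (x r - x r) + G x r s + \<eta> + K * \<Psi> (R r - x s))"
        using \<delta>(2)[unfolded Delta_bound_def, rule_format, of r r s "x r" "R r"] r B by auto
      then show ?case using r by (simp add: Delta_dr)
    qed
  qed simp
  then show "dr r \<le> E r (x r) - E r (R r) + \<eta>" by simp
qed

context
  assumes left: "\<And>r. \<lbrakk>0 < r; r \<le> T\<rbrakk> \<Longrightarrow> dl r \<le> E r (L r) - E r (x r)"
    and right: "\<And>r. \<lbrakk>0 \<le> r; r < T\<rbrakk> \<Longrightarrow> dr r \<le> E r (x r) - E r (R r)"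
begin

text \<open>The interval is cut at times approaching \<open>s\<close> and \<open>t\<close> from
  inside. The outer pieces release the full transition costs, the middle one at least \<Psi>;
  replacing three increments by one leaves the excesses \<open>jr s\<close> and
  \<open>jl t\<close>.\<close>

lemma G_ge_jumps:
  assumes st: "0 \<le> s" "s < t" "t \<le> T"
  shows "\<Psi> (x t - x s) + jr s + jl t \<le> G x s t"
proof -
  have t: "0 < t" "s < T" using st by auto
  have split: "G x s p + \<Psi> (x q - x p) + G x q t \<le> G x s t" if "s < p" "p < q" "q < t" for p q
  proof -
    have "G x s p + G x p q = G x s q" "G x s q + G x q t = G x s t"
      using that st by (intro G_add[OF admissibleD(2,3)[OF adm]]; simp)+
    moreover have "\<Psi> (x q - x p) \<le> G x p q" using that st by (intro admissibleD(4)[OF adm]) auto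
    ultimately show ?thesis by linarith
  qed
  have "G x s p + \<Psi> (L t - x p) + (E t (L t) - E t (x t)) \<le> G x s t" if p: "s < p" "p < t" for p
  proof (rule tendsto_upperbound)
    show "((\<lambda>q. G x s p + \<Psi> (x q - x p) + G x q t) \<longlongrightarrow> G x s p + \<Psi> (L t - x p) + (E t (L t) - E t (x t))) (at_left t)"
      using t st by (intro tendsto_add tendsto_const \<Psi>_tendsto tendsto_diff left_limit G_left_limit[OF adm]) auto
    show "\<forall>\<^sub>F q in at_left t. G x s p + \<Psi> (x q - x p) + G x q t \<le> G x s t"
      using eventually_at_left_real[OF p(2)] by eventually_elim (use p split in auto)
  qed simp
  note step = this
  have "(E s (x s) - E s (R s)) + \<Psi> (L t - R s) + (E t (L t) - E t (x t)) \<le> G x s t"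
  proof (rule tendsto_upperbound)
    show "((\<lambda>p. G x s p + \<Psi> (L t - x p) + (E t (L t) - E t (x t))) \<longlongrightarrow>
        (E s (x s) - E s (R s)) + \<Psi> (L t - R s) + (E t (L t) - E t (x t))) (at_right s)"
      using t st by (intro tendsto_add tendsto_const \<Psi>_tendsto tendsto_diff right_limit G_right_limit[OF adm]) auto
    show "\<forall>\<^sub>F p in at_right s. G x s p + \<Psi> (L t - x p) + (E t (L t) - E t (x t)) \<le> G x s t"
      using eventually_at_right_real[OF st(2)] by eventually_elim (use step in auto)
  qed simp
  moreover have "\<Psi> (x t - x s) \<le> \<Psi> (R s - x s) + \<Psi> (L t - R s) + \<Psi> (x t - L t)"
    using \<Psi>_triangle[of "R s - x s" "L t - R s"] \<Psi>_triangle[of "L t - x s" "x t - L t"] by simp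
  moreover have "dr s \<le> E s (x s) - E s (R s)" "dl t \<le> E t (L t) - E t (x t)"
    using left right st t by auto
  ultimately show ?thesis unfolding jl_def jr_def by linarith
qed

lemma G_ge_D_jumps:
  assumes st: "0 \<le> s" "s < t" "t \<le> T"
  shows "jr s + jl t \<le> G x s t - D s t"
proof -
  \<comment> \<open>The corrections are charged only to the partition cell that starts at
    \<open>s\<close> and the one that ends at \<open>t\<close>; all others use \<Psi> alone.\<close>
  define \<phi> where "\<phi> r = G x s r - (if s < r then jr s else 0) - (if t \<le> r then jl t else 0)" for r
  have "D s t \<le> \<phi> t - \<phi> s"
  proof (rule diss.D_le)
    fix p q assume pq: "s \<le> p" "p < q" "q \<le> t"
    have "G x s p + G x p q = G x s q"
      using pq st by (intro G_add[OF admissibleD(2,3)[OF adm]]) auto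
    moreover have "\<Psi> (x q - x p) + jr p + jl q \<le> G x p q" using pq st by (intro G_ge_jumps) auto
    moreover have "0 \<le> jr p" "0 \<le> jl q" using pq st by (auto intro!: jr_nonneg jl_nonneg)
    moreover have "p = s \<or> s < p" "q = t \<or> q < t" "p < t" "s < q" using pq by auto
    ultimately show "\<Psi> (x q - x p) \<le> \<phi> q - \<phi> p"
      unfolding \<phi>_def by auto
  qed (use st in auto)
  then show ?thesis using st by (simp add: \<phi>_def)
qed

text \<open>\<open>G - D\<close> is additive and dominates the end jumps of each interval, so it
  dominates all finite jump sums and hence the infinite one.\<close>

lemma Diss_new_le_G:
  assumes st: "0 \<le> s" "s \<le> t" "t \<le> T"
  shows "D s t + S s t \<le> G x s t"
proof (cases "s = t")
  case False
  then have st': "s < t" using st by simp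
  have sums: "jr s + jl t + (\<Sum>r\<in>F. jl r + jr r) \<le> G x s t - D s t" if "finite F" "F \<subseteq> J \<inter> {s<..<t}" for F
  proof (rule jump_sum_le[where W = "\<lambda>s t. G x s t - D s t" and T = T])
    show "(G x s r - D s r) + (G x r t - D r t) \<le> G x s t - D s t" if "0 \<le> s" "s < r" "r < t" "t \<le> T" for s r t
    proof -
      have "G x s r + G x r t = G x s t" using that by (intro G_add[OF admissibleD(2,3)[OF adm]]) auto
      then show ?thesis using diss.D_add[of s r t] that by simp
    qed
  qed (use that st st' G_ge_D_jumps in auto)
  have "(\<Sum>\<^sub>\<infinity>r\<in>J \<inter> {s<..<t}. jl r + jr r) \<le> G x s t - D s t - jr s - jl t"
  proof (rule infsum_le_finite_sums)
    show "(\<lambda>r. jl r + jr r) summable_on J \<inter> {s<..<t}" using jumps_summable(3)[OF st(1) st' st(3)] by simp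
    show "(\<Sum>r\<in>F. jl r + jr r) \<le> G x s t - D s t - jr s - jl t" if "finite F" "F \<subseteq> J \<inter> {s<..<t}" for F
      using sums[OF that] by linarith
  qed
  then show ?thesis using st' by (simp add: S_def)
qed simp

end

end

section \<open>Solutions constructed by epsilon-neighborhoods\<close>

context rate_independent
begin

lemma eps_solution_stable_points:
  assumes "0 < \<epsilon>" "\<And>\<tau>. 0 < \<tau> \<Longrightarrow> discretized_solution nrm T E \<Psi> a \<epsilon> \<tau> (Y \<tau>)"
    and "eps_neighborhood_solution T Y x" "s \<in> {0<..<T} - jump_set T x"
  shows "stable s (x s)"
proof -
  note adm = eps_solution_admissible[OF assms(1-3)]
  have "(x \<longlongrightarrow> right_lim x s) (at_right s)" "right_lim x s = x s"
    using admissible_regulated(1,5)[OF adm, of s] assms(4) by auto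
  then have cont: "(x \<longlongrightarrow> x s) (at_right s)" by simp
  show ?thesis
    unfolding stable_def
  proof (rule local_min_stable)
    show "E s (x s) \<le> E s y + \<Psi> (y - x s)" if "nrm (y - x s) \<le> \<epsilon>" for y
      using assms(4) by (intro eps_solution_stable[OF assms(1-3) _ _ cont that]) auto
  qed (use assms in auto)
qed

lemma eps_solution_properties:
  assumes "0 < \<epsilon>" "\<And>\<tau>. 0 < \<tau> \<Longrightarrow> discretized_solution nrm T E \<Psi> a \<epsilon> \<tau> (Y \<tau>)"
    and "eps_neighborhood_solution T Y x"
  shows "Diss \<Psi> x 0 T \<le> ereal (energy_bound a + \<bar>lam\<bar> * energy_bound a * T)"
    and "set_integrable lebesgue {0<..<T} (\<lambda>r. dt T E r (x r))"
    and "\<lbrakk>0 \<le> s; s \<le> t; t \<le> T\<rbrakk> \<Longrightarrow> - Diss_new nrm T E \<Psi> x s t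
        \<le> ereal (E t (x t) - E s (x s) - (LINT r:{s..t}|lebesgue. dt T E r (x r)))"
    and "\<lbrakk>0 \<le> s; s \<le> t; t \<le> T\<rbrakk> \<Longrightarrow>
        ereal (E t (x t) - E s (x s) - (LINT r:{s..t}|lebesgue. dt T E r (x r))) \<le> - Diss \<Psi> x s t"
proof -
  note adm = eps_solution_admissible[OF assms]
  interpret admissible_curve T lam nrm E \<Psi> a "energy_bound a" x by unfold_locales (rule adm)
  note x = admissibleD(2,3)[OF adm]
  show "Diss \<Psi> x 0 T \<le> ereal (energy_bound a + \<bar>lam\<bar> * energy_bound a * T)"
    using admissible_Diss[OF adm, of 0 T] G_le[OF x, of 0 T] T_pos by (auto elim: order_trans)
  show "set_integrable lebesgue {0<..<T} (\<lambda>r. dt T E r (x r))"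
    by (rule power_set_integrable[OF x]) auto
  assume st: "0 \<le> s" "s \<le> t" "t \<le> T"
  have eq: "E t (x t) - E s (x s) - (LINT r:{s..t}|lebesgue. dt T E r (x r)) = - G x s t"
    using power_integral_lebesgue[OF x st(1,3)] by (simp add: G_def)
  have "G x s t \<le> D s t + S s t"
    using admissible_regulated(3)[OF adm] eps_solution_stable_points[OF assms] st by (rule G_le_Diss_new)
  then show "- Diss_new nrm T E \<Psi> x s t \<le> ereal (E t (x t) - E s (x s) - (LINT r:{s..t}|lebesgue. dt T E r (x r)))"
    unfolding eq Diss_new_eq[OF st] by simp
  show "ereal (E t (x t) - E s (x s) - (LINT r:{s..t}|lebesgue. dt T E r (x r))) \<le> - Diss \<Psi> x s t"
    using admissible_Diss[OF adm st] unfolding eq diss.Diss_eq[OF st] by simp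
qed

lemma BV_solution_exists:
  assumes X: "\<And>\<epsilon> \<tau>. \<lbrakk>0 < \<epsilon>; 0 < \<tau>\<rbrakk> \<Longrightarrow> discretized_solution nrm T E \<Psi> a \<epsilon> \<tau> (X \<epsilon> \<tau>)"
    and x: "\<And>\<epsilon>. 0 < \<epsilon> \<Longrightarrow> eps_neighborhood_solution T (X \<epsilon>) (x \<epsilon>)"
  obtains \<epsilon> :: "nat \<Rightarrow> real" and u where "\<And>n. 0 < \<epsilon> n" "\<epsilon> \<longlonglongrightarrow> 0"
    "\<And>t. t \<in> {0..T} \<Longrightarrow> (\<lambda>n. x (\<epsilon> n) t) \<longlonglongrightarrow> u t" "BV_on 0 T u"
    "\<And>t. \<lbrakk>t \<in> {0..T}; continuous (at t within {0..T}) u\<rbrakk> \<Longrightarrow> - dx E t (u t) \<in> subdiff0 \<Psi>"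
    "\<And>s t. \<lbrakk>0 \<le> s; s \<le> t; t \<le> T\<rbrakk> \<Longrightarrow> ereal (E t (u t) - E s (u s)) =
       ereal (LINT r:{s..t}|lebesgue. dt T E r (u r)) - Diss_new nrm T E \<Psi> u s t"
proof -
  let ?M = "energy_bound a"
  let ?\<epsilon> = "\<lambda>n::nat. inverse (real (Suc n))"
  have x_adm: "admissible a ?M (x \<epsilon>)" if "0 < \<epsilon>" for \<epsilon>
    by (rule eps_solution_admissible[OF that X[OF that] x[OF that]])
  have "admissible a ?M (x (?\<epsilon> n))" for n by (rule x_adm) simp
  then obtain k u where k: "strict_mono k" and lim: "\<And>t. t \<in> {0..T} \<Longrightarrow> (\<lambda>n. x (?\<epsilon> (k n)) t) \<longlonglongrightarrow> u t"
    using admissible_selection[of a ?M "\<lambda>n. x (?\<epsilon> n)"] by auto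
  define \<epsilon> where "\<epsilon> n = ?\<epsilon> (k n)" for n
  have \<epsilon>: "0 < \<epsilon> n" for n by (simp add: \<epsilon>_def)
  have \<epsilon>_lim: "\<epsilon> \<longlonglongrightarrow> 0"
    using LIMSEQ_subseq_LIMSEQ[OF LIMSEQ_inverse_real_of_nat k] by (simp add: o_def \<epsilon>_def[abs_def])
  have u_lim: "(\<lambda>n. x (\<epsilon> n) t) \<longlonglongrightarrow> u t" if "t \<in> {0..T}" for t
    using lim[OF that] by (simp add: \<epsilon>_def)
  have u_adm: "admissible a ?M u"
    by (rule admissible_limit(1)[OF x_adm[OF \<epsilon>] u_lim])
  interpret admissible_curve T lam nrm E \<Psi> a ?M u by unfold_locales (rule u_adm)
  \<comment> \<open>Outside this set every approximating curve is stable at the given time. It may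
    contain continuity points of \<open>u\<close>; these are recovered from one-sided
    limits.\<close>
  define C where "C = (\<Union>n. jump_set T (x (\<epsilon> n)))"
  have C: "countable C"
    unfolding C_def by (intro countable_UN admissible_regulated(3)[OF x_adm[OF \<epsilon>]]) auto
  have stab: "stable s (u s)" if s: "s \<in> {0<..<T} - C" for s
  proof (rule stable_limit[OF tendsto_const u_lim])
    have "stable s (x (\<epsilon> n) s)" for n
      using s by (intro eps_solution_stable_points[OF \<epsilon> X[OF \<epsilon>] x[OF \<epsilon>]]) (auto simp: C_def)
    then show "\<exists>\<^sub>F n in sequentially. stable s (x (\<epsilon> n) s)" by simp
  qed (use s in auto)
  obtain B1 where B1: "\<And>x t. \<lbrakk>admissible a ?M x; t \<in> {0..T}\<rbrakk> \<Longrightarrow> norm (x t) \<le> B1"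
    using admissible_bounded[of a ?M] by blast
  obtain B2 where B2: "\<And>t. t \<in> {0..T} \<Longrightarrow> norm (u t) \<le> B2"
    "\<And>t. \<lbrakk>0 < t; t \<le> T\<rbrakk> \<Longrightarrow> norm (L t) \<le> B2" "\<And>t. \<lbrakk>0 \<le> t; t < T\<rbrakk> \<Longrightarrow> norm (R t) \<le> B2"
    using bounded_limits by blast
  \<comment> \<open>One radius must contain all discretized solutions and also the states of
    \<open>u\<close> between which transitions are estimated.\<close>
  define B where "B = max B1 B2"
  have "norm (x t) \<le> B" if "admissible a ?M x" "t \<in> {0..T}" for x t
    using B1[OF that] by (simp add: B_def)
  then obtain K where K: "\<And>\<eta>. 0 < \<eta> \<Longrightarrow> \<exists>\<delta>>0. \<forall>\<epsilon> \<tau> x. 0 < \<epsilon> \<and> \<epsilon> < \<delta> \<and> 0 < \<tau> \<and>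
      discretized_solution nrm T E \<Psi> a \<epsilon> \<tau> x \<longrightarrow> Delta_bound K B \<eta> \<delta> x"
    using discretized_Delta_bound[of a B] by blast
  have bound: "\<exists>\<delta>>0. Delta_bound K B \<eta> \<delta> u" if \<eta>: "0 < \<eta>" for \<eta>
  proof -
    obtain \<delta> where \<delta>: "0 < \<delta>" "\<And>\<epsilon> \<tau> x. \<lbrakk>0 < \<epsilon>; \<epsilon> < \<delta>; 0 < \<tau>; discretized_solution nrm T E \<Psi> a \<epsilon> \<tau> x\<rbrakk> \<Longrightarrow> Delta_bound K B \<eta> \<delta> x"
      using K[OF \<eta>] by blast
    have "Delta_bound K B \<eta> \<delta> (x e)" if e: "0 < e" "e < \<delta>" for e
    proof -
      obtain \<tau> :: "nat \<Rightarrow> real" where \<tau>: "\<And>n. 0 < \<tau> n" "\<And>t. t \<in> {0..T} \<Longrightarrow> (\<lambda>n. X e (\<tau> n) t) \<longlonglongrightarrow> x e t"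
        using x[OF e(1)] unfolding eps_neighborhood_solution_def by blast
      show ?thesis
      proof (rule Delta_bound_limit[OF discretized_admissible[OF e(1) \<tau>(1) X[OF e(1) \<tau>(1)]] \<tau>(2)])
        show "\<forall>\<^sub>F n in sequentially. Delta_bound K B \<eta> \<delta> (X e (\<tau> n))"
          by (intro always_eventually allI \<delta>(2)[OF e \<tau>(1) X[OF e(1) \<tau>(1)]])
      qed
    qed
    moreover have "\<forall>\<^sub>F n in sequentially. \<epsilon> n < \<delta>" using order_tendstoD(2)[OF \<epsilon>_lim \<delta>(1)] .
    ultimately have ev: "\<forall>\<^sub>F n in sequentially. Delta_bound K B \<eta> \<delta> (x (\<epsilon> n))"
      by (rule eventually_mono[rotated]) (rule \<epsilon>)
    have "Delta_bound K B \<eta> \<delta> u"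
      by (rule Delta_bound_limit[where z = "\<lambda>n. x (\<epsilon> n)", OF x_adm[OF \<epsilon>] u_lim ev])
    then show ?thesis using \<delta>(1) by blast
  qed
  have left: "dl r \<le> E r (L r) - E r (u r)" if "0 < r" "r \<le> T" for r
    using B2(1)[of r] B2(2)[of r] that by (intro jump_energy_left[OF bound]) (auto simp: B_def)
  have right: "dr r \<le> E r (u r) - E r (R r)" if "0 \<le> r" "r < T" for r
    using B2(1)[of r] B2(3)[of r] that by (intro jump_energy_right[OF bound]) (auto simp: B_def)
  show thesis
  proof (rule that[OF \<epsilon> \<epsilon>_lim u_lim admissible_BV[OF u_adm]])
    show "- dx E t (u t) \<in> subdiff0 \<Psi>" if "t \<in> {0..T}" "continuous (at t within {0..T}) u" for t
      using stable_continuity_point[OF C stab that] by (simp add: stable_def)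
    fix s t assume st: "0 \<le> s" "s \<le> t" "t \<le> T"
    have "G u s t = D s t + S s t"
      using G_le_Diss_new[OF C stab st] Diss_new_le_G[OF left right st] by (rule antisym)
    then show "ereal (E t (u t) - E s (u s)) =
        ereal (LINT r:{s..t}|lebesgue. dt T E r (u r)) - Diss_new nrm T E \<Psi> u s t"
      unfolding Diss_new_eq[OF st] using power_integral_lebesgue[OF admissibleD(2,3)[OF u_adm] st(1,3)]
      by (simp add: G_def)
  qed
qed

end

theorem theorem1:
  fixes T lam :: real
    and nrm :: "real ^ 'd \<Rightarrow> real"
    and E :: "real \<Rightarrow> real ^ 'd \<Rightarrow> real"
    and \<Psi> :: "real ^ 'd \<Rightarrow> real"
    and x0 :: "real ^ 'd"
  assumes "0 < T"
    and "is_norm nrm"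
    and "has_C1_boundary {x. nrm x \<le> 1}"
    and "\<forall>t\<in>{0..T}. \<forall>x. 0 \<le> E t x"
    and "C1_on ({0..T} \<times> UNIV) (\<lambda>(t, x). E t x)"
    and "\<forall>s\<in>{0..T}. \<forall>x. \<bar>dt T E s x\<bar> \<le> lam * E s x"
    and "\<forall>v. 0 \<le> \<Psi> v"
    and "convex_on UNIV \<Psi>"
    and "\<forall>c>0. \<forall>v. \<Psi> (c *\<^sub>R v) = c * \<Psi> v"
    and "\<forall>v. v \<noteq> 0 \<longrightarrow> 0 < \<Psi> v"
    and "\<forall>\<^sub>F x in nhds x0. E 0 x0 + \<Psi> (x0 - x0) \<le> E 0 x + \<Psi> (x - x0)"
  shows
    "(\<forall>\<epsilon>>0. \<forall>\<tau>>0. \<exists>x. discretized_solution nrm T E \<Psi> x0 \<epsilon> \<tau> x) \<and>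
     (\<forall>X :: real \<Rightarrow> real \<Rightarrow> real \<Rightarrow> real ^ 'd.
        (\<forall>\<epsilon>>0. \<forall>\<tau>>0. discretized_solution nrm T E \<Psi> x0 \<epsilon> \<tau> (X \<epsilon> \<tau>)) \<longrightarrow>
        (\<exists>C :: real. \<forall>\<epsilon>>0.
           (\<exists>x. eps_neighborhood_solution T (X \<epsilon>) x) \<and>
           (\<forall>x. eps_neighborhood_solution T (X \<epsilon>) x \<longrightarrow>
              (\<forall>t\<in>{0..<T}. (x \<longlongrightarrow> x t) (at_right t) \<longrightarrow>
                 (\<forall>y. nrm (y - x t) \<le> \<epsilon> \<longrightarrow> E t (x t) \<le> E t y + \<Psi> (y - x t))) \<and>
              Diss \<Psi> x 0 T \<le> ereal C \<and>
              set_integrable lebesgue {0<..<T} (\<lambda>r. dt T E r (x r)) \<and>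
              (\<forall>s t. 0 \<le> s \<and> s \<le> t \<and> t \<le> T \<longrightarrow>
                 - Diss_new nrm T E \<Psi> x s t
                   \<le> ereal (E t (x t) - E s (x s) - (LINT r:{s..t}|lebesgue. dt T E r (x r))) \<and>
                 ereal (E t (x t) - E s (x s) - (LINT r:{s..t}|lebesgue. dt T E r (x r)))
                   \<le> - Diss \<Psi> x s t))) \<and>
        (\<forall>x :: real \<Rightarrow> real \<Rightarrow> real ^ 'd.
           (\<forall>\<epsilon>>0. eps_neighborhood_solution T (X \<epsilon>) (x \<epsilon>)) \<longrightarrow>
           (\<exists>(\<epsilon> :: nat \<Rightarrow> real) (u :: real \<Rightarrow> real ^ 'd).
              (\<forall>n. 0 < \<epsilon> n) \<and> \<epsilon> \<longlonglongrightarrow> 0 \<and>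
              (\<forall>t\<in>{0..T}. (\<lambda>n. x (\<epsilon> n) t) \<longlonglongrightarrow> u t) \<and>
              BV_on 0 T u \<and>
              (\<forall>t\<in>{0..T}. continuous (at t within {0..T}) u \<longrightarrow> - dx E t (u t) \<in> subdiff0 \<Psi>) \<and>
              (\<forall>s t. 0 \<le> s \<and> s \<le> t \<and> t \<le> T \<longrightarrow>
                 ereal (E t (u t) - E s (u s)) =
                 ereal (LINT r:{s..t}|lebesgue. dt T E r (u r)) - Diss_new nrm T E \<Psi> u s t))))"
proof -
  interpret rate_independent T lam nrm E \<Psi>
    using assms(1-10) by unfold_locales auto
  show ?thesis
  proof (intro conjI allI impI)
    show "\<exists>x. discretized_solution nrm T E \<Psi> x0 \<epsilon> \<tau> x" if "0 < \<epsilon>" "0 < \<tau>" for \<epsilon> \<tau>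
      using discretized_solution_exists[OF that] .
  next
    fix X :: "real \<Rightarrow> real \<Rightarrow> real \<Rightarrow> real ^ 'd"
    assume "\<forall>\<epsilon>>0. \<forall>\<tau>>0. discretized_solution nrm T E \<Psi> x0 \<epsilon> \<tau> (X \<epsilon> \<tau>)"
    then have X: "discretized_solution nrm T E \<Psi> x0 \<epsilon> \<tau> (X \<epsilon> \<tau>)" if "0 < \<epsilon>" "0 < \<tau>" for \<epsilon> \<tau>
      using that by blast
    show "\<exists>C :: real. \<forall>\<epsilon>>0.
           (\<exists>x. eps_neighborhood_solution T (X \<epsilon>) x) \<and>
           (\<forall>x. eps_neighborhood_solution T (X \<epsilon>) x \<longrightarrow>
              (\<forall>t\<in>{0..<T}. (x \<longlongrightarrow> x t) (at_right t) \<longrightarrow>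
                 (\<forall>y. nrm (y - x t) \<le> \<epsilon> \<longrightarrow> E t (x t) \<le> E t y + \<Psi> (y - x t))) \<and>
              Diss \<Psi> x 0 T \<le> ereal C \<and>
              set_integrable lebesgue {0<..<T} (\<lambda>r. dt T E r (x r)) \<and>
              (\<forall>s t. 0 \<le> s \<and> s \<le> t \<and> t \<le> T \<longrightarrow>
                 - Diss_new nrm T E \<Psi> x s t
                   \<le> ereal (E t (x t) - E s (x s) - (LINT r:{s..t}|lebesgue. dt T E r (x r))) \<and>
                 ereal (E t (x t) - E s (x s) - (LINT r:{s..t}|lebesgue. dt T E r (x r)))
                   \<le> - Diss \<Psi> x s t))"
    \<comment> \<open>The constant is the bound of \<open>G_le\<close> with the Gronwall bound as
      energy level; it depends on the data only.\<close>
    proof (intro exI[of _ "energy_bound x0 + \<bar>lam\<bar> * energy_bound x0 * T"] allI impI conjI ballI)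
      fix \<epsilon> :: real assume \<epsilon>: "0 < \<epsilon>"
      have Y: "discretized_solution nrm T E \<Psi> x0 \<epsilon> \<tau> (X \<epsilon> \<tau>)" if "0 < \<tau>" for \<tau>
        using X[OF \<epsilon> that] .
      show "\<exists>x. eps_neighborhood_solution T (X \<epsilon>) x"
        by (rule eps_solution_exists[OF \<epsilon> Y])
      fix x assume x: "eps_neighborhood_solution T (X \<epsilon>) x"
      note props = eps_solution_properties[OF \<epsilon> Y x]
      show "E t (x t) \<le> E t y + \<Psi> (y - x t)"
        if "t \<in> {0..<T}" "(x \<longlongrightarrow> x t) (at_right t)" "nrm (y - x t) \<le> \<epsilon>" for t y
        using that(1) by (intro eps_solution_stable[OF \<epsilon> Y x _ _ that(2,3)]) auto
      show "Diss \<Psi> x 0 T \<le> ereal (energy_bound x0 + \<bar>lam\<bar> * energy_bound x0 * T)" by (rule props(1))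
      show "set_integrable lebesgue {0<..<T} (\<lambda>r. dt T E r (x r))" by (rule props(2))
      fix s t assume "0 \<le> s \<and> s \<le> t \<and> t \<le> T"
      then have st: "0 \<le> s" "s \<le> t" "t \<le> T" by auto
      show "- Diss_new nrm T E \<Psi> x s t
          \<le> ereal (E t (x t) - E s (x s) - (LINT r:{s..t}|lebesgue. dt T E r (x r)))" using st by (intro props(3)) auto
      show "ereal (E t (x t) - E s (x s) - (LINT r:{s..t}|lebesgue. dt T E r (x r))) \<le> - Diss \<Psi> x s t"
        using st by (intro props(4)) auto
    qed
    fix x :: "real \<Rightarrow> real \<Rightarrow> real ^ 'd"
    assume "\<forall>\<epsilon>>0. eps_neighborhood_solution T (X \<epsilon>) (x \<epsilon>)"
    then have x: "eps_neighborhood_solution T (X \<epsilon>) (x \<epsilon>)" if "0 < \<epsilon>" for \<epsilon> using that by blast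
    show "\<exists>(\<epsilon> :: nat \<Rightarrow> real) (u :: real \<Rightarrow> real ^ 'd).
              (\<forall>n. 0 < \<epsilon> n) \<and> \<epsilon> \<longlonglongrightarrow> 0 \<and>
              (\<forall>t\<in>{0..T}. (\<lambda>n. x (\<epsilon> n) t) \<longlonglongrightarrow> u t) \<and>
              BV_on 0 T u \<and>
              (\<forall>t\<in>{0..T}. continuous (at t within {0..T}) u \<longrightarrow> - dx E t (u t) \<in> subdiff0 \<Psi>) \<and>
              (\<forall>s t. 0 \<le> s \<and> s \<le> t \<and> t \<le> T \<longrightarrow>
                 ereal (E t (u t) - E s (u s)) =
                 ereal (LINT r:{s..t}|lebesgue. dt T E r (u r)) - Diss_new nrm T E \<Psi> u s t)"
    proof (rule BV_solution_exists)
      show "discretized_solution nrm T E \<Psi> x0 \<epsilon> \<tau> (X \<epsilon> \<tau>)" if "0 < \<epsilon>" "0 < \<tau>" for \<epsilon> \<tau>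
        using X[OF that] .
      show "eps_neighborhood_solution T (X \<epsilon>) (x \<epsilon>)" if "0 < \<epsilon>" for \<epsilon>
        using x[OF that] .
      fix \<epsilon> :: "nat \<Rightarrow> real" and u
      assume "\<And>n. 0 < \<epsilon> n" "\<epsilon> \<longlonglongrightarrow> 0"
        "\<And>t. t \<in> {0..T} \<Longrightarrow> (\<lambda>n. x (\<epsilon> n) t) \<longlonglongrightarrow> u t" "BV_on 0 T u"
        "\<And>t. \<lbrakk>t \<in> {0..T}; continuous (at t within {0..T}) u\<rbrakk> \<Longrightarrow> - dx E t (u t) \<in> subdiff0 \<Psi>"
        "\<And>s t. \<lbrakk>0 \<le> s; s \<le> t; t \<le> T\<rbrakk> \<Longrightarrow> ereal (E t (u t) - E s (u s)) =
           ereal (LINT r:{s..t}|lebesgue. dt T E r (u r)) - Diss_new nrm T E \<Psi> u s t"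
      then show ?thesis
        by (intro exI[of _ \<epsilon>] exI[of _ u] conjI ballI allI impI) auto
    qed
  qed
qed

end
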